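(* Let $\partial:L_1\to L_0$ be a crossed module of Lie algebras over $k$, denoted $L_*$. Let ${\bf Z}_0(L_* )$ be the vector space of all pairs $(x,\xi)$, where $x\in L_0$ and $\xi:L_0\to L_1$ is a linear map such that for all $s,t\in L_0$ and $a\in L_1$ $$\partial\xi(t)=[x,t],\qquad \xi(\partial a)=x\cdot a,\qquad \xi([s,t])=s\cdot\xi(t)-t\cdot\xi(s).$$ (i) For $c\in L_1$ put $\delta(c)=(\partial(c),\xi_c)$, where $\xi_c(t)=-t\cdot c$. Then $\delta$ is a linear map $L_1\to {\bf Z}_0(L_* )$ and, together with the bilinear map ${\bf Z}_0(L_* )\times{\bf Z}_0(L_* )\to L_1$ given by $$\{(x,\xi),(y,\eta)\}=\xi(y),$$ it is a braided crossed module of Lie algebras. This braided crossed module is denoted by ${\bf Z}_*(L_* )$ and called the centre of $L_*$. (ii) Let ${\sf z}_0:{\bf Z}_0(L_* )\to L_0$ be the map ${\sf z}_0(x,\xi)=x$. For $y\in L_0$ and $(x,\xi)\in{\bf Z}_0(L_* )$ put $$y\cdot(x,\xi):=([y,x],\psi),\qquad \psi(t)=t\cdot\xi(y).$$ This defines an action of $L_0$ on ${\bf Z}_0(L_* )$, and with this action ${\sf z}_0:{\bf Z}_0(L_* )\to L_0$ is a crossed module of Lie algebras. (iii) One has $$\pi_1({\bf Z}_*(L_* ))\cong H^0(\pi_0(L_* ),\pi_1(L_* )),$$ and there is an exact sequence $$0\to H^1(\pi_0(L_* ),\pi_1(L_* ))\to\pi_0({\bf Z}_*(L_* ))\to {\sf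 Z}_{\pi_1(L_* )}(\pi_0(L_* ))\to H^2(\pi_0(L_* ),\pi_1(L_* )).$$
   Context: Fix a field $k$ of characteristic $\neq 2$; all vector spaces, Lie algebras and (bi)linear maps are over $k$. A crossed module of Lie algebras $L_*=(L_1\xrightarrow{\partial}L_0)$ consists of a Lie algebra $L_0$, an $L_0$-module $L_1$ (with action $(x,a)\mapsto x\cdot a$, so $[x,y]\cdot a=x\cdot(y\cdot a)-y\cdot(x\cdot a)$), and a linear map $\partial:L_1\to L_0$ which is a homomorphism of $L_0$-modules, i.e. $\partial(x\cdot a)=[x,\partial a]$, such that $\partial(a)\cdot b+\partial(b)\cdot a=0$ for all $a,b\in L_1$. Then $L_1$ is a Lie algebra with bracket $[a,b]=\partial(a)\cdot b$, and $L_0$ acts on it by derivations. A braided crossed module of Lie algebras is a linear map of vector spaces $\partial:L_1\to L_0$ together with a bilinear map $L_0\times L_0\to L_1$, $(x,y)\mapsto\{x,y\}$, such that for all $a\in L_1$ and $x,u,v,w\in L_0$: $\{\partial a,x\}+\{x,\partial a\}=0$; $\partial\{x,x\}=0$; $\{u,\partial\{v,w\}\}+\{w,\partial\{u,v\}\}+\{v,\partial\{w,u\}\}=0$. Any braided crossed module is a crossed module with $[x,y]=\partial\{x,y\}$ on $L_0$ and $x\cdot a=\{x,\partial a\}$. In particular ${\bf Z}_0(L_* )$ carries the Lie bracket $[u,v]=\delta\{u,v\}$. For a (braided) crossed module, $\pi_0(L_* )=\mathrm{Coker}(\partial)$ (a Lie algebra) and $\pi_1(L_* )=\mathrm{Ker}(\partial)$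 (a $\pi_0(L_* )$-module via the action induced by that of $L_0$ on $L_1$). In particular $\pi_0({\bf Z}_*(L_* ))=\mathrm{Coker}(\delta)$ and $\pi_1({\bf Z}_*(L_* ))=\mathrm{Ker}(\delta)$. $H^i(M,A)$ denotes Lie algebra (Chevalley–Eilenberg) cohomology of a Lie algebra $M$ with coefficients in an $M$-module $A$. ${\sf Z}_A(M)$ is the set of all $m\in M$ such that $[m,x]=0$ for all $x\in M$ and $m\cdot a=0$ for all $a\in A$. *)

theory Defs
  imports "HOL-Algebra.Module" "HOL-Algebra.AbelCoset"
begin

text \<open>
  A vector space over a field \<open>k\<close> is a module in the sense of the locale \<^locale>\<open>module\<close>. The record
  \<^type>\<open>module\<close> extends the ring record; its fields \<open>mult\<close> and \<open>one\<close> play no role for modules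
  and are left \<^const>\<open>undefined\<close> in the records built below.

  Function spaces consist of extensional functions, so that a linear map on a carrier is determined
  by its values on that carrier.
\<close>

section \<open>Linear algebra\<close>

definition lin_hom :: "('k, 'r) ring_scheme \<Rightarrow> ('k, 'v, 'm) module_scheme \<Rightarrow>
    ('k, 'w, 'n) module_scheme \<Rightarrow> ('v \<Rightarrow> 'w) set" where
  "lin_hom k V W = {f \<in> carrier V \<rightarrow> carrier W.
     (\<forall>x\<in>carrier V. \<forall>y\<in>carrier V. f (x \<oplus>\<^bsub>V\<^esub> y) = f x \<oplus>\<^bsub>W\<^esub> f y) \<and>
     (\<forall>r\<in>carrier k. \<forall>x\<in>carrier V. f (r \<odot>\<^bsub>V\<^esub> x) = r \<odot>\<^bsub>W\<^esub> f x)}"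

definition bilinear_on :: "('k, 'r) ring_scheme \<Rightarrow> ('k, 'u, 'l) module_scheme \<Rightarrow>
    ('k, 'v, 'm) module_scheme \<Rightarrow> ('k, 'w, 'n) module_scheme \<Rightarrow> ('u \<Rightarrow> 'v \<Rightarrow> 'w) \<Rightarrow> bool" where
  "bilinear_on k U V W f \<longleftrightarrow>
     (\<forall>u\<in>carrier U. (\<lambda>v. f u v) \<in> lin_hom k V W) \<and>
     (\<forall>v\<in>carrier V. (\<lambda>u. f u v) \<in> lin_hom k U W)"

definition lin_iso :: "('k, 'r) ring_scheme \<Rightarrow> ('k, 'v, 'm) module_scheme \<Rightarrow>
    ('k, 'w, 'n) module_scheme \<Rightarrow> bool" where
  "lin_iso k V W \<longleftrightarrow> (\<exists>f\<in>lin_hom k V W. bij_betw f (carrier V) (carrier W))"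

definition exact_at :: "('k, 'u, 'l) module_scheme \<Rightarrow> ('u \<Rightarrow> 'v) \<Rightarrow>
    ('k, 'v, 'm) module_scheme \<Rightarrow> ('v \<Rightarrow> 'w) \<Rightarrow> ('k, 'w, 'n) module_scheme \<Rightarrow> bool" where
  "exact_at U f V g W \<longleftrightarrow> f ` carrier U = a_kernel V W g"

definition quot_space :: "('k, 'v, 'm) module_scheme \<Rightarrow> 'v set \<Rightarrow> ('k, 'v set) module" where
  "quot_space V S =
     \<lparr>carrier = a_rcosets\<^bsub>V\<^esub> S, mult = undefined, one = undefined, zero = S, add = set_add V,
      smult = (\<lambda>r U. \<Union>x\<in>U. S +>\<^bsub>V\<^esub> (r \<odot>\<^bsub>V\<^esub> x))\<rparr>"

definition fun_space :: "'t set \<Rightarrow> ('k, 'v, 'm) module_scheme \<Rightarrow> ('k, 't \<Rightarrow> 'v) module" where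
  "fun_space T V =
     \<lparr>carrier = T \<rightarrow>\<^sub>E carrier V, mult = undefined, one = undefined,
      zero = (\<lambda>t\<in>T. \<zero>\<^bsub>V\<^esub>), add = (\<lambda>f g. \<lambda>t\<in>T. f t \<oplus>\<^bsub>V\<^esub> g t),
      smult = (\<lambda>r f. \<lambda>t\<in>T. r \<odot>\<^bsub>V\<^esub> f t)\<rparr>"

section \<open>Lie algebras and their modules\<close>

record ('k, 'v) lie_algebra = "('k, 'v) module" +
  bracket :: "'v \<Rightarrow> 'v \<Rightarrow> 'v"

locale lie_algebra = module k M for k (structure) and M (structure) +
  assumes bracket_bilinear: "bilinear_on k M M M (bracket M)"
    and bracket_self: "x \<in> carrier M \<Longrightarrow> bracket M x x = \<zero>\<^bsub>M\<^esub>"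
    and jacobi: "\<lbrakk>x \<in> carrier M; y \<in> carrier M; z \<in> carrier M\<rbrakk> \<Longrightarrow>
      bracket M x (bracket M y z) \<oplus>\<^bsub>M\<^esub> bracket M y (bracket M z x)
        \<oplus>\<^bsub>M\<^esub> bracket M z (bracket M x y) = \<zero>\<^bsub>M\<^esub>"

locale lie_module = M?: lie_algebra k M + A?: module k A
    for k (structure) and M (structure) and A (structure) +
  fixes act :: "'b \<Rightarrow> 'c \<Rightarrow> 'c"
  assumes act_bilinear: "bilinear_on k M A A act"
    and act_bracket: "\<lbrakk>x \<in> carrier M; y \<in> carrier M; a \<in> carrier A\<rbrakk> \<Longrightarrow>
      act (bracket M x y) a = act x (act y a) \<ominus>\<^bsub>A\<^esub> act y (act x a)"

definition lie_quot :: "('k, 'v, 'm) lie_algebra_scheme \<Rightarrow> 'v set \<Rightarrow> ('k, 'v set) lie_algebra" where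
  "lie_quot M I =
     \<lparr>carrier = a_rcosets\<^bsub>M\<^esub> I, mult = undefined, one = undefined, zero = I, add = set_add M,
      smult = (\<lambda>r U. \<Union>x\<in>U. I +>\<^bsub>M\<^esub> (r \<odot>\<^bsub>M\<^esub> x)),
      bracket = (\<lambda>U V. \<Union>x\<in>U. \<Union>y\<in>V. I +>\<^bsub>M\<^esub> bracket M x y)\<rparr>"

text \<open>The subspace of central elements of \<open>M\<close> that act trivially on \<open>A\<close>.\<close>

definition central_annihilator :: "('k, 'v, 'm) lie_algebra_scheme \<Rightarrow> ('k, 'a, 'n) module_scheme \<Rightarrow>
    ('v \<Rightarrow> 'a \<Rightarrow> 'a) \<Rightarrow> ('k, 'v, 'm) lie_algebra_scheme" where
  "central_annihilator M A act = M\<lparr>carrier := {m \<in> carrier M.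
     (\<forall>x\<in>carrier M. bracket M m x = \<zero>\<^bsub>M\<^esub>) \<and> (\<forall>a\<in>carrier A. act m a = \<zero>\<^bsub>A\<^esub>)}\<rparr>"

section \<open>Chevalley--Eilenberg cohomology\<close>

text \<open>An \<open>n\<close>-tuple is a list of length \<open>n\<close>; an \<open>n\<close>-cochain is an alternating multilinear function of
  such tuples.\<close>

definition tuples :: "('k, 'v, 'm) module_scheme \<Rightarrow> nat \<Rightarrow> 'v list set" where
  "tuples M n = {xs. length xs = n \<and> set xs \<subseteq> carrier M}"

definition omit :: "nat \<Rightarrow> 'v list \<Rightarrow> 'v list" where
  "omit i xs = take i xs @ drop (Suc i) xs"

definition alternate_sign :: "('k, 'a, 'n) module_scheme \<Rightarrow> nat \<Rightarrow> 'a \<Rightarrow> 'a" where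
  "alternate_sign A i a = (if even i then a else \<ominus>\<^bsub>A\<^esub> a)"

definition ce_cochains :: "('k, 'r) ring_scheme \<Rightarrow> ('k, 'v, 'm) module_scheme \<Rightarrow>
    ('k, 'a, 'n) module_scheme \<Rightarrow> nat \<Rightarrow> ('k, 'v list \<Rightarrow> 'a) module" where
  "ce_cochains k M A n = (fun_space (tuples M n) A)\<lparr>carrier :=
     {\<omega> \<in> tuples M n \<rightarrow>\<^sub>E carrier A.
        (\<forall>xs\<in>tuples M n. \<forall>i<n. (\<lambda>x. \<omega> (xs[i := x])) \<in> lin_hom k M A) \<and>
        (\<forall>xs\<in>tuples M n. \<not> distinct xs \<longrightarrow> \<omega> xs = \<zero>\<^bsub>A\<^esub>)}\<rparr>"

text \<open>\<open>(d \<omega>)(x\<^sub>0,\<dots>,x\<^sub>n) = \<Sum>\<^sub>i (-1)\<^sup>i x\<^sub>i \<cdot> \<omega>(\<dots>, x\<^sub>i omitted, \<dots>)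
    + \<Sum>\<^sub>i\<^sub><\<^sub>j (-1)\<^sup>i\<^sup>+\<^sup>j \<omega>([x\<^sub>i,x\<^sub>j], \<dots>, x\<^sub>i and x\<^sub>j omitted, \<dots>)\<close>\<close>

definition ce_diff :: "('k, 'v, 'm) lie_algebra_scheme \<Rightarrow> ('k, 'a, 'n) module_scheme \<Rightarrow>
    ('v \<Rightarrow> 'a \<Rightarrow> 'a) \<Rightarrow> nat \<Rightarrow> ('v list \<Rightarrow> 'a) \<Rightarrow> 'v list \<Rightarrow> 'a" where
  "ce_diff M A act n \<omega> = (\<lambda>xs\<in>tuples M (Suc n).
     (\<Oplus>\<^bsub>A\<^esub>i\<in>{..n}. alternate_sign A i (act (xs ! i) (\<omega> (omit i xs)))) \<oplus>\<^bsub>A\<^esub>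
     (\<Oplus>\<^bsub>A\<^esub>p\<in>{(i, j). i < j \<and> j \<le> n}. alternate_sign A (fst p + snd p)
        (\<omega> (bracket M (xs ! fst p) (xs ! snd p) # omit (fst p) (omit (snd p) xs)))))"

definition ce_cocycles :: "('k, 'r) ring_scheme \<Rightarrow> ('k, 'v, 'm) lie_algebra_scheme \<Rightarrow>
    ('k, 'a, 'n) module_scheme \<Rightarrow> ('v \<Rightarrow> 'a \<Rightarrow> 'a) \<Rightarrow> nat \<Rightarrow> ('v list \<Rightarrow> 'a) set" where
  "ce_cocycles k M A act n =
     a_kernel (ce_cochains k M A n) (ce_cochains k M A (Suc n)) (ce_diff M A act n)"

definition ce_coboundaries :: "('k, 'r) ring_scheme \<Rightarrow> ('k, 'v, 'm) lie_algebra_scheme \<Rightarrow>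
    ('k, 'a, 'n) module_scheme \<Rightarrow> ('v \<Rightarrow> 'a \<Rightarrow> 'a) \<Rightarrow> nat \<Rightarrow> ('v list \<Rightarrow> 'a) set" where
  "ce_coboundaries k M A act n = (case n of
     0 \<Rightarrow> {\<zero>\<^bsub>ce_cochains k M A 0\<^esub>}
   | Suc m \<Rightarrow> ce_diff M A act m ` carrier (ce_cochains k M A m))"

definition ce_cohomology :: "('k, 'r) ring_scheme \<Rightarrow> ('k, 'v, 'm) lie_algebra_scheme \<Rightarrow>
    ('k, 'a, 'n) module_scheme \<Rightarrow> ('v \<Rightarrow> 'a \<Rightarrow> 'a) \<Rightarrow> nat \<Rightarrow> ('k, ('v list \<Rightarrow> 'a) set) module" where
  "ce_cohomology k M A act n =
     quot_space ((ce_cochains k M A n)\<lparr>carrier := ce_cocycles k M A act n\<rparr>)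
       (ce_coboundaries k M A act n)"

definition ce_class :: "('k, 'r) ring_scheme \<Rightarrow> ('k, 'v, 'm) lie_algebra_scheme \<Rightarrow>
    ('k, 'a, 'n) module_scheme \<Rightarrow> ('v \<Rightarrow> 'a \<Rightarrow> 'a) \<Rightarrow> nat \<Rightarrow> ('v list \<Rightarrow> 'a) \<Rightarrow> ('v list \<Rightarrow> 'a) set" where
  "ce_class k M A act n \<omega> = ce_coboundaries k M A act n +>\<^bsub>ce_cochains k M A n\<^esub> \<omega>"

section \<open>Crossed modules\<close>

locale crossed_module = lie_module k L0 L1 act
    for k (structure) and L1 (structure) and L0 (structure) and act +
  fixes bd :: "'c \<Rightarrow> 'b"
  assumes bd_linear: "bd \<in> lin_hom k L1 L0"
    and bd_act: "\<lbrakk>x \<in> carrier L0; a \<in> carrier L1\<rbrakk> \<Longrightarrow> bd (act x a) = bracket L0 x (bd a)"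
    and act_bd: "\<lbrakk>a \<in> carrier L1; b \<in> carrier L1\<rbrakk> \<Longrightarrow>
      act (bd a) b \<oplus>\<^bsub>L1\<^esub> act (bd b) a = \<zero>\<^bsub>L1\<^esub>"

locale braided_crossed_module = L1?: module k L1 + L0?: module k L0
    for k (structure) and L1 (structure) and L0 (structure) +
  fixes bd :: "'b \<Rightarrow> 'c" and br :: "'c \<Rightarrow> 'c \<Rightarrow> 'b"
  assumes bd_linear: "bd \<in> lin_hom k L1 L0"
    and br_bilinear: "bilinear_on k L0 L0 L1 br"
    and br_bd: "\<lbrakk>a \<in> carrier L1; x \<in> carrier L0\<rbrakk> \<Longrightarrow>
      br (bd a) x \<oplus>\<^bsub>L1\<^esub> br x (bd a) = \<zero>\<^bsub>L1\<^esub>"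
    and bd_br: "x \<in> carrier L0 \<Longrightarrow> bd (br x x) = \<zero>\<^bsub>L0\<^esub>"
    and br_jacobi: "\<lbrakk>u \<in> carrier L0; v \<in> carrier L0; w \<in> carrier L0\<rbrakk> \<Longrightarrow>
      br u (bd (br v w)) \<oplus>\<^bsub>L1\<^esub> br w (bd (br u v)) \<oplus>\<^bsub>L1\<^esub> br v (bd (br w u)) = \<zero>\<^bsub>L1\<^esub>"

definition cm_pi0 :: "('k, 'a, 'm) module_scheme \<Rightarrow> ('k, 'b, 'n) lie_algebra_scheme \<Rightarrow>
    ('a \<Rightarrow> 'b) \<Rightarrow> ('k, 'b set) lie_algebra" where
  "cm_pi0 L1 L0 bd = lie_quot L0 (bd ` carrier L1)"

definition cm_pi1 :: "('k, 'a, 'm) module_scheme \<Rightarrow> ('k, 'b, 'n) module_scheme \<Rightarrow>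
    ('a \<Rightarrow> 'b) \<Rightarrow> ('k, 'a, 'm) module_scheme" where
  "cm_pi1 L1 L0 bd = L1\<lparr>carrier := a_kernel L1 L0 bd\<rparr>"

text \<open>The action of a coset on \<open>Ker \<partial>\<close>: all its elements act on \<open>Ker \<partial>\<close> in the same way.\<close>

definition pi_act :: "('b \<Rightarrow> 'a \<Rightarrow> 'a) \<Rightarrow> 'b set \<Rightarrow> 'a \<Rightarrow> 'a" where
  "pi_act act U a = the_elem ((\<lambda>x. act x a) ` U)"

section \<open>The centre of a crossed module\<close>

definition centre_bd :: "('k, 'a, 'm) module_scheme \<Rightarrow> ('k, 'b, 'n) lie_algebra_scheme \<Rightarrow>
    ('b \<Rightarrow> 'a \<Rightarrow> 'a) \<Rightarrow> ('a \<Rightarrow> 'b) \<Rightarrow> 'a \<Rightarrow> 'b \<times> ('b \<Rightarrow> 'a)" where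
  "centre_bd L1 L0 act bd c = (bd c, \<lambda>t\<in>carrier L0. \<ominus>\<^bsub>L1\<^esub> act t c)"

definition centre_br :: "'b \<times> ('b \<Rightarrow> 'a) \<Rightarrow> 'b \<times> ('b \<Rightarrow> 'a) \<Rightarrow> 'a" where
  "centre_br u v = snd u (fst v)"

definition centre0 :: "('k, 'r) ring_scheme \<Rightarrow> ('k, 'a, 'm) module_scheme \<Rightarrow>
    ('k, 'b, 'n) lie_algebra_scheme \<Rightarrow> ('b \<Rightarrow> 'a \<Rightarrow> 'a) \<Rightarrow> ('a \<Rightarrow> 'b) \<Rightarrow>
    ('k, 'b \<times> ('b \<Rightarrow> 'a)) lie_algebra" where
  "centre0 k L1 L0 act bd =
     \<lparr>carrier = {(x, \<xi>). x \<in> carrier L0 \<and> \<xi> \<in> lin_hom k L0 L1 \<and> \<xi> \<in> extensional (carrier L0) \<and>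
        (\<forall>t\<in>carrier L0. bd (\<xi> t) = bracket L0 x t) \<and>
        (\<forall>a\<in>carrier L1. \<xi> (bd a) = act x a) \<and>
        (\<forall>s\<in>carrier L0. \<forall>t\<in>carrier L0.
           \<xi> (bracket L0 s t) = act s (\<xi> t) \<ominus>\<^bsub>L1\<^esub> act t (\<xi> s))},
      mult = undefined, one = undefined,
      zero = (\<zero>\<^bsub>L0\<^esub>, \<zero>\<^bsub>fun_space (carrier L0) L1\<^esub>),
      add = (\<lambda>(x, \<xi>) (y, \<eta>). (x \<oplus>\<^bsub>L0\<^esub> y, \<xi> \<oplus>\<^bsub>fun_space (carrier L0) L1\<^esub> \<eta>)),
      smult = (\<lambda>r (x, \<xi>). (r \<odot>\<^bsub>L0\<^esub> x, r \<odot>\<^bsub>fun_space (carrier L0) L1\<^esub> \<xi>)),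
      bracket = (\<lambda>u v. centre_bd L1 L0 act bd (centre_br u v))\<rparr>"

definition centre_act :: "('k, 'b, 'n) lie_algebra_scheme \<Rightarrow> ('b \<Rightarrow> 'a \<Rightarrow> 'a) \<Rightarrow>
    'b \<Rightarrow> 'b \<times> ('b \<Rightarrow> 'a) \<Rightarrow> 'b \<times> ('b \<Rightarrow> 'a)" where
  "centre_act L0 act y = (\<lambda>(x, \<xi>). (bracket L0 y x, \<lambda>t\<in>carrier L0. act t (\<xi> y)))"

end

theory Submission
  imports Defs
begin

text \<open>
  The action of \<open>L\<^sub>0\<close> on the centre is \<open>y \<cdot> (x, \<xi>) = \<delta>(- \<xi>(y))\<close>, and both crossed module structures rest on
  the identity \<open>t \<cdot> \<xi>(x) = 0\<close>: since \<open>[x, t] = \<partial>\<xi>(t)\<close>, the value \<open>\<xi>[x, t]\<close> is both \<open>x \<cdot> \<xi>(t)\<close> and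
  \<open>x \<cdot> \<xi>(t) - t \<cdot> \<xi>(x)\<close>.

  For the exact sequence, drop from the definition of the centre the condition that \<open>\<xi>\<close> is a
  derivation. By a Zorn argument every element of the subspace of central elements of \<open>\<pi>\<^sub>0\<close>
  annihilating \<open>\<pi>\<^sub>1\<close> is the class of the first component of such a pair \<open>(x, \<xi>)\<close>. The
  failure of \<open>\<xi>\<close> to be a derivation takes values in \<open>\<pi>\<^sub>1\<close> and descends to a 2-cocycle on \<open>\<pi>\<^sub>0\<close>;
  as pairs with \<open>x = 0\<close> are exactly the 1-cochains, its class depends only on the class of \<open>x\<close>, and
  it vanishes iff \<open>\<xi>\<close> can be corrected to a derivation.
\<close>

section \<open>Linear maps, quotients and complements\<close>

text \<open>No finiteness of dimension is assumed, so for a given \<open>x\<close> the map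
  \<open>\<xi>\<close> with its prescribed values on the image of \<open>\<partial>\<close> has to
  come from a choice. That choice is made for one \<open>x\<close> at a time and is not linear in
  \<open>x\<close>. Linearity of the map to \<open>H 2\<close> has another source: the pairs in
  \<open>lifts\<close> form a vector space, the obstruction is linear on it, and the projection of
  this space onto the central elements is surjective, so the obstruction class factors through it.
  The other two maps arise in the same way, from the 1-cocycles and from the centre.
  Well-definedness and exactness then turn into questions about pairs whose first component lies in
  the image of \<open>\<partial>\<close>.

  The obstruction is the Chevalley--Eilenberg differential of \<open>\<xi>\<close>, seen as a
  1-cochain of \<open>L0\<close> with values in \<open>L1\<close>. This is why it is a cocycle. It
  need not be a coboundary on \<open>\<pi>\<^sub>0\<close>, since \<open>\<xi>\<close> itself
  neither descends to \<open>\<pi>\<^sub>0\<close> nor takes values in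
  \<open>\<pi>\<^sub>1\<close>.\<close>

context abelian_group begin

lemma a_inv_zero: "\<ominus> \<zero> = \<zero>"
  using minus_equality[of \<zero> \<zero>] by simp

text \<open>The method \<open>algebra\<close> comes with rewrite rules for rings only.\<close>

lemmas [algebra abelian_group "zero G" "add G" "a_inv G" "a_minus G"] =
  a_closed zero_closed a_inv_closed minus_closed a_assoc l_zero l_neg a_comm a_minus_def
  r_zero r_neg r_neg2 r_neg1 minus_add minus_minus a_inv_zero a_lcomm

lemma a_minus_eq_zero_iff: "a \<in> carrier G \<Longrightarrow> b \<in> carrier G \<Longrightarrow> a \<ominus> b = \<zero> \<longleftrightarrow> a = b"
  using minus_equality[of a "\<ominus> b"] minus_minus[of b] by (auto simp: a_minus_def r_neg)

lemma a_minus_eq_self_iff: "a \<in> carrier G \<Longrightarrow> b \<in> carrier G \<Longrightarrow> a = a \<ominus> b \<longleftrightarrow> b = \<zero>"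
  using add.l_cancel_one'[of a "\<ominus> b"] minus_minus[of b] by (auto simp: a_minus_def a_inv_zero)

end

section \<open>Linear maps between carriers\<close>

lemma lin_homD:
  assumes "f \<in> lin_hom k U V"
  shows "x \<in> carrier U \<Longrightarrow> f x \<in> carrier V"
    and "x \<in> carrier U \<Longrightarrow> y \<in> carrier U \<Longrightarrow> f (x \<oplus>\<^bsub>U\<^esub> y) = f x \<oplus>\<^bsub>V\<^esub> f y"
    and "r \<in> carrier k \<Longrightarrow> x \<in> carrier U \<Longrightarrow> f (r \<odot>\<^bsub>U\<^esub> x) = r \<odot>\<^bsub>V\<^esub> f x"
  using assms by (auto simp: lin_hom_def)

text \<open>The value at a point is read off from an arbitrary preimage. Since \<open>cong\<close>
  makes the choice irrelevant, sums and multiples of preimages serve as preimages of sums and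
  multiples, and linearity follows without a linear section of \<open>p\<close>. The three maps of
  the exact sequence are obtained in this way.\<close>

lemma factor_lin_hom:
  assumes p: "p \<in> lin_hom k E X" and F: "F \<in> lin_hom k E W"
    and onto: "p ` carrier E = carrier X"
    and closed: "\<And>u v. u \<in> carrier E \<Longrightarrow> v \<in> carrier E \<Longrightarrow> u \<oplus>\<^bsub>E\<^esub> v \<in> carrier E"
      "\<And>r u. r \<in> carrier k \<Longrightarrow> u \<in> carrier E \<Longrightarrow> r \<odot>\<^bsub>E\<^esub> u \<in> carrier E"
    and cong: "\<And>u v. u \<in> carrier E \<Longrightarrow> v \<in> carrier E \<Longrightarrow> p u = p v \<Longrightarrow> F u = F v"
  shows "\<exists>f\<in>lin_hom k X W. \<forall>u\<in>carrier E. f (p u) = F u"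
proof -
  define f where "f x = F (inv_into (carrier E) p x)" for x
  have f: "f (p u) = F u" if "u \<in> carrier E" for u
  proof -
    have "p u \<in> p ` carrier E" using that by blast
    then have "inv_into (carrier E) p (p u) \<in> carrier E" "p (inv_into (carrier E) p (p u)) = p u"
      by (rule inv_into_into, rule f_inv_into_f)
    then show ?thesis unfolding f_def using that cong by blast
  qed
  have ex: "\<exists>u\<in>carrier E. x = p u" if "x \<in> carrier X" for x
    using that onto by auto
  have "f \<in> lin_hom k X W"
    unfolding lin_hom_def
  proof (intro CollectI conjI ballI)
    show "f \<in> carrier X \<rightarrow> carrier W"
    proof
      fix x assume "x \<in> carrier X"
      then obtain u where "u \<in> carrier E" "x = p u" using ex by blast
      then show "f x \<in> carrier W" using lin_homD(1)[OF F] f by simp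
    qed
    show "f (x \<oplus>\<^bsub>X\<^esub> y) = f x \<oplus>\<^bsub>W\<^esub> f y" if xy: "x \<in> carrier X" "y \<in> carrier X" for x y
    proof -
      obtain u v where uv: "u \<in> carrier E" "v \<in> carrier E" "x = p u" "y = p v"
        using ex[OF xy(1)] ex[OF xy(2)] by blast
      then have "x \<oplus>\<^bsub>X\<^esub> y = p (u \<oplus>\<^bsub>E\<^esub> v)"
        using p by (simp add: lin_hom_def)
      then show ?thesis
        using uv F closed by (simp add: f lin_hom_def)
    qed
    show "f (r \<odot>\<^bsub>X\<^esub> x) = r \<odot>\<^bsub>W\<^esub> f x" if rx: "r \<in> carrier k" "x \<in> carrier X" for r x
    proof -
      obtain u where u: "u \<in> carrier E" "x = p u"
        using ex[OF rx(2)] by blast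
      then have "r \<odot>\<^bsub>X\<^esub> x = p (r \<odot>\<^bsub>E\<^esub> u)"
        using p rx by (simp add: lin_hom_def)
      then show ?thesis
        using u F closed rx by (simp add: f lin_hom_def)
    qed
  qed
  with f show ?thesis by blast
qed

lemma lin_hom_comp:
  assumes "f \<in> lin_hom k U V" "g \<in> lin_hom k V W"
  shows "(\<lambda>x. g (f x)) \<in> lin_hom k U W"
  using assms by (auto simp: lin_hom_def Pi_iff)

lemma lin_hom_cong:
  assumes "f \<in> lin_hom k U V"
    and "\<And>x. x \<in> carrier U \<Longrightarrow> f x = g x"
    and "\<And>x y. x \<in> carrier U \<Longrightarrow> y \<in> carrier U \<Longrightarrow> x \<oplus>\<^bsub>U\<^esub> y \<in> carrier U"
    and "\<And>r x. r \<in> carrier k \<Longrightarrow> x \<in> carrier U \<Longrightarrow> r \<odot>\<^bsub>U\<^esub> x \<in> carrier U"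
  shows "g \<in> lin_hom k U V"
  using lin_homD[OF assms(1)] assms(3,4) by (simp add: lin_hom_def Pi_iff flip: assms(2))

lemma module_carrier_closed:
  assumes "module k V"
  shows "x \<in> carrier V \<Longrightarrow> y \<in> carrier V \<Longrightarrow> x \<oplus>\<^bsub>V\<^esub> y \<in> carrier V"
    and "r \<in> carrier k \<Longrightarrow> x \<in> carrier V \<Longrightarrow> r \<odot>\<^bsub>V\<^esub> x \<in> carrier V"
    and "\<zero>\<^bsub>V\<^esub> \<in> carrier V"
proof -
  interpret module k V by fact
  show "x \<in> carrier V \<Longrightarrow> y \<in> carrier V \<Longrightarrow> x \<oplus>\<^bsub>V\<^esub> y \<in> carrier V"
    "r \<in> carrier k \<Longrightarrow> x \<in> carrier V \<Longrightarrow> r \<odot>\<^bsub>V\<^esub> x \<in> carrier V"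
    "\<zero>\<^bsub>V\<^esub> \<in> carrier V"
    by simp_all
qed

text \<open>\<open>lin_hom\<close> sees only carriers, addition and scaling, so a map passes between
  records that share these operations, such as a space of functions and the cochains inside
  it.\<close>

lemma lin_hom_restrict:
  assumes "f \<in> lin_hom k U V" "carrier U' \<subseteq> carrier U" "f ` carrier U' \<subseteq> carrier V'"
   "add U' = add U" "smult U' = smult U" "add V' = add V" "smult V' = smult V"
  shows "f \<in> lin_hom k U' V'"
  using assms by (auto simp: lin_hom_def Pi_iff subset_iff)

text \<open>Writing negation as a multiple lets closure under scaling supply additive inverses, and
  makes linear maps and restrictions of the carrier respect negation.\<close>

lemma (in module) a_inv_eq_smult: "x \<in> carrier M \<Longrightarrow> \<ominus>\<^bsub>M\<^esub> x = (\<ominus> \<one>) \<odot>\<^bsub>M\<^esub> x"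
  by (simp add: smult_l_minus)

lemma (in module) submoduleI_smult:
  assumes "H \<subseteq> carrier M" "\<zero>\<^bsub>M\<^esub> \<in> H"
    "\<And>a b. a \<in> H \<Longrightarrow> b \<in> H \<Longrightarrow> a \<oplus>\<^bsub>M\<^esub> b \<in> H"
    "\<And>r x. r \<in> carrier R \<Longrightarrow> x \<in> H \<Longrightarrow> r \<odot>\<^bsub>M\<^esub> x \<in> H"
  shows "submodule H R M"
  using assms by (intro submoduleI) (auto simp: a_inv_eq_smult subset_iff)

lemma (in module) abelian_subgroupI_submodule:
  assumes "submodule H R M" shows "abelian_subgroup H M"
  using assms by (intro abelian_subgroupI3 additive_subgroup.intro)
    (auto simp: submodule_def abelian_group_axioms)

lemma lin_hom_zero_minus:
  assumes "module k U" "module k V" "f \<in> lin_hom k U V"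
  shows "f \<zero>\<^bsub>U\<^esub> = \<zero>\<^bsub>V\<^esub>" and "x \<in> carrier U \<Longrightarrow> f (\<ominus>\<^bsub>U\<^esub> x) = \<ominus>\<^bsub>V\<^esub> f x"
    and "x \<in> carrier U \<Longrightarrow> y \<in> carrier U \<Longrightarrow> f (x \<ominus>\<^bsub>U\<^esub> y) = f x \<ominus>\<^bsub>V\<^esub> f y"
proof -
  interpret U: module k U by fact
  interpret V: module k V by fact
  note f = lin_homD[OF assms(3)]
  show 0: "f \<zero>\<^bsub>U\<^esub> = \<zero>\<^bsub>V\<^esub>"
    using f(3)[of "\<zero>\<^bsub>k\<^esub>" "\<zero>\<^bsub>U\<^esub>"] f(1)[of "\<zero>\<^bsub>U\<^esub>"] by simp
  show m: "f (\<ominus>\<^bsub>U\<^esub> x) = \<ominus>\<^bsub>V\<^esub> f x" if "x \<in> carrier U" for x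
    using f(3)[of "\<ominus>\<^bsub>k\<^esub> \<one>\<^bsub>k\<^esub>" x] f(1)[of x] that by (simp add: U.a_inv_eq_smult V.a_inv_eq_smult)
  show "f (x \<ominus>\<^bsub>U\<^esub> y) = f x \<ominus>\<^bsub>V\<^esub> f y" if "x \<in> carrier U" "y \<in> carrier U"
    using that by (simp add: a_minus_def f m)
qed

section \<open>Cosets of a subspace and quotient spaces\<close>

context module begin

context fixes S assumes S: "submodule S R M" begin

interpretation S: abelian_subgroup S M
  by (rule abelian_subgroupI_submodule[OF S])

lemma mem_coset_iff:
  assumes "x \<in> carrier M"
  shows "y \<in> S +>\<^bsub>M\<^esub> x \<longleftrightarrow> y \<in> carrier M \<and> y \<ominus>\<^bsub>M\<^esub> x \<in> S"
  using S.a_rcos_module[of x y] assms S.a_elemrcos_carrier[of x y]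
  by (auto simp: a_minus_def)

lemma coset_eq_iff:
  assumes "x \<in> carrier M" "y \<in> carrier M"
  shows "S +>\<^bsub>M\<^esub> x = S +>\<^bsub>M\<^esub> y \<longleftrightarrow> x \<ominus>\<^bsub>M\<^esub> y \<in> S"
  using assms S.a_repr_independence'[of x y] S.a_rcos_self[of x] by (auto simp: mem_coset_iff)

lemma coset_eq_self_iff:
  assumes "x \<in> carrier M"
  shows "S +>\<^bsub>M\<^esub> x = S \<longleftrightarrow> x \<in> S"
  using coset_eq_iff[of x "\<zero>\<^bsub>M\<^esub>"] assms S.a_subset by (simp add: a_minus_def M.a_inv_zero)

lemma coset_add:
  assumes "x \<in> carrier M" "y \<in> carrier M"
  shows "set_add M (S +>\<^bsub>M\<^esub> x) (S +>\<^bsub>M\<^esub> y) = S +>\<^bsub>M\<^esub> (x \<oplus>\<^bsub>M\<^esub> y)"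
  using S.a_rcos_sum assms by simp

text \<open>Two points of a coset differ by an element of \<open>S\<close>, and so do their
  multiples; the union is over copies of one coset.\<close>

lemma coset_smult:
  assumes "r \<in> carrier R" "x \<in> carrier M"
  shows "(\<Union>y\<in>S +>\<^bsub>M\<^esub> x. S +>\<^bsub>M\<^esub> (r \<odot>\<^bsub>M\<^esub> y)) = S +>\<^bsub>M\<^esub> (r \<odot>\<^bsub>M\<^esub> x)"
proof -
  have "S +>\<^bsub>M\<^esub> (r \<odot>\<^bsub>M\<^esub> y) = S +>\<^bsub>M\<^esub> (r \<odot>\<^bsub>M\<^esub> x)" if "y \<in> S +>\<^bsub>M\<^esub> x" for y
  proof -
    have y: "y \<in> carrier M" "y \<ominus>\<^bsub>M\<^esub> x \<in> S"
      using that assms by (auto simp: mem_coset_iff)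
    then have "r \<odot>\<^bsub>M\<^esub> (y \<ominus>\<^bsub>M\<^esub> x) \<in> S"
      using S assms by (intro submodule.smult_closed)
    then show ?thesis using y assms
      by (simp add: coset_eq_iff a_minus_def smult_r_distr smult_r_minus)
  qed
  moreover have "x \<in> S +>\<^bsub>M\<^esub> x"
    using assms by (auto simp: mem_coset_iff a_minus_def M.r_neg)
  ultimately show ?thesis by blast
qed

text \<open>Cohomology is a quotient of the cocycles inside a larger function space, hence the
  separate set \<open>Z\<close>. Cosets and their sums depend on the addition alone and not on the
  carrier, so they may be computed in the larger space.\<close>

lemma quot_proj:
  assumes "Z \<subseteq> carrier M"
  shows "(\<lambda>x. S +>\<^bsub>M\<^esub> x) \<in> lin_hom R (M\<lparr>carrier := Z\<rparr>) (quot_space (M\<lparr>carrier := Z\<rparr>) S)"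
    and "carrier (quot_space (M\<lparr>carrier := Z\<rparr>) S) = (\<lambda>x. S +>\<^bsub>M\<^esub> x) ` Z"
proof -
  have eq: "(\<lambda>x. S +>\<^bsub>M\<lparr>carrier := Z\<rparr>\<^esub> x) = (\<lambda>x. S +>\<^bsub>M\<^esub> x)"
    by (auto simp: a_r_coset_def')
  have eq2: "set_add (M\<lparr>carrier := Z\<rparr>) = set_add M"
    by (intro ext) (simp add: set_add_def')
  show *: "carrier (quot_space (M\<lparr>carrier := Z\<rparr>) S) = (\<lambda>x. S +>\<^bsub>M\<^esub> x) ` Z"
    by (auto simp: quot_space_def A_RCOSETS_def' eq)
  show "(\<lambda>x. S +>\<^bsub>M\<^esub> x) \<in> lin_hom R (M\<lparr>carrier := Z\<rparr>) (quot_space (M\<lparr>carrier := Z\<rparr>) S)"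
    unfolding lin_hom_def * using assms 
    by (auto simp: quot_space_def eq eq2 coset_add coset_smult subset_iff)
qed

end
end

lemma lin_hom_lie_quot:
  "lin_hom k U (lie_quot M S) = lin_hom k U (quot_space M S)"
  "lin_hom k (lie_quot M S) U = lin_hom k (quot_space M S) U"
  "carrier (lie_quot M S) = carrier (quot_space M S)"
  by (auto simp: lin_hom_def lie_quot_def quot_space_def)

section \<open>Function spaces and products\<close>

lemma module_fun_space:
  assumes "module k V" shows "module k (fun_space T V)"
proof -
  interpret module k V by fact
  show ?thesis
  proof (intro moduleI abelian_groupI)
    show "\<exists>g\<in>carrier (fun_space T V). g \<oplus>\<^bsub>fun_space T V\<^esub> f = \<zero>\<^bsub>fun_space T V\<^esub>"
      if "f \<in> carrier (fun_space T V)" for f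
      using that
      by (intro bexI[of _ "\<lambda>t\<in>T. \<ominus>\<^bsub>V\<^esub> f t"])
        (auto simp: fun_space_def fun_eq_iff PiE_iff M.l_neg extensional_def)
  qed (auto simp: fun_space_def fun_eq_iff PiE_iff R.cring_axioms M.a_ac extensional_def
       smult_l_distr smult_r_distr smult_assoc1)
qed

text \<open>The fields of \<open>M\<close> are constrained instead of fixing one product record:
  this covers the ambient space of the centre, whose record carries a bracket, as well as the space
  \<open>Q\<close> in \<open>lift_exists\<close>.\<close>

lemma module_prod:
  assumes "module k V" "module k W"
    and M: "carrier M = carrier V \<times> carrier W" "zero M = (\<zero>\<^bsub>V\<^esub>, \<zero>\<^bsub>W\<^esub>)"
      "add M = (\<lambda>(x, y) (x', y'). (x \<oplus>\<^bsub>V\<^esub> x', y \<oplus>\<^bsub>W\<^esub> y'))"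
      "smult M = (\<lambda>r (x, y). (r \<odot>\<^bsub>V\<^esub> x, r \<odot>\<^bsub>W\<^esub> y))"
  shows "module k M"
proof -
  interpret V: module k V by fact
  interpret W: module k W by fact
  show ?thesis
  proof (intro moduleI abelian_groupI)
    show "\<exists>q\<in>carrier M. q \<oplus>\<^bsub>M\<^esub> p = \<zero>\<^bsub>M\<^esub>" if "p \<in> carrier M" for p
      using that
      by (intro bexI[of _ "(\<ominus>\<^bsub>V\<^esub> fst p, \<ominus>\<^bsub>W\<^esub> snd p)"])
        (auto simp: M V.M.l_neg W.M.l_neg)
  qed (auto simp: M V.R.cring_axioms V.M.a_ac W.M.a_ac
       V.smult_l_distr V.smult_r_distr V.smult_assoc1 W.smult_l_distr W.smult_r_distr W.smult_assoc1)
qed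

section \<open>Complements of subspaces\<close>

lemma (in module) submodule_Union_chain:
  assumes C: "C \<noteq> {}" "subset.chain {G. submodule G R M} C"
  shows "submodule (\<Union>C) R M"
proof -
  have sub: "submodule G R M" if "G \<in> C" for G
    using that C by (auto simp: subset.chain_def)
  show ?thesis
  proof (rule submoduleI_smult)
    show "\<Union>C \<subseteq> carrier M" using submoduleE(1)[OF sub] by blast
    show "\<zero>\<^bsub>M\<^esub> \<in> \<Union>C"
      using C sub subgroup.one_closed[of _ "add_monoid M"] by (force simp: submodule_def)
    show "r \<odot>\<^bsub>M\<^esub> x \<in> \<Union>C" if "r \<in> carrier R" "x \<in> \<Union>C" for r x
      using that submoduleE(4)[OF sub] by blast
    show "x \<oplus>\<^bsub>M\<^esub> y \<in> \<Union>C" if xy: "x \<in> \<Union>C" "y \<in> \<Union>C" for x y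
    proof -
      obtain G where "G \<in> C" "x \<in> G" "y \<in> G"
        using xy C(2) unfolding subset.chain_def subset_chain_def by blast
      then show ?thesis using submoduleE(5)[OF sub] by blast
    qed
  qed
qed

text \<open>Zorn's lemma gives a maximal subspace among those that contain \<open>S\<close> and meet
  \<open>N\<close> trivially. If it did not span everything together with \<open>N\<close>, a
  missing vector could be adjoined and the intersection with \<open>N\<close> would remain trivial.
  Containing \<open>S\<close> is what later forces prescribed values on the image of
  \<open>\<partial>\<close>.\<close>

lemma (in module) complement_exists:
  assumes "field R" and S: "submodule S R M" and N: "submodule N R M" and SN: "S \<inter> N = {\<zero>\<^bsub>M\<^esub>}"
  obtains G where "submodule G R M" "S \<subseteq> G" "G \<inter> N = {\<zero>\<^bsub>M\<^esub>}"
    "\<And>v. v \<in> carrier M \<Longrightarrow> \<exists>g\<in>G. \<exists>n\<in>N. v = g \<oplus>\<^bsub>M\<^esub> n"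
proof -
  interpret field R by fact
  let ?A = "{G. submodule G R M \<and> S \<subseteq> G \<and> G \<inter> N = {\<zero>\<^bsub>M\<^esub>}}"
  have "\<exists>G\<in>?A. \<forall>X\<in>?A. G \<subseteq> X \<longrightarrow> X = G"
  proof (rule subset_Zorn_nonempty)
    show "?A \<noteq> {}" using S SN by auto
    fix C assume C: "C \<noteq> {}" "subset.chain ?A C"
    then have "subset.chain {G. submodule G R M} C" by (auto simp: subset.chain_def)
    then have "submodule (\<Union>C) R M" using C(1) by (rule submodule_Union_chain[rotated])
    moreover have "\<forall>G\<in>C. S \<subseteq> G \<and> G \<inter> N = {\<zero>\<^bsub>M\<^esub>}"
      using C(2) by (auto simp: subset.chain_def)
    then have "S \<subseteq> \<Union>C" "\<Union>C \<inter> N = {\<zero>\<^bsub>M\<^esub>}"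
      using C(1) by auto
    ultimately show "\<Union>C \<in> ?A" by simp
  qed
  then obtain G where GA: "G \<in> ?A" and max0: "\<forall>X\<in>?A. G \<subseteq> X \<longrightarrow> X = G"
    by (elim bexE)
  then have G: "submodule G R M" "S \<subseteq> G" "G \<inter> N = {\<zero>\<^bsub>M\<^esub>}"
    by simp_all
  have max: "X = G" if "submodule X R M" "S \<subseteq> X" "X \<inter> N = {\<zero>\<^bsub>M\<^esub>}" "G \<subseteq> X" for X
    using max0 that by simp
  note GE = submoduleE[OF G(1)] and NE = submoduleE[OF N]
  have zG: "\<zero>\<^bsub>M\<^esub> \<in> G" using G(3) by blast
  have "\<exists>g\<in>G. \<exists>n\<in>N. v = g \<oplus>\<^bsub>M\<^esub> n" if v: "v \<in> carrier M" for v
  proof (rule ccontr)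
    assume no: "\<not> ?thesis"
    define X where "X = {g \<oplus>\<^bsub>M\<^esub> r \<odot>\<^bsub>M\<^esub> v | g r. g \<in> G \<and> r \<in> carrier R}"
    have GM: "g \<in> carrier M" if "g \<in> G" for g using that GE(1) by blast
    have NM: "g \<in> carrier M" if "g \<in> N" for g using that NE(1) by blast
    have X: "submodule X R M"
    proof (rule submoduleI_smult)
      show "X \<subseteq> carrier M" using v GM by (auto simp: X_def)
      show "\<zero>\<^bsub>M\<^esub> \<in> X" 
        unfolding X_def using v zG by (intro CollectI exI[of _ "\<zero>\<^bsub>M\<^esub>"] exI[of _ "\<zero>"]) simp
      show "x \<oplus>\<^bsub>M\<^esub> y \<in> X" if xy: "x \<in> X" "y \<in> X" for x y
      proof -
        obtain g r g' r' where *: "x = g \<oplus>\<^bsub>M\<^esub> r \<odot>\<^bsub>M\<^esub> v" "g \<in> G" "r \<in> carrier R"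
          "y = g' \<oplus>\<^bsub>M\<^esub> r' \<odot>\<^bsub>M\<^esub> v" "g' \<in> G" "r' \<in> carrier R"
          using xy unfolding X_def by blast
        then have "x \<oplus>\<^bsub>M\<^esub> y = (g \<oplus>\<^bsub>M\<^esub> g') \<oplus>\<^bsub>M\<^esub> (r \<oplus> r') \<odot>\<^bsub>M\<^esub> v"
          using v GM by (simp add: smult_l_distr M.a_ac)
        then show ?thesis using *(2,3,5,6) GE(5) R.a_closed unfolding X_def by blast
      qed
      show "r' \<odot>\<^bsub>M\<^esub> x \<in> X" if rx: "r' \<in> carrier R" "x \<in> X" for r' x
      proof -
        obtain g r where *: "x = g \<oplus>\<^bsub>M\<^esub> r \<odot>\<^bsub>M\<^esub> v" "g \<in> G" "r \<in> carrier R"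
          using rx unfolding X_def by blast
        then have "r' \<odot>\<^bsub>M\<^esub> x = r' \<odot>\<^bsub>M\<^esub> g \<oplus>\<^bsub>M\<^esub> (r' \<otimes> r) \<odot>\<^bsub>M\<^esub> v"
          using v GM rx by (simp add: smult_r_distr smult_assoc1)
        then show ?thesis using *(2,3) GE(4) rx(1) R.m_closed unfolding X_def by blast
      qed
    qed
    have GX: "G \<subseteq> X"
    proof
      fix g assume "g \<in> G"
      then show "g \<in> X"
        unfolding X_def using v GM by (intro CollectI exI[of _ g] exI[of _ "\<zero>"]) simp
    qed
    have "X \<inter> N \<subseteq> {\<zero>\<^bsub>M\<^esub>}"
    proof
      fix n assume n: "n \<in> X \<inter> N"
      then obtain g r where *: "n = g \<oplus>\<^bsub>M\<^esub> r \<odot>\<^bsub>M\<^esub> v" "g \<in> G" "r \<in> carrier R"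
        by (auto simp: X_def)
      \<comment> \<open>Division by scalars enters here: were \<open>r\<close> invertible, the
        equation \<open>n = g + r v\<close> could be solved for \<open>v\<close>, placing it in the
        sum of \<open>G\<close> and \<open>N\<close>.\<close>
      have "r = \<zero>"
      proof (rule ccontr)
        assume "r \<noteq> \<zero>"
        then have r: "inv r \<in> carrier R" "inv r \<otimes> r = \<one>"
          using * field_Units by auto
        have "v = inv r \<odot>\<^bsub>M\<^esub> (r \<odot>\<^bsub>M\<^esub> v)" using r * v by (simp flip: smult_assoc1)
        also have "r \<odot>\<^bsub>M\<^esub> v = \<ominus>\<^bsub>M\<^esub> g \<oplus>\<^bsub>M\<^esub> n"
          using * v GM by (simp add: M.r_neg1)
        also have "inv r \<odot>\<^bsub>M\<^esub> (\<ominus>\<^bsub>M\<^esub> g \<oplus>\<^bsub>M\<^esub> n) = inv r \<odot>\<^bsub>M\<^esub> (\<ominus>\<^bsub>M\<^esub> g) \<oplus>\<^bsub>M\<^esub> inv r \<odot>\<^bsub>M\<^esub> n"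
          using r GM NM * n by (simp add: smult_r_distr)
        finally have "v = inv r \<odot>\<^bsub>M\<^esub> (\<ominus>\<^bsub>M\<^esub> g) \<oplus>\<^bsub>M\<^esub> inv r \<odot>\<^bsub>M\<^esub> n" .
        moreover have "inv r \<odot>\<^bsub>M\<^esub> (\<ominus>\<^bsub>M\<^esub> g) \<in> G" "inv r \<odot>\<^bsub>M\<^esub> n \<in> N"
          using r * n GE(3,4) NE(4) by auto
        ultimately show False using no by blast
      qed
      then have "n \<in> G" using * v GM by simp
      then show "n \<in> {\<zero>\<^bsub>M\<^esub>}" using n G(3) by blast
    qed
    then have "X = G" using X GX G by (intro max) auto
    moreover have "v \<in> X"
      unfolding X_def using v zG by (intro CollectI exI[of _ "\<zero>\<^bsub>M\<^esub>"] exI[of _ "\<one>"]) simp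
    moreover have "\<zero>\<^bsub>M\<^esub> \<in> N" using G(3) by blast
    moreover have "v = v \<oplus>\<^bsub>M\<^esub> \<zero>\<^bsub>M\<^esub>" using v by simp
    ultimately show False using no by blast
  qed
  with G show thesis by (rule that)
qed

section \<open>Images, kernels and maps induced on quotients\<close>

lemma submodule_image:
  assumes "f \<in> lin_hom k U V" "module k U" "module k V"
  shows "submodule (f ` carrier U) k V"
proof (rule module.submoduleI_smult[OF assms(3)])
  note f = lin_homD[OF assms(1)] and U = module_carrier_closed[OF assms(2)]
  show "f ` carrier U \<subseteq> carrier V" using f by auto
  show "\<zero>\<^bsub>V\<^esub> \<in> f ` carrier U"
    using lin_hom_zero_minus(1)[OF assms(2,3,1)] U(3) by (metis imageI)
  show "a \<oplus>\<^bsub>V\<^esub> b \<in> f ` carrier U" if "a \<in> f ` carrier U" "b \<in> f ` carrier U" for a b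
    using that U(1) by (auto simp flip: f(2))
  show "r \<odot>\<^bsub>V\<^esub> a \<in> f ` carrier U" if "r \<in> carrier k" "a \<in> f ` carrier U" for r a
    using that U(2) by (auto simp flip: f(3))
qed

lemma a_kernel_eq: "a_kernel U V f = {x \<in> carrier U. f x = \<zero>\<^bsub>V\<^esub>}"
  by (simp add: a_kernel_def')

lemma submodule_kernel:
  assumes "f \<in> lin_hom k U V" "module k U" "module k V"
  shows "submodule (a_kernel U V f) k U"
proof (rule module.submoduleI_smult[OF assms(2)])
  interpret V: module k V by fact
  note f = lin_homD[OF assms(1)] and U = module_carrier_closed[OF assms(2)]
  show "a_kernel U V f \<subseteq> carrier U" by (auto simp: a_kernel_eq)
  show "\<zero>\<^bsub>U\<^esub> \<in> a_kernel U V f"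
    using U lin_hom_zero_minus(1)[OF assms(2,3,1)] by (simp add: a_kernel_eq)
  show "a \<oplus>\<^bsub>U\<^esub> b \<in> a_kernel U V f" if "a \<in> a_kernel U V f" "b \<in> a_kernel U V f" for a b
    using that U f by (simp add: a_kernel_eq)
  show "r \<odot>\<^bsub>U\<^esub> a \<in> a_kernel U V f" if "r \<in> carrier k" "a \<in> a_kernel U V f" for r a
    using that U f by (simp add: a_kernel_eq)
qed

text \<open>Negation is a definite description over the carrier, so shrinking the carrier might
  change it; scaling by minus one does not mention the carrier.\<close>

lemma submodule_a_inv:
  assumes "module k V" "submodule H k V" "x \<in> H"
  shows "\<ominus>\<^bsub>V\<lparr>carrier := H\<rparr>\<^esub> x = \<ominus>\<^bsub>V\<^esub> x"
  using module.a_inv_eq_smult[OF assms(1), of x] module.submoduleE(1)[OF assms(1,2)] assms(3)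
    module.a_inv_eq_smult[OF submodule.submodule_is_module[OF assms(2,1)], of x]
  by auto

text \<open>Two elements of \<open>Z\<close> in the same coset differ by an element that lies in
  \<open>Z\<close> as well as in \<open>S\<close>, so it suffices to control \<open>f\<close> on the
  intersection. For cohomology, \<open>Z\<close> consists of cocycles and \<open>S\<close> of
  coboundaries.\<close>

lemma quot_factor:
  assumes V: "module k V" and W: "module k W" and S: "submodule S k V" and Z: "submodule Z k V"
    and T: "submodule T k W" and f: "f \<in> lin_hom k (V\<lparr>carrier := Z\<rparr>) W"
    and ST: "\<And>s. s \<in> S \<Longrightarrow> s \<in> Z \<Longrightarrow> f s \<in> T"
  shows "\<exists>g\<in>lin_hom k (quot_space (V\<lparr>carrier := Z\<rparr>) S) (quot_space W T).
    \<forall>z\<in>Z. g (S +>\<^bsub>V\<^esub> z) = T +>\<^bsub>W\<^esub> f z"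
proof -
  interpret V: module k V by fact
  interpret W: module k W by fact
  note ZE = V.submoduleE[OF Z]
  note ZV = submodule.submodule_is_module[OF Z V]
  have Wproj: "(\<lambda>w. T +>\<^bsub>W\<^esub> w) \<in> lin_hom k W (quot_space W T)"
    using W.quot_proj(1)[OF T, of "carrier W"] by simp
  have "T +>\<^bsub>W\<^esub> f x = T +>\<^bsub>W\<^esub> f y" if x: "x \<in> Z" and y: "y \<in> Z" and eq: "S +>\<^bsub>V\<^esub> x = S +>\<^bsub>V\<^esub> y" for x y
  proof -
    have xyZ: "x \<ominus>\<^bsub>V\<^esub> y \<in> Z" using ZE(3,5) x y by (simp add: a_minus_def)
    have xy: "x \<in> carrier V" "y \<in> carrier V" using ZE(1) x y by auto
    have "x \<ominus>\<^bsub>V\<^esub> y \<in> S"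
      using V.coset_eq_iff[OF S xy] eq by simp
    then have "f (x \<ominus>\<^bsub>V\<^esub> y) \<in> T" using xyZ by (rule ST)
    moreover have "x \<ominus>\<^bsub>V\<^esub> y = x \<ominus>\<^bsub>V\<lparr>carrier := Z\<rparr>\<^esub> y"
      using submodule_a_inv[OF V Z y] by (simp add: a_minus_def)
    ultimately have "f x \<ominus>\<^bsub>W\<^esub> f y \<in> T"
      using lin_hom_zero_minus(3)[OF ZV W f] x y by simp
    then show ?thesis
      using W.coset_eq_iff[OF T, of "f x" "f y"] lin_homD(1)[OF f] x y by simp
  qed
  note cong = this
  have "\<exists>g\<in>lin_hom k (quot_space (V\<lparr>carrier := Z\<rparr>) S) (quot_space W T).
    \<forall>z\<in>carrier (V\<lparr>carrier := Z\<rparr>). g (S +>\<^bsub>V\<^esub> z) = T +>\<^bsub>W\<^esub> f z"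
  proof (rule factor_lin_hom[OF V.quot_proj(1)[OF S ZE(1)] lin_hom_comp[OF f Wproj]])
    show "(\<lambda>z. S +>\<^bsub>V\<^esub> z) ` carrier (V\<lparr>carrier := Z\<rparr>) = carrier (quot_space (V\<lparr>carrier := Z\<rparr>) S)"
      using V.quot_proj(2)[OF S ZE(1)] by simp
    show "T +>\<^bsub>W\<^esub> f x = T +>\<^bsub>W\<^esub> f y"
      if "x \<in> carrier (V\<lparr>carrier := Z\<rparr>)" "y \<in> carrier (V\<lparr>carrier := Z\<rparr>)" "S +>\<^bsub>V\<^esub> x = S +>\<^bsub>V\<^esub> y" for x y
      using that by (intro cong) simp_all
  qed (rule module_carrier_closed(1,2)[OF ZV]; assumption)+
  then show ?thesis by simp
qed

lemma fun_space_apply: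
  "t \<in> T \<Longrightarrow> (f \<oplus>\<^bsub>fun_space T V\<^esub> g) t = f t \<oplus>\<^bsub>V\<^esub> g t"
  "t \<in> T \<Longrightarrow> (r \<odot>\<^bsub>fun_space T V\<^esub> f) t = r \<odot>\<^bsub>V\<^esub> f t"
  "t \<in> T \<Longrightarrow> \<zero>\<^bsub>fun_space T V\<^esub> t = \<zero>\<^bsub>V\<^esub>"
  by (simp_all add: fun_space_def)

lemma fun_space_eqI:
  assumes "f \<in> carrier (fun_space T V)" "g \<in> carrier (fun_space T V)" "\<And>t. t \<in> T \<Longrightarrow> f t = g t"
  shows "f = g"
  using assms by (auto simp: fun_space_def intro: PiE_ext)

lemma fun_space_closed: "f \<in> carrier (fun_space T V) \<Longrightarrow> t \<in> T \<Longrightarrow> f t \<in> carrier V"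
  by (auto simp: fun_space_def)

lemma restrict_fun_space: "(\<And>t. t \<in> T \<Longrightarrow> f t \<in> carrier V) \<Longrightarrow> restrict f T \<in> carrier (fun_space T V)"
  by (simp add: fun_space_def restrict_PiE_iff)

text \<open>Reduces linearity of the differentials and of the obstruction to linearity of each of
  their values.\<close>

lemma lin_hom_fun_spaceI:
  assumes V: "module k V" and f: "\<And>x. x \<in> carrier U \<Longrightarrow> f x \<in> carrier (fun_space T V)"
    and lin: "\<And>t. t \<in> T \<Longrightarrow> (\<lambda>x. f x t) \<in> lin_hom k U V"
    and closed: "\<And>x y. x \<in> carrier U \<Longrightarrow> y \<in> carrier U \<Longrightarrow> x \<oplus>\<^bsub>U\<^esub> y \<in> carrier U"
      "\<And>r x. r \<in> carrier k \<Longrightarrow> x \<in> carrier U \<Longrightarrow> r \<odot>\<^bsub>U\<^esub> x \<in> carrier U"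
  shows "f \<in> lin_hom k U (fun_space T V)"
proof -
  note FV = module_carrier_closed[OF module_fun_space[OF V, of T]]
  have "f (x \<oplus>\<^bsub>U\<^esub> y) = f x \<oplus>\<^bsub>fun_space T V\<^esub> f y" if xy: "x \<in> carrier U" "y \<in> carrier U" for x y
  proof (rule fun_space_eqI)
    show "f (x \<oplus>\<^bsub>U\<^esub> y) t = (f x \<oplus>\<^bsub>fun_space T V\<^esub> f y) t" if "t \<in> T" for t
      using lin_homD(2)[OF lin] xy that by (simp add: fun_space_apply)
    show "f (x \<oplus>\<^bsub>U\<^esub> y) \<in> carrier (fun_space T V)" "f x \<oplus>\<^bsub>fun_space T V\<^esub> f y \<in> carrier (fun_space T V)"
      using f closed FV xy by simp_all
  qed
  moreover have "f (r \<odot>\<^bsub>U\<^esub> x) = r \<odot>\<^bsub>fun_space T V\<^esub> f x" if rx: "r \<in> carrier k" "x \<in> carrier U" for r x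
  proof (rule fun_space_eqI)
    show "f (r \<odot>\<^bsub>U\<^esub> x) t = (r \<odot>\<^bsub>fun_space T V\<^esub> f x) t" if "t \<in> T" for t
      using lin_homD(3)[OF lin] rx that by (simp add: fun_space_apply)
    show "f (r \<odot>\<^bsub>U\<^esub> x) \<in> carrier (fun_space T V)" "r \<odot>\<^bsub>fun_space T V\<^esub> f x \<in> carrier (fun_space T V)"
      using f closed FV rx by simp_all
  qed
  ultimately show ?thesis using f by (simp add: lin_hom_def Pi_iff)
qed

lemma lin_hom_add_smult:
  assumes "module k V" "module k U" "f \<in> lin_hom k U V" "g \<in> lin_hom k U V"
  shows "(\<lambda>x. f x \<oplus>\<^bsub>V\<^esub> g x) \<in> lin_hom k U V" "(\<lambda>x. f x \<ominus>\<^bsub>V\<^esub> g x) \<in> lin_hom k U V"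
proof -
  interpret V: module k V by fact
  note f = lin_homD[OF assms(3)] and g = lin_homD[OF assms(4)]
  show "(\<lambda>x. f x \<oplus>\<^bsub>V\<^esub> g x) \<in> lin_hom k U V" "(\<lambda>x. f x \<ominus>\<^bsub>V\<^esub> g x) \<in> lin_hom k U V"
    using f g by (simp_all add: lin_hom_def[of k U V] Pi_iff V.M.a_ac V.M.minus_add
      V.smult_r_distr V.smult_r_minus a_minus_def)
qed

section \<open>The Chevalley--Eilenberg differential in degrees 0, 1 and 2\<close>

lemma tuples_0: "tuples M 0 = {[]}"
  by (auto simp: tuples_def)

lemma tuples_1: "tuples M 1 = (\<lambda>x. [x]) ` carrier M"
  by (auto simp: tuples_def length_Suc_conv)

lemma tuples_2: "tuples M 2 = (\<lambda>(x, y). [x, y]) ` (carrier M \<times> carrier M)"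
  by (auto simp: tuples_def length_Suc_conv numeral_2_eq_2 image_iff)

lemma tuples_3: "tuples M 3 = (\<lambda>(x, y, z). [x, y, z]) ` (carrier M \<times> carrier M \<times> carrier M)"
  by (auto simp: tuples_def length_Suc_conv numeral_3_eq_3 image_iff)

lemma pairs_upto_1: "{(i, j). i < j \<and> j \<le> (1::nat)} = {(0, 1)}"
  by auto

lemma pairs_upto_2: "{(i, j). i < j \<and> j \<le> (2::nat)} = {(0, 1), (0, 2), (1, 2)}"
  by auto

lemma (in module) ce_diff_0:
  assumes "x \<in> carrier L" "act x (\<omega> []) \<in> carrier M"
  shows "ce_diff L M act 0 \<omega> [x] = act x (\<omega> [])"
proof -
  have pairs: "{(i, j). i < j \<and> j \<le> (0::nat)} = {}" by auto
  show ?thesis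
    unfolding ce_diff_def pairs using assms by (simp add: tuples_def alternate_sign_def omit_def)
qed

lemma (in module) ce_diff_1:
  assumes "x \<in> carrier L" "y \<in> carrier L"
    "act x (\<omega> [y]) \<in> carrier M" "act y (\<omega> [x]) \<in> carrier M" "\<omega> [bracket L x y] \<in> carrier M"
  shows "ce_diff L M act 1 \<omega> [x, y] = act x (\<omega> [y]) \<ominus>\<^bsub>M\<^esub> act y (\<omega> [x]) \<ominus>\<^bsub>M\<^esub> \<omega> [bracket L x y]"
proof -
  have upto: "{..1::nat} = {0, 1}" by auto
  show ?thesis
    unfolding ce_diff_def pairs_upto_1 upto using assms by (simp add: tuples_def alternate_sign_def omit_def a_minus_def)
qed

lemma (in module) ce_diff_2:
  assumes "x \<in> carrier L" "y \<in> carrier L" "z \<in> carrier L"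
    "act x (\<omega> [y, z]) \<in> carrier M" "act y (\<omega> [x, z]) \<in> carrier M" "act z (\<omega> [x, y]) \<in> carrier M"
    "\<omega> [bracket L x y, z] \<in> carrier M" "\<omega> [bracket L x z, y] \<in> carrier M"
    "\<omega> [bracket L y z, x] \<in> carrier M"
  shows "ce_diff L M act 2 \<omega> [x, y, z] =
    act x (\<omega> [y, z]) \<ominus>\<^bsub>M\<^esub> act y (\<omega> [x, z]) \<oplus>\<^bsub>M\<^esub> act z (\<omega> [x, y])
    \<ominus>\<^bsub>M\<^esub> \<omega> [bracket L x y, z] \<oplus>\<^bsub>M\<^esub> \<omega> [bracket L x z, y] \<ominus>\<^bsub>M\<^esub> \<omega> [bracket L y z, x]"
proof -
  \<comment> \<open>The index pair \<open>(1, 2)\<close> carries the sign of an odd exponent, three;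
    with numerals unfolded its parity appears in this form.\<close>
  have [simp]: "\<not> Suc (Suc 0) dvd Suc (Suc (Suc 0))" by presburger
  have upto: "{..2::nat} = {0, 1, 2}" by auto
  show ?thesis
    unfolding ce_diff_def pairs_upto_2 upto using assms by (simp add: tuples_def alternate_sign_def omit_def a_minus_def
       numeral_2_eq_2 M.a_ac)
qed

text \<open>The cancellation behind the vanishing of the squared differential on a 1-cochain
  \<open>\<xi>\<close>. Here \<open>stu\<close> stands for
  \<open>s \<cdot> (t \<cdot> \<xi>(u))\<close> and likewise for the other orders; \<open>a\<close>,
  \<open>b\<close>, \<open>c\<close> are \<open>s \<cdot> \<xi>[t, u]\<close>,
  \<open>t \<cdot> \<xi>[s, u]\<close>, \<open>u \<cdot> \<xi>[s, t]\<close>; and \<open>i\<close>,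
  \<open>j\<close>, \<open>l\<close> are the values of \<open>\<xi>\<close> at
  \<open>[[s, t], u]\<close>, \<open>[[s, u], t]\<close>, \<open>[[t, u], s]\<close>. What remains
  is left to the Jacobi identity.\<close>

lemma (in abelian_group) ce_diff_square_terms:
  assumes "stu \<in> carrier G" "sut \<in> carrier G" "tsu \<in> carrier G" "tus \<in> carrier G"
    "ust \<in> carrier G" "uts \<in> carrier G" "a \<in> carrier G" "b \<in> carrier G" "c \<in> carrier G"
    "i \<in> carrier G" "j \<in> carrier G" "l \<in> carrier G"
  shows "(stu \<ominus> sut \<ominus> a) \<ominus> (tsu \<ominus> tus \<ominus> b) \<oplus> (ust \<ominus> uts \<ominus> c) \<ominus> ((stu \<ominus> tsu) \<ominus> c \<ominus> i)
    \<oplus> ((sut \<ominus> ust) \<ominus> b \<ominus> j) \<ominus> ((tus \<ominus> uts) \<ominus> a \<ominus> l) = i \<ominus> j \<oplus> l"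
  using assms by algebra

context crossed_module begin

section \<open>The centre as a braided crossed module\<close>

lemma act_lin: "x \<in> carrier L0 \<Longrightarrow> act x \<in> lin_hom k L1 L1" "a \<in> carrier L1 \<Longrightarrow> (\<lambda>x. act x a) \<in> lin_hom k L0 L1"
  using act_bilinear by (auto simp: bilinear_on_def)

lemma br_lin: "x \<in> carrier L0 \<Longrightarrow> bracket L0 x \<in> lin_hom k L0 L0"
    "y \<in> carrier L0 \<Longrightarrow> (\<lambda>x. bracket L0 x y) \<in> lin_hom k L0 L0"
  using bracket_bilinear by (auto simp: bilinear_on_def)

lemmas act_simps = lin_homD[OF act_lin(1)] lin_homD(2-3)[OF act_lin(2)]
  lin_hom_zero_minus[OF A.module_axioms A.module_axioms act_lin(1)]
  lin_hom_zero_minus[OF M.module_axioms A.module_axioms act_lin(2)]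

lemmas br_simps = lin_homD[OF br_lin(1)] lin_homD(2-3)[OF br_lin(2)]
  lin_hom_zero_minus[OF M.module_axioms M.module_axioms br_lin(1)]
  lin_hom_zero_minus[OF M.module_axioms M.module_axioms br_lin(2)]

lemmas bd_simps = lin_homD[OF bd_linear]
  lin_hom_zero_minus[OF A.module_axioms M.module_axioms bd_linear]

text \<open>The bracket is only assumed to be alternating; antisymmetry follows by expanding the
  bracket of \<open>x + y\<close> with itself.\<close>

lemma br_flip:
  assumes "x \<in> carrier L0" "y \<in> carrier L0"
  shows "bracket L0 y x = \<ominus>\<^bsub>L0\<^esub> bracket L0 x y"
proof -
  have "\<zero>\<^bsub>L0\<^esub> = bracket L0 (x \<oplus>\<^bsub>L0\<^esub> y) (x \<oplus>\<^bsub>L0\<^esub> y)"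
    using assms by (simp add: bracket_self)
  also have "\<dots> = bracket L0 x y \<oplus>\<^bsub>L0\<^esub> bracket L0 y x"
    using assms by (simp add: br_simps bracket_self[of x] bracket_self[of y] M.M.a_comm)
  finally have "bracket L0 y x \<oplus>\<^bsub>L0\<^esub> bracket L0 x y = \<zero>\<^bsub>L0\<^esub>"
    using assms by (simp add: br_simps M.M.a_comm)
  then show ?thesis
    using assms by (intro M.M.minus_equality[symmetric]) (simp_all add: br_simps)
qed

lemma act_bd_flip:
  assumes "a \<in> carrier L1" "b \<in> carrier L1"
  shows "act (bd b) a = \<ominus>\<^bsub>L1\<^esub> act (bd a) b"
  using assms act_bd[of b a]
  by (intro A.M.minus_equality[symmetric]) (simp_all add: act_simps bd_simps)

text \<open>The centre without the requirement that \<open>\<xi>\<close> be a derivation.\<close>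

definition lifts :: "('b \<times> ('b \<Rightarrow> 'c)) set" where
  "lifts = {(x, \<xi>). x \<in> carrier L0 \<and> \<xi> \<in> lin_hom k L0 L1 \<and> \<xi> \<in> extensional (carrier L0) \<and>
     (\<forall>t\<in>carrier L0. bd (\<xi> t) = bracket L0 x t) \<and> (\<forall>a\<in>carrier L1. \<xi> (bd a) = act x a)}"

section \<open>The centre as a subspace of a product\<close>

abbreviation Z where "Z \<equiv> centre0 k L1 L0 act bd"

text \<open>Enlarging the carrier alone keeps the operations of the centre, so that the centre and
  \<open>lifts\<close> are subspaces of one product space and inherit the module axioms from
  it.\<close>

abbreviation Z_ambient where
  "Z_ambient \<equiv> Z\<lparr>carrier := carrier L0 \<times> (carrier L0 \<rightarrow>\<^sub>E carrier L1)\<rparr>"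

abbreviation \<delta> where "\<delta> \<equiv> centre_bd L1 L0 act bd"

lemma Z_record [simp]:
  "(x, \<xi>) \<oplus>\<^bsub>Z\<^esub> (y, \<eta>) = (x \<oplus>\<^bsub>L0\<^esub> y, \<lambda>t\<in>carrier L0. \<xi> t \<oplus>\<^bsub>L1\<^esub> \<eta> t)"
  "r \<odot>\<^bsub>Z\<^esub> (x, \<xi>) = (r \<odot>\<^bsub>L0\<^esub> x, \<lambda>t\<in>carrier L0. r \<odot>\<^bsub>L1\<^esub> \<xi> t)"
  "\<zero>\<^bsub>Z\<^esub> = (\<zero>\<^bsub>L0\<^esub>, \<lambda>t\<in>carrier L0. \<zero>\<^bsub>L1\<^esub>)"
  by (simp_all add: centre0_def fun_space_def)

lemma Z_ambient_module: "module k Z_ambient"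
  by (rule module_prod[OF M.module_axioms module_fun_space[OF A.module_axioms, of "carrier L0"]])
    (simp_all add: centre0_def fun_space_def)

lemma carrier_Z:
  "z \<in> carrier Z \<longleftrightarrow> z \<in> lifts \<and> (\<forall>s\<in>carrier L0. \<forall>t\<in>carrier L0.
     snd z (bracket L0 s t) = act s (snd z t) \<ominus>\<^bsub>L1\<^esub> act t (snd z s))"
  by (cases z) (auto simp: centre0_def lifts_def)

lemma lin_hom_pointwise_add:
  assumes "f \<in> lin_hom k L0 L1" "g \<in> lin_hom k L0 L1"
  shows "(\<lambda>t\<in>carrier L0. f t \<oplus>\<^bsub>L1\<^esub> g t) \<in> lin_hom k L0 L1"
  using lin_homD[OF assms(1)] lin_homD[OF assms(2)]
  by (auto simp: lin_hom_def A.smult_r_distr A.M.a_ac)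

lemma lin_hom_pointwise_smult:
  assumes "f \<in> lin_hom k L0 L1" "r \<in> carrier k"
  shows "(\<lambda>t\<in>carrier L0. r \<odot>\<^bsub>L1\<^esub> f t) \<in> lin_hom k L0 L1"
  using lin_homD[OF assms(1)] assms(2)
  by (auto simp: lin_hom_def A.smult_r_distr A.smult_assoc1[symmetric] R.m_comm)

lemma lin_hom_zero: "(\<lambda>t\<in>carrier L0. \<zero>\<^bsub>L1\<^esub>) \<in> lin_hom k L0 L1"
  by (auto simp: lin_hom_def)

lemma carrier_subset_ambient: "lifts \<subseteq> carrier Z_ambient"
proof
  fix z assume "z \<in> lifts"
  then show "z \<in> carrier Z_ambient"
    by (cases z) (auto simp: lifts_def lin_hom_def PiE_iff)
qed

lemma submodule_lifts: "submodule lifts k Z_ambient"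
proof (rule module.submoduleI_smult[OF Z_ambient_module carrier_subset_ambient])
  show "\<zero>\<^bsub>Z_ambient\<^esub> \<in> lifts"
    by (auto simp: lifts_def lin_hom_zero act_simps br_simps bd_simps)
  fix z assume z: "z \<in> lifts"
  obtain x \<xi> where z_eq: "z = (x, \<xi>)" by (cases z)
  then have \<xi>: "\<xi> \<in> lin_hom k L0 L1" using z by (simp add: lifts_def)
  show "z \<oplus>\<^bsub>Z_ambient\<^esub> w \<in> lifts" if w: "w \<in> lifts" for w
  proof -
    obtain y \<eta> where w_eq: "w = (y, \<eta>)" by (cases w)
    then have \<eta>: "\<eta> \<in> lin_hom k L0 L1" using w by (simp add: lifts_def)
    show ?thesis
      using z w lin_homD(1)[OF \<xi>] lin_homD(1)[OF \<eta>]
      by (auto simp: z_eq w_eq lifts_def lin_hom_pointwise_add act_simps br_simps bd_simps)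
  qed
  show "r \<odot>\<^bsub>Z_ambient\<^esub> z \<in> lifts" if "r \<in> carrier k" for r
    using that z lin_homD(1)[OF \<xi>]
    by (auto simp: z_eq lifts_def lin_hom_pointwise_smult act_simps br_simps bd_simps)
qed

lemma submodule_Z: "submodule (carrier Z) k Z_ambient"
proof (rule module.submoduleI_smult[OF Z_ambient_module])
  show "carrier Z \<subseteq> carrier Z_ambient"
    using carrier_subset_ambient by (auto simp: carrier_Z)
  show "\<zero>\<^bsub>Z_ambient\<^esub> \<in> carrier Z"
    by (auto simp: carrier_Z lifts_def lin_hom_zero act_simps br_simps bd_simps a_minus_def A.M.r_neg)
  fix z assume z: "z \<in> carrier Z"
  then have \<xi>: "snd z \<in> lin_hom k L0 L1" by (auto simp: carrier_Z lifts_def)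
  show "z \<oplus>\<^bsub>Z_ambient\<^esub> w \<in> carrier Z" if w: "w \<in> carrier Z" for w
  proof -
    have \<eta>: "snd w \<in> lin_hom k L0 L1" using w by (auto simp: carrier_Z lifts_def)
    have "z \<oplus>\<^bsub>Z_ambient\<^esub> w \<in> lifts"
      using z w module.submoduleE(5)[OF Z_ambient_module submodule_lifts] by (simp add: carrier_Z)
    then show ?thesis
      using z w lin_homD(1)[OF \<xi>] lin_homD(1)[OF \<eta>]
      by (cases z; cases w)
        (auto simp: carrier_Z act_simps br_simps a_minus_def A.M.minus_add A.M.a_ac)
  qed
  show "r \<odot>\<^bsub>Z_ambient\<^esub> z \<in> carrier Z" if r: "r \<in> carrier k" for r
  proof -
    have "r \<odot>\<^bsub>Z_ambient\<^esub> z \<in> lifts"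
      using z r module.submoduleE(4)[OF Z_ambient_module submodule_lifts] by (simp add: carrier_Z)
    then show ?thesis
      using z r lin_homD(1)[OF \<xi>]
      by (cases z)
        (auto simp: carrier_Z act_simps br_simps a_minus_def A.smult_r_distr A.smult_r_minus)
  qed
qed

lemma Z_module: "module k Z"
  using submodule.submodule_is_module[OF submodule_Z Z_ambient_module] by simp

section \<open>The map \<open>\<delta>\<close> and the braiding\<close>

lemma \<delta>_eq: "\<delta> c = (bd c, \<lambda>t\<in>carrier L0. \<ominus>\<^bsub>L1\<^esub> act t c)"
  by (simp add: centre_bd_def)

text \<open>The three conditions on the second component come, in order, from equivariance of
  \<open>\<partial>\<close>, from the identity
  \<open>\<partial>(a) \<cdot> c = - \<partial>(c) \<cdot> a\<close>, and from the law for the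
  action of a bracket, by which inner derivations are derivations.\<close>

lemma \<delta>_mem: 
  assumes "c \<in> carrier L1" shows "\<delta> c \<in> carrier Z"
proof -
  have "(\<lambda>t\<in>carrier L0. \<ominus>\<^bsub>L1\<^esub> act t c) \<in> lin_hom k L0 L1"
    using assms by (auto simp: lin_hom_def act_simps A.M.minus_add A.smult_r_minus)
  moreover have "bd (\<ominus>\<^bsub>L1\<^esub> act t c) = bracket L0 (bd c) t" if "t \<in> carrier L0" for t
    using that assms br_flip[of t "bd c"] by (simp add: bd_simps bd_act act_simps br_simps)
  moreover have "\<ominus>\<^bsub>L1\<^esub> act (bd a) c = act (bd c) a" if "a \<in> carrier L1" for a
    using that assms act_bd_flip[of c a] by (simp add: act_simps bd_simps)
  moreover have "\<ominus>\<^bsub>L1\<^esub> act (bracket L0 s t) c = act s (\<ominus>\<^bsub>L1\<^esub> act t c) \<ominus>\<^bsub>L1\<^esub> act t (\<ominus>\<^bsub>L1\<^esub> act s c)"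
    if "s \<in> carrier L0" "t \<in> carrier L0" for s t
    using that assms by (simp add: act_bracket act_simps a_minus_def A.M.minus_add A.M.a_comm)
  ultimately show ?thesis
    using assms by (auto simp: \<delta>_eq carrier_Z lifts_def bd_simps br_simps)
qed

lemma \<delta>_lin: "\<delta> \<in> lin_hom k L1 Z"
proof -
  have "\<ominus>\<^bsub>L1\<^esub> act t (a \<oplus>\<^bsub>L1\<^esub> b) = \<ominus>\<^bsub>L1\<^esub> act t a \<oplus>\<^bsub>L1\<^esub> \<ominus>\<^bsub>L1\<^esub> act t b" if "t \<in> carrier L0" "a \<in> carrier L1" "b \<in> carrier L1" for t a b
    using that by (simp add: act_simps A.M.minus_add)
  moreover have "\<ominus>\<^bsub>L1\<^esub> act t (r \<odot>\<^bsub>L1\<^esub> a) = r \<odot>\<^bsub>L1\<^esub> (\<ominus>\<^bsub>L1\<^esub> act t a)" if "t \<in> carrier L0" "a \<in> carrier L1" "r \<in> carrier k" for t a r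
    using that by (simp add: act_simps A.smult_r_minus)
  ultimately show ?thesis
    using \<delta>_mem by (auto simp: lin_hom_def \<delta>_eq bd_simps fun_eq_iff)
qed

lemma ZD:
  assumes "z \<in> carrier Z"
  shows "fst z \<in> carrier L0" "snd z \<in> lin_hom k L0 L1" "snd z \<in> extensional (carrier L0)"
    "t \<in> carrier L0 \<Longrightarrow> bd (snd z t) = bracket L0 (fst z) t"
    "a \<in> carrier L1 \<Longrightarrow> snd z (bd a) = act (fst z) a"
    "s \<in> carrier L0 \<Longrightarrow> t \<in> carrier L0 \<Longrightarrow> snd z (bracket L0 s t) = act s (snd z t) \<ominus>\<^bsub>L1\<^esub> act t (snd z s)"
  using assms by (auto simp: carrier_Z lifts_def)

lemma act_snd_fst_eq_0:
  assumes "z \<in> carrier Z" "t \<in> carrier L0"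
  shows "act t (snd z (fst z)) = \<zero>\<^bsub>L1\<^esub>"
proof -
  note z = ZD[OF assms(1)] 
  note l = lin_homD[OF z(2)]
  have "act (fst z) (snd z t) = snd z (bd (snd z t))"
    using assms l z(5) by simp
  also have "\<dots> = snd z (bracket L0 (fst z) t)"
    using assms z(4) by simp
  also have "\<dots> = act (fst z) (snd z t) \<ominus>\<^bsub>L1\<^esub> act t (snd z (fst z))"
    using assms z by simp
  finally show ?thesis
    by (rule iffD1[OF A.M.a_minus_eq_self_iff, rotated 2]) (use assms l(1) z(1) in \<open>simp_all add: act_simps\<close>)
qed

text \<open>Polarisation: the identity for a single element is applied to the sum of
  \<open>z\<close> and \<open>w\<close>, and the two diagonal terms drop out. The last axiom of the
  braiding and the last axiom of the crossed module over \<open>L0\<close> both come down to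
  it.\<close>

lemma act_snd_fst_skew:
  assumes z: "z \<in> carrier Z" and w: "w \<in> carrier Z" and t: "t \<in> carrier L0"
  shows "act t (snd z (fst w)) \<oplus>\<^bsub>L1\<^esub> act t (snd w (fst z)) = \<zero>\<^bsub>L1\<^esub>"
proof -
  have zw: "z \<oplus>\<^bsub>Z\<^esub> w \<in> carrier Z"
    using z w module.submoduleE(5)[OF Z_ambient_module submodule_Z] by simp
  have sum: "fst (z \<oplus>\<^bsub>Z\<^esub> w) = fst z \<oplus>\<^bsub>L0\<^esub> fst w" "s \<in> carrier L0 \<Longrightarrow> snd (z \<oplus>\<^bsub>Z\<^esub> w) s = snd z s \<oplus>\<^bsub>L1\<^esub> snd w s" for s
    by (cases z; cases w; simp)+
  note zD = ZD(1)[OF z] lin_homD[OF ZD(2)[OF z]]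
  note wD = ZD(1)[OF w] lin_homD[OF ZD(2)[OF w]]
  have "act t (snd z (fst z) \<oplus>\<^bsub>L1\<^esub> snd z (fst w) \<oplus>\<^bsub>L1\<^esub> (snd w (fst z) \<oplus>\<^bsub>L1\<^esub> snd w (fst w))) = \<zero>\<^bsub>L1\<^esub>"
    using act_snd_fst_eq_0[OF zw t] zD wD by (simp add: sum)
  then show ?thesis
    using act_snd_fst_eq_0[OF z t] act_snd_fst_eq_0[OF w t] zD(1,2) wD(1,2) t
    by (simp add: act_simps)
qed

lemma fst_lin: "fst \<in> lin_hom k Z L0"
proof -
  have "fst (z \<oplus>\<^bsub>Z\<^esub> w) = fst z \<oplus>\<^bsub>L0\<^esub> fst w" "fst (r \<odot>\<^bsub>Z\<^esub> z) = r \<odot>\<^bsub>L0\<^esub> fst z" for z w r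
    by (cases z; cases w; simp)+
  then show ?thesis using ZD(1) by (simp add: lin_hom_def Pi_iff)
qed

lemma centre_br_bilinear: "bilinear_on k Z Z L1 centre_br"
proof -
  have "(\<lambda>v. snd u (fst v)) \<in> lin_hom k Z L1" if "u \<in> carrier Z" for u
    using lin_hom_comp[OF fst_lin ZD(2)[OF that]] .
  moreover have "(\<lambda>u. snd u (fst v)) \<in> lin_hom k Z L1" if v: "v \<in> carrier Z" for v
  proof -
    have "snd (z \<oplus>\<^bsub>Z\<^esub> w) (fst v) = snd z (fst v) \<oplus>\<^bsub>L1\<^esub> snd w (fst v)"
      "snd (r \<odot>\<^bsub>Z\<^esub> z) (fst v) = r \<odot>\<^bsub>L1\<^esub> snd z (fst v)" for z w r
      using ZD(1)[OF v] by (cases z; cases w; simp)+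
    then show ?thesis
      using lin_homD(1)[OF ZD(2)] ZD(1)[OF v] by (simp add: lin_hom_def[of k Z] Pi_iff)
  qed
  ultimately show ?thesis
    by (simp add: bilinear_on_def centre_br_def)
qed

lemma centre_braided: "braided_crossed_module k L1 Z \<delta> centre_br"
proof (intro braided_crossed_module.intro braided_crossed_module_axioms.intro
    A.module_axioms Z_module \<delta>_lin centre_br_bilinear)
  show "centre_br (\<delta> a) z \<oplus>\<^bsub>L1\<^esub> centre_br z (\<delta> a) = \<zero>\<^bsub>L1\<^esub>" if "a \<in> carrier L1" "z \<in> carrier Z" for a z
    using that ZD(1,5)[OF that(2)] by (simp add: centre_br_def \<delta>_eq act_simps A.M.l_neg)
  show "\<delta> (centre_br z z) = \<zero>\<^bsub>Z\<^esub>" if z: "z \<in> carrier Z" for z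
    using ZD[OF z] act_snd_fst_eq_0[OF z] lin_homD(1)[OF ZD(2)[OF z]]
    by (auto simp: centre_br_def \<delta>_eq bracket_self fun_eq_iff A.M.a_inv_zero)
  show "centre_br u (\<delta> (centre_br v w)) \<oplus>\<^bsub>L1\<^esub> centre_br w (\<delta> (centre_br u v)) \<oplus>\<^bsub>L1\<^esub>
      centre_br v (\<delta> (centre_br w u)) = \<zero>\<^bsub>L1\<^esub>"
    if u: "u \<in> carrier Z" and v: "v \<in> carrier Z" and w: "w \<in> carrier Z" for u v w
  proof -
    note cl = ZD(1)[OF u] ZD(1)[OF v] ZD(1)[OF w]
      lin_homD(1)[OF ZD(2)[OF u]] lin_homD(1)[OF ZD(2)[OF v]] lin_homD(1)[OF ZD(2)[OF w]]
    \<comment> \<open>The element \<open>\<partial>\<close> of \<open>snd v (fst w)\<close> is also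
      the bracket of the first components of \<open>v\<close> and \<open>w\<close>. Evaluating
      \<open>snd u\<close> there, once by the rule for boundaries and once as a derivation, gives
      the relation \<open>A\<close>.\<close>
    have "act (fst u) (snd v (fst w)) = snd u (bd (snd v (fst w)))"
      using ZD(5)[OF u] cl by simp
    also have "\<dots> = snd u (bracket L0 (fst v) (fst w))"
      using ZD(4)[OF v] cl by simp
    also have "\<dots> = act (fst v) (snd u (fst w)) \<ominus>\<^bsub>L1\<^esub> act (fst w) (snd u (fst v))"
      using ZD(6)[OF u] cl by simp
    finally have A: "act (fst u) (snd v (fst w)) = \<dots>" .
    have B: "act (fst v) (snd u (fst w)) \<oplus>\<^bsub>L1\<^esub> act (fst v) (snd w (fst u)) = \<zero>\<^bsub>L1\<^esub>"
      by (rule act_snd_fst_skew[OF u w cl(2)])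
    \<comment> \<open>Substituting \<open>A\<close> cancels the term on which the first component of
      \<open>w\<close> acts; the rest is the polarised identity \<open>B\<close>.\<close>
    have "act (fst u) (snd v (fst w)) \<oplus>\<^bsub>L1\<^esub> act (fst w) (snd u (fst v)) \<oplus>\<^bsub>L1\<^esub> act (fst v) (snd w (fst u)) =
      act (fst v) (snd u (fst w)) \<oplus>\<^bsub>L1\<^esub> act (fst v) (snd w (fst u))"
      unfolding A using cl by (simp add: act_simps a_minus_def A.M.a_assoc A.M.r_neg1)
    then show ?thesis
      using cl ZD(5)[OF u] ZD(5)[OF v] ZD(5)[OF w] B by (simp add: centre_br_def \<delta>_eq)
  qed
qed

section \<open>The action of \<open>L0\<close> on the centre\<close>

lemma centre_act_eq:
  assumes "y \<in> carrier L0" "z \<in> carrier Z"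
  shows "centre_act L0 act y z = \<delta> (\<ominus>\<^bsub>L1\<^esub> snd z y)"
proof -
  note z = ZD[OF assms(2)] lin_homD(1)[OF ZD(2)[OF assms(2)]]
  have "bracket L0 y (fst z) = bd (\<ominus>\<^bsub>L1\<^esub> snd z y)"
    using assms z br_flip[of "fst z" y] by (simp add: bd_simps)
  then show ?thesis
    using assms z by (cases z) (auto simp: centre_act_def \<delta>_eq act_simps fun_eq_iff)
qed

lemma snd_\<delta>: "t \<in> carrier L0 \<Longrightarrow> snd (\<delta> c) t = \<ominus>\<^bsub>L1\<^esub> act t c"
  by (simp add: \<delta>_eq)

text \<open>The action is \<open>\<delta>\<close> applied to the negative of an evaluation, so
  linearity in the two arguments is inherited from \<open>\<delta>\<close>, from the second
  components and from the pointwise operations on them.\<close>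

lemma centre_act_bilinear: "bilinear_on k L0 Z Z (centre_act L0 act)"
proof -
  have neg: "(\<lambda>a. \<ominus>\<^bsub>L1\<^esub> a) \<in> lin_hom k L1 L1"
    by (auto simp: lin_hom_def A.M.minus_add A.smult_r_minus)
  note neg\<delta> = lin_hom_comp[OF neg \<delta>_lin]
  have "centre_act L0 act y \<in> lin_hom k Z Z" if y: "y \<in> carrier L0" for y
  proof -
    have "snd (z \<oplus>\<^bsub>Z\<^esub> w) y = snd z y \<oplus>\<^bsub>L1\<^esub> snd w y" "snd (r \<odot>\<^bsub>Z\<^esub> z) y = r \<odot>\<^bsub>L1\<^esub> snd z y" for z w r
      using y by (cases z; cases w; simp)+
    then have "(\<lambda>z. snd z y) \<in> lin_hom k Z L1"
      using lin_homD(1)[OF ZD(2)] y by (simp add: lin_hom_def[of k Z] Pi_iff)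
    from lin_hom_comp[OF this neg\<delta>] show ?thesis
      by (rule lin_hom_cong) (use Z_module y in \<open>simp_all add: centre_act_eq module_carrier_closed\<close>)
  qed
  moreover have "(\<lambda>y. centre_act L0 act y z) \<in> lin_hom k L0 Z" if z: "z \<in> carrier Z" for z
    using lin_hom_comp[OF ZD(2)[OF z] neg\<delta>]
    by (rule lin_hom_cong) (use M.module_axioms z in \<open>simp_all add: centre_act_eq module_carrier_closed\<close>)
  ultimately show ?thesis by (simp add: bilinear_on_def)
qed

lemma centre_act_lie_module: "lie_module k L0 Z (centre_act L0 act)"
proof (intro lie_module.intro lie_module_axioms.intro M.lie_algebra_axioms Z_module centre_act_bilinear)
  fix x y z assume x: "x \<in> carrier L0" and y: "y \<in> carrier L0" and z: "z \<in> carrier Z"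
  note zD = ZD[OF z] lin_homD(1)[OF ZD(2)[OF z]]
  \<comment> \<open>The second component of \<open>\<delta>\<close> at \<open>- \<xi>(t)\<close>
    sends \<open>s\<close> to \<open>s \<cdot> \<xi>(t)\<close>, the two signs cancelling. With
    double actions in this form, the module law is \<open>\<delta>\<close> applied to the derivation
    rule for \<open>\<xi>\<close>.\<close>
  have act_act: "centre_act L0 act s (centre_act L0 act t z) = \<delta> (\<ominus>\<^bsub>L1\<^esub> act s (snd z t))"
    if "s \<in> carrier L0" "t \<in> carrier L0" for s t
    using that z zD by (simp add: centre_act_eq snd_\<delta> \<delta>_mem act_simps)
  show "centre_act L0 act (bracket L0 x y) z =
    centre_act L0 act x (centre_act L0 act y z) \<ominus>\<^bsub>Z\<^esub> centre_act L0 act y (centre_act L0 act x z)"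
    unfolding act_act[OF x y] act_act[OF y x]
    using x y z zD 
    by (simp add: centre_act_eq br_simps act_simps a_minus_def A.M.minus_add
       flip: lin_hom_zero_minus(2,3)[OF A.module_axioms Z_module \<delta>_lin] lin_homD(2)[OF \<delta>_lin])
qed

lemma centre_crossed: "crossed_module k Z L0 (centre_act L0 act) fst"
proof (intro crossed_module.intro crossed_module_axioms.intro centre_act_lie_module fst_lin)
  show "fst (centre_act L0 act x z) = bracket L0 x (fst z)" for x z
    by (cases z) (simp add: centre_act_def)
  show "centre_act L0 act (fst z) w \<oplus>\<^bsub>Z\<^esub> centre_act L0 act (fst w) z = \<zero>\<^bsub>Z\<^esub>"
    if z: "z \<in> carrier Z" and w: "w \<in> carrier Z" for z w
  proof -
    note zD = ZD[OF z] lin_homD(1)[OF ZD(2)[OF z]] and wD = ZD[OF w] lin_homD(1)[OF ZD(2)[OF w]]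
    \<comment> \<open>Both summands of the claim are values of \<open>\<delta>\<close>, and
      \<open>?c\<close> is the sum of their arguments; it remains to see that
      \<open>\<delta>\<close> kills it.\<close>
    let ?c = "\<ominus>\<^bsub>L1\<^esub> snd w (fst z) \<oplus>\<^bsub>L1\<^esub> \<ominus>\<^bsub>L1\<^esub> snd z (fst w)"
    have "\<delta> ?c = \<zero>\<^bsub>Z\<^esub>"
    proof -
      have "bd ?c = \<zero>\<^bsub>L0\<^esub>"
        using z w zD wD br_flip[of "fst z" "fst w"] by (simp add: bd_simps br_simps M.M.l_neg M.M.r_neg)
      moreover have "act t ?c = \<zero>\<^bsub>L1\<^esub>" if t: "t \<in> carrier L0" for t
      proof -
        have "act t ?c = \<ominus>\<^bsub>L1\<^esub> (act t (snd z (fst w)) \<oplus>\<^bsub>L1\<^esub> act t (snd w (fst z)))"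
          using zD wD t by (simp add: act_simps A.M.minus_add A.M.a_comm)
        then show ?thesis
          using act_snd_fst_skew[OF z w t] by (simp add: A.M.a_inv_zero)
      qed
      ultimately show ?thesis by (auto simp: \<delta>_eq fun_eq_iff A.M.a_inv_zero)
    qed
    then show ?thesis
      using z w zD wD by (simp add: centre_act_eq lin_homD(2)[OF \<delta>_lin])
  qed
qed

section \<open>Cochains on the cokernel with values in the kernel\<close>

abbreviation P0 where "P0 \<equiv> cm_pi0 L1 L0 bd"
abbreviation P1 where "P1 \<equiv> cm_pi1 L1 L0 bd"

section \<open>The Lie algebra structure of the cokernel\<close>

abbreviation cls where "cls x \<equiv> bd ` carrier L1 +>\<^bsub>L0\<^esub> x"

lemma submodule_Im: "submodule (bd ` carrier L1) k L0"
  by (rule submodule_image[OF bd_linear A.module_axioms M.module_axioms])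

lemma Im_ideal:
  assumes "i \<in> bd ` carrier L1" "x \<in> carrier L0"
  shows "bracket L0 x i \<in> bd ` carrier L1" "bracket L0 i x \<in> bd ` carrier L1"
proof -
  obtain a where a: "a \<in> carrier L1" "i = bd a" using assms by auto
  then have "bracket L0 x i = bd (act x a)" using assms by (simp add: bd_act)
  then show *: "bracket L0 x i \<in> bd ` carrier L1" using a assms by (auto simp: act_simps)
  have "bracket L0 i x = \<ominus>\<^bsub>L0\<^esub> bracket L0 x i"
    using assms a by (intro br_flip) (simp_all add: bd_simps)
  then show "bracket L0 i x \<in> bd ` carrier L1"
    using module.submoduleE(3)[OF M.module_axioms submodule_Im *] by simp
qed

lemmas cls_eq_iff = module.coset_eq_iff[OF M.module_axioms submodule_Im]
lemmas mem_cls_iff = module.mem_coset_iff[OF M.module_axioms submodule_Im]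

lemma cls_lin: "(\<lambda>x. cls x) \<in> lin_hom k L0 P0"
  using module.quot_proj(1)[OF M.module_axioms submodule_Im, of "carrier L0"]
  by (simp add: cm_pi0_def lin_hom_lie_quot)

lemma carrier_P0: "carrier P0 = (\<lambda>x. cls x) ` carrier L0"
  using module.quot_proj(2)[OF M.module_axioms submodule_Im, of "carrier L0"]
  by (simp add: cm_pi0_def lin_hom_lie_quot)

lemma zero_P0: "\<zero>\<^bsub>P0\<^esub> = bd ` carrier L1"
  by (simp add: cm_pi0_def lie_quot_def)

lemma cls_self: "x \<in> carrier L0 \<Longrightarrow> x \<in> cls x"
  by (rule abelian_subgroup.a_rcos_self[OF module.abelian_subgroupI_submodule[OF M.module_axioms submodule_Im]])

lemma bracket_P0:
  assumes x: "x \<in> carrier L0" and y: "y \<in> carrier L0"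
  shows "bracket P0 (cls x) (cls y) = cls (bracket L0 x y)"
proof -
  note sub = module.submoduleE[OF M.module_axioms submodule_Im]
  have eq: "cls (bracket L0 x' y') = cls (bracket L0 x y)" if "x' \<in> cls x" "y' \<in> cls y" for x' y'
  proof -
    have x': "x' \<in> carrier L0" "x' \<ominus>\<^bsub>L0\<^esub> x \<in> bd ` carrier L1"
      and y': "y' \<in> carrier L0" "y' \<ominus>\<^bsub>L0\<^esub> y \<in> bd ` carrier L1"
      using that x y by (auto simp: mem_cls_iff)
    \<comment> \<open>Passing from \<open>[x, y]\<close> to \<open>[x', y']\<close> one argument at
      a time keeps each increment inside the ideal.\<close>
    have "bracket L0 (x' \<ominus>\<^bsub>L0\<^esub> x) y' \<oplus>\<^bsub>L0\<^esub> bracket L0 x (y' \<ominus>\<^bsub>L0\<^esub> y) \<in> bd ` carrier L1"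
      by (rule sub(5)[OF Im_ideal(2)[OF x'(2) y'(1)] Im_ideal(1)[OF y'(2) x]])
    also have "bracket L0 (x' \<ominus>\<^bsub>L0\<^esub> x) y' \<oplus>\<^bsub>L0\<^esub> bracket L0 x (y' \<ominus>\<^bsub>L0\<^esub> y) = bracket L0 x' y' \<ominus>\<^bsub>L0\<^esub> bracket L0 x y"
      using x y x' y' by (simp add: br_simps a_minus_def M.M.a_assoc M.M.r_neg1)
    finally show ?thesis
      using x y x' y' by (simp add: cls_eq_iff br_simps)
  qed
  have "bracket P0 (cls x) (cls y) = (\<Union>x'\<in>cls x. \<Union>y'\<in>cls y. cls (bracket L0 x' y'))"
    by (simp add: cm_pi0_def lie_quot_def)
  also have "\<dots> = (\<Union>x'\<in>cls x. \<Union>y'\<in>cls y. cls (bracket L0 x y))"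
    by (intro SUP_cong refl eq)
  also have "\<dots> = cls (bracket L0 x y)"
    using cls_self[OF x] cls_self[OF y] by blast
  finally show ?thesis .
qed

section \<open>The kernel as a module over the cokernel\<close>

lemma submodule_Ker: "submodule (a_kernel L1 L0 bd) k L1"
  by (rule submodule_kernel[OF bd_linear A.module_axioms M.module_axioms])

lemma P1_module: "module k P1"
  unfolding cm_pi1_def by (rule submodule.submodule_is_module[OF submodule_Ker A.module_axioms])

lemma carrier_P1: "a \<in> carrier P1 \<longleftrightarrow> a \<in> carrier L1 \<and> bd a = \<zero>\<^bsub>L0\<^esub>"
  by (simp add: cm_pi1_def a_kernel_eq)

lemma P1_ops [simp]: "add P1 = add L1" "smult P1 = smult L1" "zero P1 = zero L1"
  by (simp_all add: cm_pi1_def)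

lemma P1_a_inv: "a \<in> carrier P1 \<Longrightarrow> \<ominus>\<^bsub>P1\<^esub> a = \<ominus>\<^bsub>L1\<^esub> a" "b \<in> carrier P1 \<Longrightarrow> a \<ominus>\<^bsub>P1\<^esub> b = a \<ominus>\<^bsub>L1\<^esub> b"
  using submodule_a_inv[OF A.module_axioms submodule_Ker]
  by (simp_all add: cm_pi1_def a_minus_def)

lemma act_P1: "x \<in> carrier L0 \<Longrightarrow> a \<in> carrier P1 \<Longrightarrow> act x a \<in> carrier P1"
  by (simp add: carrier_P1 act_simps bd_act br_simps)

text \<open>The image of \<open>\<partial>\<close> acts trivially on the kernel, because
  \<open>\<partial>(b) \<cdot> a = - \<partial>(a) \<cdot> b = 0\<close>. Hence a coset takes only
  one value on \<open>a\<close>, and \<open>the_elem\<close> is applied to a singleton.\<close>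

lemma pi_act_cls:
  assumes "x \<in> carrier L0" "a \<in> carrier P1"
  shows "pi_act act (cls x) a = act x a"
proof -
  have eq: "act x' a = act x a" if "x' \<in> cls x" for x'
  proof -
    have x': "x' \<in> carrier L0" "x' \<ominus>\<^bsub>L0\<^esub> x \<in> bd ` carrier L1"
      using that assms by (simp_all add: mem_cls_iff)
    obtain b where b: "b \<in> carrier L1" "x' \<ominus>\<^bsub>L0\<^esub> x = bd b"
      using x'(2) by blast
    have "act x' a \<ominus>\<^bsub>L1\<^esub> act x a = act (bd b) a"
      using assms x' by (simp add: carrier_P1 act_simps flip: b(2))
    also have "\<dots> = \<zero>\<^bsub>L1\<^esub>"
      using act_bd_flip[of a b] assms b by (simp add: carrier_P1 act_simps A.M.a_inv_zero)
    finally show ?thesis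
      using assms x' by (simp add: carrier_P1 act_simps A.M.a_minus_eq_zero_iff)
  qed
  have "(\<lambda>x. act x a) ` cls x = (\<lambda>_. act x a) ` cls x"
    by (intro image_cong refl eq)
  also have "\<dots> = {act x a}"
    using cls_self[OF assms(1)] by blast
  finally have "(\<lambda>x. act x a) ` cls x = {act x a}" .
  then show ?thesis by (simp add: pi_act_def)
qed

section \<open>Cochains, cocycles and coboundaries in low degrees\<close>

context notes One_nat_def [simp del] begin

text \<open>All functions on tuples, with no multilinearity or alternation imposed. Cochains,
  cocycles and coboundaries of one degree share its operations, and their cosets are compared inside
  it.\<close>

abbreviation F where "F n \<equiv> fun_space (tuples P0 n) P1"
abbreviation d where "d \<equiv> ce_diff P0 P1 (pi_act act)"
abbreviation cochains where "cochains \<equiv> ce_cochains k P0 P1"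
abbreviation cocycles where "cocycles \<equiv> ce_cocycles k P0 P1 (pi_act act)"
abbreviation coboundaries where "coboundaries \<equiv> ce_coboundaries k P0 P1 (pi_act act)"

lemma F_module: "module k (F n)"
  by (rule module_fun_space[OF P1_module])

lemma cochains_update: "(cochains n)\<lparr>carrier := X\<rparr> = (F n)\<lparr>carrier := X\<rparr>"
  by (simp add: ce_cochains_def)

lemma cochains_subset: "carrier (cochains n) \<subseteq> carrier (F n)"
  by (auto simp: ce_cochains_def fun_space_def)

lemma cochains_ops [simp]: "add (cochains n) = add (F n)" "smult (cochains n) = smult (F n)"
    "zero (cochains n) = zero (F n)"
  by (simp_all add: ce_cochains_def)

lemma cocycles_iff: "\<omega> \<in> cocycles n \<longleftrightarrow> \<omega> \<in> carrier (cochains n) \<and> d n \<omega> = \<zero>\<^bsub>F (Suc n)\<^esub>"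
  by (simp add: ce_cocycles_def a_kernel_eq)

lemma cochains_coset: "S +>\<^bsub>cochains n\<^esub> \<phi> = S +>\<^bsub>F n\<^esub> \<phi>"
  by (simp add: a_r_coset_def')

lemma tuples_P0:
  "tuples P0 1 = (\<lambda>x. [cls x]) ` carrier L0"
  "tuples P0 2 = (\<lambda>(x, y). [cls x, cls y]) ` (carrier L0 \<times> carrier L0)"
  "tuples P0 3 = (\<lambda>(x, y, z). [cls x, cls y, cls z]) ` (carrier L0 \<times> carrier L0 \<times> carrier L0)"
proof -
  let ?c = "\<lambda>x. cls x" and ?L = "carrier L0"
  show "tuples P0 1 = (\<lambda>x. [cls x]) ` ?L"
    by (simp add: tuples_1 carrier_P0 image_image)
  have P2: "?c ` ?L \<times> ?c ` ?L = map_prod ?c ?c ` (?L \<times> ?L)"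
    by (simp add: map_prod_surj_on[of ?c ?L "?c ` ?L" ?c ?L "?c ` ?L"])
  show "tuples P0 2 = (\<lambda>(x, y). [cls x, cls y]) ` (?L \<times> ?L)"
    unfolding tuples_2 carrier_P0 P2 image_image by (rule image_cong) auto
  have P3: "?c ` ?L \<times> map_prod ?c ?c ` (?L \<times> ?L) = map_prod ?c (map_prod ?c ?c) ` (?L \<times> ?L \<times> ?L)"
    by (simp add: map_prod_surj_on[of ?c ?L "?c ` ?L" "map_prod ?c ?c" "?L \<times> ?L" "map_prod ?c ?c ` (?L \<times> ?L)"])
  show "tuples P0 3 = (\<lambda>(x, y, z). [cls x, cls y, cls z]) ` (?L \<times> ?L \<times> ?L)"
    unfolding tuples_3 carrier_P0 P2 P3 image_image by (rule image_cong) auto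
qed

lemma tuples_P0_mem:
  assumes "x \<in> carrier L0" "y \<in> carrier L0" "z \<in> carrier L0"
  shows "[cls x] \<in> tuples P0 1" "[cls x, cls y] \<in> tuples P0 2" "[cls x, cls y, cls z] \<in> tuples P0 3"
  using assms by (auto simp: tuples_def carrier_P0)

lemma cls_mem: "x \<in> carrier L0 \<Longrightarrow> cls x \<in> carrier P0"
  by (auto simp: carrier_P0)

text \<open>The projection to the cokernel is linear and surjective, so linearity may be tested on
  representatives.\<close>

lemma lin_hom_P0_iff: "g \<in> lin_hom k P0 W \<longleftrightarrow> (\<lambda>t. g (cls t)) \<in> lin_hom k L0 W"
proof
  show "g \<in> lin_hom k P0 W \<Longrightarrow> (\<lambda>t. g (cls t)) \<in> lin_hom k L0 W"
    using lin_hom_comp[OF cls_lin] .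
  assume "(\<lambda>t. g (cls t)) \<in> lin_hom k L0 W"
  note g = lin_homD[OF this]
  show "g \<in> lin_hom k P0 W"
    using g(1) by (auto simp: lin_hom_def[of k P0] carrier_P0 simp flip: g(2,3) lin_homD(2,3)[OF cls_lin])
qed

lemma cochain_1_iff:
  "\<phi> \<in> carrier (cochains 1) \<longleftrightarrow> \<phi> \<in> carrier (F 1) \<and> (\<lambda>t. \<phi> [cls t]) \<in> lin_hom k L0 P1"
proof -
  have "(\<forall>xs\<in>tuples P0 1. \<forall>i<1. (\<lambda>u. \<phi> (xs[i := u])) \<in> lin_hom k P0 P1)
      \<longleftrightarrow> (\<lambda>u. \<phi> [u]) \<in> lin_hom k P0 P1"
    using M.zero_closed by (auto simp: tuples_P0(1))
  moreover have "distinct xs" if "xs \<in> tuples P0 1" for xs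
    using that by (auto simp: tuples_P0(1))
  ultimately show ?thesis
    by (auto simp: ce_cochains_def fun_space_def lin_hom_P0_iff)
qed

text \<open>A pair of cosets that is not distinct can be written with one representative repeated,
  so alternation is tested on such pairs only.\<close>

lemma cochain_2I:
  assumes "\<omega> \<in> carrier (F 2)"
    and "\<And>y. y \<in> carrier L0 \<Longrightarrow> (\<lambda>t. \<omega> [cls t, cls y]) \<in> lin_hom k L0 P1"
    and "\<And>y. y \<in> carrier L0 \<Longrightarrow> (\<lambda>t. \<omega> [cls y, cls t]) \<in> lin_hom k L0 P1"
    and "\<And>t. t \<in> carrier L0 \<Longrightarrow> \<omega> [cls t, cls t] = \<zero>\<^bsub>L1\<^esub>"
  shows "\<omega> \<in> carrier (cochains 2)"
proof -
  have "(\<lambda>u. \<omega> (xs[i := u])) \<in> lin_hom k P0 P1" if "xs \<in> tuples P0 2" "i < 2" for xs i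
    using that assms(2,3) by (auto simp: tuples_P0(2) lin_hom_P0_iff less_2_cases_iff)
  moreover have "\<omega> xs = \<zero>\<^bsub>L1\<^esub>" if "xs \<in> tuples P0 2" "\<not> distinct xs" for xs
    using that assms(4) by (auto simp: tuples_P0(2))
  ultimately show ?thesis
    using assms(1) by (auto simp: ce_cochains_def fun_space_def)
qed

lemma cochains_0: "carrier (cochains 0) = carrier (F 0)"
  by (auto simp: ce_cochains_def fun_space_def tuples_0)

lemma F_closed:
  "\<omega> \<in> carrier (F 0) \<Longrightarrow> \<omega> [] \<in> carrier P1"
  "\<phi> \<in> carrier (F 1) \<Longrightarrow> x \<in> carrier L0 \<Longrightarrow> \<phi> [cls x] \<in> carrier P1"
  "\<psi> \<in> carrier (F 2) \<Longrightarrow> x \<in> carrier L0 \<Longrightarrow> y \<in> carrier L0 \<Longrightarrow> \<psi> [cls x, cls y] \<in> carrier P1"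
  by (erule fun_space_closed, simp add: tuples_0 tuples_P0_mem)+

lemma d0:
  assumes "\<omega> \<in> carrier (F 0)" "x \<in> carrier L0"
  shows "d 0 \<omega> [cls x] = act x (\<omega> [])"
  using assms module.ce_diff_0[OF P1_module, of "cls x" P0 "pi_act act" \<omega>]
  by (simp add: cls_mem pi_act_cls F_closed act_P1)

lemma d1:
  assumes "\<phi> \<in> carrier (F 1)" "x \<in> carrier L0" "y \<in> carrier L0"
  shows "d 1 \<phi> [cls x, cls y] = act x (\<phi> [cls y]) \<ominus>\<^bsub>L1\<^esub> act y (\<phi> [cls x]) \<ominus>\<^bsub>L1\<^esub> \<phi> [cls (bracket L0 x y)]"
  using assms module.ce_diff_1[OF P1_module, of "cls x" P0 "cls y" "pi_act act" \<phi>]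
  by (simp add: cls_mem pi_act_cls F_closed act_P1 bracket_P0 P1_a_inv br_simps)

lemma d2:
  assumes "\<omega> \<in> carrier (F 2)" "x \<in> carrier L0" "y \<in> carrier L0" "z \<in> carrier L0"
  shows "d 2 \<omega> [cls x, cls y, cls z] =
    act x (\<omega> [cls y, cls z]) \<ominus>\<^bsub>L1\<^esub> act y (\<omega> [cls x, cls z]) \<oplus>\<^bsub>L1\<^esub> act z (\<omega> [cls x, cls y])
    \<ominus>\<^bsub>L1\<^esub> \<omega> [cls (bracket L0 x y), cls z] \<oplus>\<^bsub>L1\<^esub> \<omega> [cls (bracket L0 x z), cls y]
    \<ominus>\<^bsub>L1\<^esub> \<omega> [cls (bracket L0 y z), cls x]"
  using assms module.ce_diff_2[OF P1_module, of "cls x" P0 "cls y" "cls z" "pi_act act" \<omega>]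
  by (simp add: cls_mem pi_act_cls F_closed act_P1 bracket_P0 P1_a_inv br_simps)

lemma act_lin_P1: "x \<in> carrier L0 \<Longrightarrow> act x \<in> lin_hom k P1 P1"
  using lin_homD[OF act_lin(1)] act_P1 by (simp add: lin_hom_def[of k P1] carrier_P1 Pi_iff)

lemma eval_lin: "xs \<in> tuples P0 n \<Longrightarrow> (\<lambda>\<omega>. \<omega> xs) \<in> lin_hom k (F n) P1"
  by (auto simp: lin_hom_def[of k "F n"] fun_space_apply fun_space_closed)

lemma d0_lin: "d 0 \<in> lin_hom k (F 0) (F 1)"
proof (rule lin_hom_fun_spaceI[OF P1_module _ _ module_carrier_closed(1,2)[OF F_module]])
  have F1: "restrict (d 0 \<omega>) (tuples P0 1) = d 0 \<omega>" for \<omega>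
    by (simp add: ce_diff_def One_nat_def)
  show "d 0 \<omega> \<in> carrier (F 1)" if "\<omega> \<in> carrier (F 0)" for \<omega>
  proof -
    have "restrict (d 0 \<omega>) (tuples P0 1) \<in> carrier (F 1)"
      using that by (intro restrict_fun_space) (auto simp: tuples_P0(1) d0 F_closed act_P1)
    then show ?thesis by (simp add: F1)
  qed
  show "(\<lambda>\<omega>. d 0 \<omega> xs) \<in> lin_hom k (F 0) P1" if xs: "xs \<in> tuples P0 1" for xs
  proof -
    obtain x where x: "x \<in> carrier L0" "xs = [cls x]"
      using xs unfolding tuples_P0 by blast
    have "(\<lambda>\<omega>. act x (\<omega> [])) \<in> lin_hom k (F 0) P1"
      by (rule lin_hom_comp[OF eval_lin act_lin_P1]) (use x in \<open>simp_all add: tuples_0\<close>)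
    then show ?thesis
      by (rule lin_hom_cong) (use x module_carrier_closed[OF F_module] in \<open>simp_all add: d0\<close>)
  qed
qed

text \<open>Makes \<open>coboundaries 2\<close>, the image of this set under \<open>d 1\<close>, a
  subspace.\<close>

lemma cochains_1_submodule: "submodule (carrier (cochains 1)) k (F 1)"
proof -
  note F = module_carrier_closed[OF F_module[of 1]]
  have 1: "(\<lambda>t. f [cls t] \<oplus>\<^bsub>L1\<^esub> g [cls t]) \<in> lin_hom k L0 P1"
    if "(\<lambda>t. f [cls t]) \<in> lin_hom k L0 P1" "(\<lambda>t. g [cls t]) \<in> lin_hom k L0 P1" for f g
    using lin_hom_add_smult(1)[OF P1_module M.module_axioms that] by simp
  have 2: "(\<lambda>t. r \<odot>\<^bsub>L1\<^esub> f [cls t]) \<in> lin_hom k L0 P1"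
    if f: "(\<lambda>t. f [cls t]) \<in> lin_hom k L0 P1" and r: "r \<in> carrier k" for f r
    using lin_homD[OF f] r module_carrier_closed[OF P1_module]
    by (auto simp: lin_hom_def[of k L0 P1] carrier_P1 A.smult_r_distr R.m_comm simp flip: A.smult_assoc1)
  show ?thesis
  proof (rule module.submoduleI_smult[OF F_module])
    show "carrier (cochains 1) \<subseteq> carrier (F 1)" by (rule cochains_subset)
    have "(\<lambda>t. \<zero>\<^bsub>F 1\<^esub> [cls t]) \<in> lin_hom k L0 P1"
      by (auto simp: lin_hom_def[of k L0 P1] fun_space_apply tuples_P0_mem carrier_P1 bd_simps)
    then show "\<zero>\<^bsub>F 1\<^esub> \<in> carrier (cochains 1)"
      using F by (simp add: cochain_1_iff)
    show "f \<oplus>\<^bsub>F 1\<^esub> g \<in> carrier (cochains 1)" if "f \<in> carrier (cochains 1)" "g \<in> carrier (cochains 1)" for f g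
    proof -
      have "(\<lambda>t. (f \<oplus>\<^bsub>F 1\<^esub> g) [cls t]) \<in> lin_hom k L0 P1"
        by (rule lin_hom_cong[OF 1[of f g]])
         (use that in \<open>simp_all add: cochain_1_iff fun_space_apply tuples_P0_mem\<close>)
      then show ?thesis using that F by (simp add: cochain_1_iff)
    qed
    show "r \<odot>\<^bsub>F 1\<^esub> f \<in> carrier (cochains 1)" if "r \<in> carrier k" "f \<in> carrier (cochains 1)" for r f
    proof -
      have "(\<lambda>t. (r \<odot>\<^bsub>F 1\<^esub> f) [cls t]) \<in> lin_hom k L0 P1"
        by (rule lin_hom_cong[OF 2[of f r]])
         (use that in \<open>simp_all add: cochain_1_iff fun_space_apply tuples_P0_mem\<close>)
      then show ?thesis using that F by (simp add: cochain_1_iff)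
    qed
  qed
qed

lemma cochains_1_module: "module k (cochains 1)"
  using submodule.submodule_is_module[OF cochains_1_submodule F_module] cochains_update[of "carrier (cochains 1)" 1]
  by simp

text \<open>Each value of \<open>d 1\<close> is a combination of evaluations, some followed by the
  action of a fixed element, so linearity in the cochain holds on all of \<open>F 1\<close>.\<close>

lemma d1_lin: "d 1 \<in> lin_hom k (F 1) (F 2)"
proof (rule lin_hom_fun_spaceI[OF P1_module _ _ module_carrier_closed(1,2)[OF F_module]])
  have F2: "restrict (d 1 \<phi>) (tuples P0 2) = d 1 \<phi>" for \<phi>
    by (simp add: ce_diff_def flip: Suc_1)
  show "d 1 \<phi> \<in> carrier (F 2)" if \<phi>: "\<phi> \<in> carrier (F 1)" for \<phi>
  proof -
    have "d 1 \<phi> [cls x, cls y] \<in> carrier P1" if "x \<in> carrier L0" "y \<in> carrier L0" for x y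
    proof -
      interpret P: module k P1 by (rule P1_module)
      have b: "bracket L0 x y \<in> carrier L0" using that by (simp add: br_simps)
      have "act x (\<phi> [cls y]) \<ominus>\<^bsub>P1\<^esub> act y (\<phi> [cls x]) \<ominus>\<^bsub>P1\<^esub> \<phi> [cls (bracket L0 x y)] \<in> carrier P1"
        by (intro P.M.minus_closed act_P1 F_closed(2)[OF \<phi>] that b)
      then show ?thesis
        unfolding d1[OF \<phi> that] P1_a_inv(2)[OF act_P1[OF that(2) F_closed(2)[OF \<phi> that(1)]]]
          P1_a_inv(2)[OF F_closed(2)[OF \<phi> b]] .
    qed
    then have "restrict (d 1 \<phi>) (tuples P0 2) \<in> carrier (F 2)"
      by (intro restrict_fun_space) (auto simp: tuples_P0(2))
    then show ?thesis by (simp add: F2)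
  qed
  show "(\<lambda>\<phi>. d 1 \<phi> xs) \<in> lin_hom k (F 1) P1" if xs: "xs \<in> tuples P0 2" for xs
  proof -
    obtain x y where x: "x \<in> carrier L0" "y \<in> carrier L0" "xs = [cls x, cls y]"
      using xs by (auto simp: tuples_P0(2))
    have ev: "(\<lambda>\<phi>. \<phi> [cls s]) \<in> lin_hom k (F 1) P1" if "s \<in> carrier L0" for s
      using that by (intro eval_lin tuples_P0_mem)
    have b: "bracket L0 x y \<in> carrier L0" using x by (simp add: br_simps)
    have "(\<lambda>\<phi>. act x (\<phi> [cls y]) \<ominus>\<^bsub>P1\<^esub> act y (\<phi> [cls x]) \<ominus>\<^bsub>P1\<^esub> \<phi> [cls (bracket L0 x y)]) \<in> lin_hom k (F 1) P1"
      by (rule lin_hom_add_smult(2)[OF P1_module F_module lin_hom_add_smult(2)[OF P1_module F_module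
          lin_hom_comp[OF ev[OF x(2)] act_lin_P1[OF x(1)]]
          lin_hom_comp[OF ev[OF x(1)] act_lin_P1[OF x(2)]]] ev[OF b]])
    moreover have "act x (\<phi> [cls y]) \<ominus>\<^bsub>P1\<^esub> act y (\<phi> [cls x]) \<ominus>\<^bsub>P1\<^esub> \<phi> [cls (bracket L0 x y)] = d 1 \<phi> xs"
      if "\<phi> \<in> carrier (F 1)" for \<phi>
      using d1[OF that x(1,2)] F_closed(2)[OF that] x b act_P1 by (simp add: P1_a_inv)
    ultimately show ?thesis
      by (rule lin_hom_cong[OF _ _ module_carrier_closed(1,2)[OF F_module]])
  qed
qed

lemma coboundaries_eq:
  "coboundaries 0 = {\<zero>\<^bsub>F 0\<^esub>}" "coboundaries 1 = d 0 ` carrier (F 0)"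
  "coboundaries 2 = d 1 ` carrier (cochains 1)"
  by (simp_all add: ce_coboundaries_def numeral_2_eq_2 cochains_0 One_nat_def)

lemma coboundaries_submodule:
  "submodule (coboundaries 0) k (F 0)" "submodule (coboundaries 1) k (F 1)"
  "submodule (coboundaries 2) k (F 2)"
proof -
  interpret F0: module k "F 0" by (rule F_module)
  show "submodule (coboundaries 0) k (F 0)"
    unfolding coboundaries_eq by (rule F0.submoduleI_smult) auto
  show "submodule (coboundaries 1) k (F 1)"
    unfolding coboundaries_eq by (rule submodule_image[OF d0_lin F_module F_module])
  have "d 1 \<in> lin_hom k (cochains 1) (F 2)"
    by (rule lin_hom_restrict[OF d1_lin cochains_subset])
     (use cochains_subset[of 1] lin_homD(1)[OF d1_lin] in auto)
  then show "submodule (coboundaries 2) k (F 2)"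
    unfolding coboundaries_eq by (rule submodule_image[OF _ cochains_1_module F_module])
qed

lemma cohomology_eq:
  "ce_cohomology k P0 P1 (pi_act act) n = quot_space ((F n)\<lparr>carrier := cocycles n\<rparr>) (coboundaries n)"
  by (simp add: ce_cohomology_def cochains_update)

lemma cocycles_subset: "cocycles n \<subseteq> carrier (F n)"
  using cochains_subset[of n] by (auto simp: cocycles_iff)

lemma coh_proj:
  assumes "submodule (coboundaries n) k (F n)"
  shows "(\<lambda>\<phi>. coboundaries n +>\<^bsub>F n\<^esub> \<phi>) \<in>
      lin_hom k ((F n)\<lparr>carrier := cocycles n\<rparr>) (ce_cohomology k P0 P1 (pi_act act) n)"
    and "carrier (ce_cohomology k P0 P1 (pi_act act) n) = (\<lambda>\<phi>. coboundaries n +>\<^bsub>F n\<^esub> \<phi>) ` cocycles n"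
  unfolding cohomology_eq using module.quot_proj[OF F_module assms cocycles_subset] by simp_all

section \<open>The obstruction to being a derivation\<close>

lemma d_eq_zero_iff: "d n \<omega> = \<zero>\<^bsub>F (Suc n)\<^esub> \<longleftrightarrow> (\<forall>xs\<in>tuples P0 (Suc n). d n \<omega> xs = \<zero>\<^bsub>L1\<^esub>)"
  by (auto simp: ce_diff_def fun_space_def fun_eq_iff)

lemma cocycle_0_iff: "\<omega> \<in> cocycles 0 \<longleftrightarrow> \<omega> \<in> carrier (F 0) \<and> (\<forall>x\<in>carrier L0. act x (\<omega> []) = \<zero>\<^bsub>L1\<^esub>)"
proof -
  have "d 0 \<omega> = \<zero>\<^bsub>F (Suc 0)\<^esub> \<longleftrightarrow> (\<forall>x\<in>carrier L0. act x (\<omega> []) = \<zero>\<^bsub>L1\<^esub>)" if "\<omega> \<in> carrier (F 0)"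
    unfolding d_eq_zero_iff unfolding tuples_P0(1)[unfolded One_nat_def] using d0[OF that] by simp
  then show ?thesis by (auto simp: cocycles_iff cochains_0)
qed

lemma cocycle_1_iff: "\<phi> \<in> cocycles 1 \<longleftrightarrow> \<phi> \<in> carrier (cochains 1) \<and> d 1 \<phi> = \<zero>\<^bsub>F 2\<^esub>"
  by (simp add: cocycles_iff)

text \<open>Both sides are the invariants. The kernel of \<open>\<delta>\<close> consists of the
  elements of the kernel of \<open>\<partial>\<close> on which \<open>L0\<close> acts by zero, and a
  0-cocycle is a function on the empty tuple whose value is such an element. As the coboundaries in
  degree 0 are zero, passing to cosets loses nothing.\<close>

lemma H0_iso: "lin_iso k (cm_pi1 L1 Z \<delta>) (ce_cohomology k P0 P1 (pi_act act) 0)"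
proof -
  let ?U = "cm_pi1 L1 Z \<delta>" and ?E = "(F 0)\<lparr>carrier := cocycles 0\<rparr>"
  define \<iota> where "\<iota> c = (\<lambda>xs\<in>tuples P0 0. c)" for c :: 'c
  have U: "c \<in> carrier ?U \<longleftrightarrow> c \<in> carrier P1 \<and> (\<forall>t\<in>carrier L0. act t c = \<zero>\<^bsub>L1\<^esub>)" for c
  proof -
    have "\<ominus>\<^bsub>L1\<^esub> act t c = \<zero>\<^bsub>L1\<^esub> \<longleftrightarrow> act t c = \<zero>\<^bsub>L1\<^esub>" if "t \<in> carrier L0" "c \<in> carrier L1" for t
      using that A.M.minus_minus[of "act t c"] by (auto simp: act_simps A.M.a_inv_zero)
    then show ?thesis
      by (auto simp: cm_pi1_def a_kernel_eq \<delta>_eq fun_eq_iff)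
  qed
  have mem: "\<iota> c \<in> cocycles 0" if "c \<in> carrier ?U" for c
    using that by (auto simp: \<iota>_def cocycle_0_iff U tuples_0 fun_space_def)
  have "\<iota> \<in> lin_hom k ?U ?E"
    using mem by (auto simp: lin_hom_def \<iota>_def fun_space_def fun_eq_iff cm_pi1_def)
  then have lin: "(\<lambda>c. coboundaries 0 +>\<^bsub>F 0\<^esub> \<iota> c) \<in> lin_hom k ?U (ce_cohomology k P0 P1 (pi_act act) 0)"
    by (rule lin_hom_comp) (rule coh_proj(1)[OF coboundaries_submodule(1)])
  have "\<iota> ` carrier ?U = cocycles 0"
  proof
    show "\<iota> ` carrier ?U \<subseteq> cocycles 0" using mem by blast
    show "cocycles 0 \<subseteq> \<iota> ` carrier ?U"
    proof
      fix \<omega> assume \<omega>: "\<omega> \<in> cocycles 0"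
      then have "\<iota> (\<omega> []) = \<omega>"
        by (auto simp: \<iota>_def cocycle_0_iff tuples_0 fun_space_def fun_eq_iff PiE_iff extensional_def)
      moreover have "\<omega> [] \<in> carrier ?U"
        using \<omega> F_closed(1) by (simp add: cocycle_0_iff U)
      ultimately show "\<omega> \<in> \<iota> ` carrier ?U" by force
    qed
  qed
  then have "(\<lambda>\<phi>. coboundaries 0 +>\<^bsub>F 0\<^esub> \<phi>) ` (\<iota> ` carrier ?U) = carrier (ce_cohomology k P0 P1 (pi_act act) 0)"
    by (simp add: coh_proj(2)[OF coboundaries_submodule(1)])
  then have onto: "(\<lambda>c. coboundaries 0 +>\<^bsub>F 0\<^esub> \<iota> c) ` carrier ?U = carrier (ce_cohomology k P0 P1 (pi_act act) 0)"
    by (simp only: image_image)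
  have "inj_on (\<lambda>c. coboundaries 0 +>\<^bsub>F 0\<^esub> \<iota> c) (carrier ?U)"
  proof
    fix a b assume ab: "a \<in> carrier ?U" "b \<in> carrier ?U"
      and eq: "coboundaries 0 +>\<^bsub>F 0\<^esub> \<iota> a = coboundaries 0 +>\<^bsub>F 0\<^esub> \<iota> b"
    have F: "\<iota> a \<in> carrier (F 0)" "\<iota> b \<in> carrier (F 0)"
      using mem ab by (simp_all add: cocycle_0_iff)
    then have "\<iota> a \<ominus>\<^bsub>F 0\<^esub> \<iota> b = \<zero>\<^bsub>F 0\<^esub>"
      using eq module.coset_eq_iff[OF F_module coboundaries_submodule(1)] by (simp add: coboundaries_eq)
    then have "\<iota> a = \<iota> b"
      using F abelian_group.a_minus_eq_zero_iff[OF module.axioms(2)[OF F_module]] by blast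
    then have "\<iota> a [] = \<iota> b []" by simp
    then show "a = b" by (simp add: \<iota>_def tuples_0)
  qed
  with lin onto show ?thesis
    unfolding lin_iso_def bij_betw_def by blast
qed

section \<open>The defect of a lift and its descent to the cokernel\<close>

abbreviation Lifts where "Lifts \<equiv> Z\<lparr>carrier := lifts\<rparr>"

lemma Lifts_module: "module k Lifts"
  using submodule.submodule_is_module[OF submodule_lifts Z_ambient_module] by simp

lemma liftsD:
  assumes "z \<in> lifts"
  shows "fst z \<in> carrier L0" "snd z \<in> lin_hom k L0 L1" "snd z \<in> extensional (carrier L0)"
    "t \<in> carrier L0 \<Longrightarrow> bd (snd z t) = bracket L0 (fst z) t"
    "a \<in> carrier L1 \<Longrightarrow> snd z (bd a) = act (fst z) a"
  using assms by (auto simp: lifts_def)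

lemma Z_subset_lifts: "carrier Z \<subseteq> lifts"
  by (auto simp: carrier_Z)

lemma Lifts_fst_lin: "fst \<in> lin_hom k Lifts L0"
proof -
  have "fst (z \<oplus>\<^bsub>Z\<^esub> w) = fst z \<oplus>\<^bsub>L0\<^esub> fst w" "fst (r \<odot>\<^bsub>Z\<^esub> z) = r \<odot>\<^bsub>L0\<^esub> fst z" for z w r
    by (cases z; cases w; simp)+
  then show ?thesis using liftsD(1) by (simp add: lin_hom_def Pi_iff)
qed

text \<open>The Chevalley--Eilenberg differential of the second component, taken as a 1-cochain of
  \<open>L0\<close> with values in \<open>L1\<close>.\<close>

definition defect :: "'b \<times> ('b \<Rightarrow> 'c) \<Rightarrow> 'b \<Rightarrow> 'b \<Rightarrow> 'c" where
  "defect z s t = act s (snd z t) \<ominus>\<^bsub>L1\<^esub> act t (snd z s) \<ominus>\<^bsub>L1\<^esub> snd z (bracket L0 s t)"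

lemma defect_closed:
  assumes "z \<in> lifts" "s \<in> carrier L0" "t \<in> carrier L0"
  shows "defect z s t \<in> carrier L1"
  using assms lin_homD(1)[OF liftsD(2)[OF assms(1)]] by (simp add: defect_def act_simps br_simps)

text \<open>Composing the second component with \<open>\<partial>\<close> gives the bracket with the
  first component, which is a derivation by the Jacobi identity.\<close>

lemma defect_ker:
  assumes z: "z \<in> lifts" and s: "s \<in> carrier L0" and t: "t \<in> carrier L0"
  shows "defect z s t \<in> carrier P1"
proof -
  let ?x = "fst z"
  note x = liftsD(1)[OF z] and cl = lin_homD(1)[OF liftsD(2)[OF z]]
  have "bd (defect z s t) = bracket L0 s (bracket L0 ?x t) \<ominus>\<^bsub>L0\<^esub> bracket L0 t (bracket L0 ?x s)
      \<ominus>\<^bsub>L0\<^esub> bracket L0 ?x (bracket L0 s t)"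
    using x s t cl liftsD(4)[OF z]
    by (simp add: defect_def act_simps br_simps bd_simps bd_act)
  also have "bracket L0 s (bracket L0 ?x t) = \<ominus>\<^bsub>L0\<^esub> bracket L0 s (bracket L0 t ?x)"
    using x s t br_flip[of t ?x] by (simp add: br_simps)
  also have "\<ominus>\<^bsub>L0\<^esub> bracket L0 s (bracket L0 t ?x) \<ominus>\<^bsub>L0\<^esub> bracket L0 t (bracket L0 ?x s) \<ominus>\<^bsub>L0\<^esub> bracket L0 ?x (bracket L0 s t) =
     \<ominus>\<^bsub>L0\<^esub> (bracket L0 ?x (bracket L0 s t) \<oplus>\<^bsub>L0\<^esub> bracket L0 s (bracket L0 t ?x) \<oplus>\<^bsub>L0\<^esub> bracket L0 t (bracket L0 ?x s))"
    using x s t by (simp add: br_simps a_minus_def M.M.minus_add M.M.a_ac)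
  also have "\<dots> = \<zero>\<^bsub>L0\<^esub>"
    using jacobi[OF x s t] by (simp add: M.M.a_inv_zero)
  finally show ?thesis
    using defect_closed[OF z s t] by (simp add: carrier_P1)
qed

lemma defect_self:
  assumes "z \<in> lifts" "s \<in> carrier L0"
  shows "defect z s s = \<zero>\<^bsub>L1\<^esub>"
  using assms lin_homD(1)[OF liftsD(2)[OF assms(1)]]
    lin_hom_zero_minus(1)[OF M.module_axioms A.module_axioms liftsD(2)[OF assms(1)]]
  by (simp add: defect_def bracket_self act_simps a_minus_def A.M.r_neg A.M.a_inv_zero)

lemma defect_skew:
  assumes z: "z \<in> lifts" and s: "s \<in> carrier L0" and t: "t \<in> carrier L0"
  shows "defect z t s = \<ominus>\<^bsub>L1\<^esub> defect z s t"
proof -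
  note cl = lin_homD(1)[OF liftsD(2)[OF z]]
  have b: "bracket L0 s t \<in> carrier L0" using s t by (simp add: br_simps)
  have "snd z (bracket L0 t s) = \<ominus>\<^bsub>L1\<^esub> snd z (bracket L0 s t)"
    unfolding br_flip[OF s t]
    using lin_hom_zero_minus(2)[OF M.module_axioms A.module_axioms liftsD(2)[OF z]] b by simp
  then show ?thesis
    using s t b cl by (simp add: defect_def act_simps a_minus_def A.M.minus_add A.M.a_ac)
qed

lemma defect_lin:
  assumes z: "z \<in> lifts" and s: "s \<in> carrier L0"
  shows "defect z s \<in> lin_hom k L0 P1" "(\<lambda>t. defect z t s) \<in> lin_hom k L0 P1"
proof -
  note \<xi> = liftsD(2)[OF z]
  note sub = lin_hom_add_smult(2)[OF A.module_axioms M.module_axioms]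
  have "(\<lambda>t. act s (snd z t) \<ominus>\<^bsub>L1\<^esub> act t (snd z s) \<ominus>\<^bsub>L1\<^esub> snd z (bracket L0 s t)) \<in> lin_hom k L0 L1"
    by (rule sub[OF sub[OF lin_hom_comp[OF \<xi> act_lin(1)[OF s]] act_lin(2)[OF lin_homD(1)[OF \<xi> s]]]
      lin_hom_comp[OF br_lin(1)[OF s] \<xi>]])
  then have l1: "defect z s \<in> lin_hom k L0 L1"
    by (simp add: defect_def[abs_def])
  then show "defect z s \<in> lin_hom k L0 P1"
    using defect_ker[OF z s] by (simp add: lin_hom_def Pi_iff)
  have "(\<lambda>t. act t (snd z s) \<ominus>\<^bsub>L1\<^esub> act s (snd z t) \<ominus>\<^bsub>L1\<^esub> snd z (bracket L0 t s)) \<in> lin_hom k L0 L1"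
    by (rule sub[OF sub[OF act_lin(2)[OF lin_homD(1)[OF \<xi> s]] lin_hom_comp[OF \<xi> act_lin(1)[OF s]]]
      lin_hom_comp[OF br_lin(2)[OF s] \<xi>]])
  then have "(\<lambda>t. defect z t s) \<in> lin_hom k L0 L1"
    by (simp add: defect_def[abs_def])
  then show "(\<lambda>t. defect z t s) \<in> lin_hom k L0 P1"
    using defect_ker[OF z _ s] by (simp add: lin_hom_def Pi_iff)
qed

text \<open>Write \<open>z = (x, \<xi>)\<close>. Then \<open>\<partial>a \<cdot> \<xi>(t) = - [x, t]
  \<cdot> a = t \<cdot> (x \<cdot> a) - x \<cdot> (t \<cdot> a)\<close>, while
  \<open>t \<cdot> \<xi>(\<partial>a) = t \<cdot> (x \<cdot> a)\<close> and
  \<open>\<xi>[\<partial>a, t] = - \<xi>(\<partial>(t \<cdot> a)) = - x \<cdot> (t \<cdot>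
  a)\<close>, so everything cancels. The two conditions kept in \<open>lifts\<close> are what this
  takes.\<close>

lemma defect_Im:
  assumes z: "z \<in> lifts" and a: "a \<in> carrier L1" and t: "t \<in> carrier L0"
  shows "defect z (bd a) t = \<zero>\<^bsub>L1\<^esub>" "defect z t (bd a) = \<zero>\<^bsub>L1\<^esub>"
proof -
  let ?x = "fst z"
  note x = liftsD(1)[OF z] and \<xi> = liftsD(2)[OF z]
  note cl = lin_homD(1)[OF \<xi>]
  have "act (bd a) (snd z t) = \<ominus>\<^bsub>L1\<^esub> act (bd (snd z t)) a"
    using act_bd_flip[of "snd z t" a] a t cl by simp
  also have "\<dots> = act t (act ?x a) \<ominus>\<^bsub>L1\<^esub> act ?x (act t a)"
    using x a t by (simp add: liftsD(4)[OF z] act_bracket act_simps a_minus_def A.M.minus_add A.M.a_comm)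
  finally have 1: "act (bd a) (snd z t) = act t (act ?x a) \<ominus>\<^bsub>L1\<^esub> act ?x (act t a)" .
  have "bracket L0 (bd a) t = \<ominus>\<^bsub>L0\<^esub> bd (act t a)"
    using br_flip[of t "bd a"] a t by (simp add: bd_act bd_simps)
  then have "snd z (bracket L0 (bd a) t) = \<ominus>\<^bsub>L1\<^esub> act ?x (act t a)"
    using lin_hom_zero_minus(2)[OF M.module_axioms A.module_axioms \<xi>] a t
    by (simp add: liftsD(5)[OF z] act_simps bd_simps)
  then show *: "defect z (bd a) t = \<zero>\<^bsub>L1\<^esub>"
    using x a t unfolding defect_def 1 liftsD(5)[OF z a]
    by (simp add: act_simps a_minus_def A.M.a_ac A.M.r_neg A.M.r_neg1 A.M.r_neg2)
  then show "defect z t (bd a) = \<zero>\<^bsub>L1\<^esub>"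
    using defect_skew[OF z, of "bd a" t] a t by (simp add: bd_simps A.M.a_inv_zero)
qed

lemma defect_cls:
  assumes z: "z \<in> lifts" and s: "s \<in> carrier L0" "s' \<in> carrier L0" "cls s = cls s'"
    and t: "t \<in> carrier L0" "t' \<in> carrier L0" "cls t = cls t'"
  shows "defect z s t = defect z s' t'"
proof -
  have "s \<ominus>\<^bsub>L0\<^esub> s' \<in> bd ` carrier L1" "t \<ominus>\<^bsub>L0\<^esub> t' \<in> bd ` carrier L1"
    using s t cls_eq_iff by blast+
  then obtain a b where a: "a \<in> carrier L1" "s \<ominus>\<^bsub>L0\<^esub> s' = bd a" and b: "b \<in> carrier L1" "t \<ominus>\<^bsub>L0\<^esub> t' = bd b"
    by blast
  have "defect z s t \<ominus>\<^bsub>L1\<^esub> defect z s' t = defect z (s \<ominus>\<^bsub>L0\<^esub> s') t"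
    using lin_hom_zero_minus(3)[OF M.module_axioms P1_module defect_lin(2)[OF z t(1)] s(1,2)]
    by (simp add: P1_a_inv(2)[OF defect_ker[OF z s(2) t(1)]])
  then have 1: "defect z s t = defect z s' t"
    using defect_Im(1)[OF z a(1) t(1)] defect_closed[OF z] s t a(2) by (simp add: A.M.a_minus_eq_zero_iff)
  have "defect z s' t \<ominus>\<^bsub>L1\<^esub> defect z s' t' = defect z s' (t \<ominus>\<^bsub>L0\<^esub> t')"
    using lin_hom_zero_minus(3)[OF M.module_axioms P1_module defect_lin(1)[OF z s(2)] t(1,2)]
    by (simp add: P1_a_inv(2)[OF defect_ker[OF z s(2) t(2)]])
  then have "defect z s' t = defect z s' t'"
    using defect_Im(2)[OF z b(1) s(2)] defect_closed[OF z] s t b(2) by (simp add: A.M.a_minus_eq_zero_iff)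
  with 1 show ?thesis by simp
qed

text \<open>The defect on chosen representatives; by \<open>defect_cls\<close> the choice has no
  effect.\<close>

definition obstruction :: "'b \<times> ('b \<Rightarrow> 'c) \<Rightarrow> 'b set list \<Rightarrow> 'c" where
  "obstruction z = (\<lambda>xs\<in>tuples P0 2.
     defect z (inv_into (carrier L0) (\<lambda>x. cls x) (xs ! 0)) (inv_into (carrier L0) (\<lambda>x. cls x) (xs ! 1)))"

lemma obstruction_cls:
  assumes "z \<in> lifts" "s \<in> carrier L0" "t \<in> carrier L0"
  shows "obstruction z [cls s, cls t] = defect z s t"
proof -
  have r: "inv_into (carrier L0) (\<lambda>x. cls x) (cls u) \<in> carrier L0"
      "cls (inv_into (carrier L0) (\<lambda>x. cls x) (cls u)) = cls u" if "u \<in> carrier L0" for u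
    using inv_into_into[of "cls u" "\<lambda>x. cls x" "carrier L0"]
      f_inv_into_f[of "cls u" "\<lambda>x. cls x" "carrier L0"] imageI[OF that, of "\<lambda>x. cls x"] by simp_all
  have "obstruction z [cls s, cls t] = defect z (inv_into (carrier L0) (\<lambda>x. cls x) (cls s))
      (inv_into (carrier L0) (\<lambda>x. cls x) (cls t))"
    using assms tuples_P0_mem(2) by (simp add: obstruction_def)
  also have "\<dots> = defect z s t"
    using assms by (intro defect_cls r) simp_all
  finally show ?thesis .
qed

lemma obstruction_F: "z \<in> lifts \<Longrightarrow> obstruction z \<in> carrier (F 2)"
proof -
  assume z: "z \<in> lifts"
  have "restrict (obstruction z) (tuples P0 2) \<in> carrier (F 2)"
    by (intro restrict_fun_space) (auto simp: tuples_P0(2) obstruction_cls[OF z] defect_ker[OF z])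
  then show ?thesis by (simp add: obstruction_def)
qed

text \<open>On representatives the obstruction is the differential of a cochain on
  \<open>L0\<close>, so its own differential vanishes because the square of the differential is
  zero. This is carried out with values of \<open>\<xi>\<close> in \<open>L1\<close>, where the
  intermediate terms live; only the defect itself passes to \<open>\<pi>\<^sub>0\<close> and
  \<open>\<pi>\<^sub>1\<close>.\<close>

lemma obstruction_cocycle:
  assumes z: "z \<in> lifts" shows "obstruction z \<in> cocycles 2"
proof -
  have "obstruction z \<in> carrier (cochains 2)"
  proof (rule cochain_2I[OF obstruction_F[OF z]])
    fix y assume y: "y \<in> carrier L0"
    show "(\<lambda>t. obstruction z [cls t, cls y]) \<in> lin_hom k L0 P1"
      by (rule lin_hom_cong[OF defect_lin(2)[OF z y] _ module_carrier_closed(1,2)[OF M.module_axioms]])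
        (simp add: obstruction_cls z y)
    show "(\<lambda>t. obstruction z [cls y, cls t]) \<in> lin_hom k L0 P1"
      by (rule lin_hom_cong[OF defect_lin(1)[OF z y] _ module_carrier_closed(1,2)[OF M.module_axioms]])
        (simp add: obstruction_cls z y)
    show "obstruction z [cls y, cls y] = \<zero>\<^bsub>L1\<^esub>"
      by (simp add: obstruction_cls z y defect_self)
  qed
  moreover have "d 2 (obstruction z) [cls s, cls t, cls u] = \<zero>\<^bsub>L1\<^esub>"
    if s: "s \<in> carrier L0" and t: "t \<in> carrier L0" and u: "u \<in> carrier L0" for s t u
  proof -
    note \<xi> = liftsD(2)[OF z]
    note cl = lin_homD(1)[OF \<xi>]
    have b: "bracket L0 s t \<in> carrier L0" "bracket L0 s u \<in> carrier L0" "bracket L0 t u \<in> carrier L0"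
      using s t u by (simp_all add: br_simps)
    \<comment> \<open>The combination of double brackets at which \<open>\<xi>\<close> is evaluated
      once all iterated actions have cancelled; up to sign it is the Jacobi sum.\<close>
    let ?J = "bracket L0 (bracket L0 s t) u \<ominus>\<^bsub>L0\<^esub> bracket L0 (bracket L0 s u) t \<oplus>\<^bsub>L0\<^esub> bracket L0 (bracket L0 t u) s"
    have "?J = \<ominus>\<^bsub>L0\<^esub> (bracket L0 s (bracket L0 t u) \<oplus>\<^bsub>L0\<^esub> bracket L0 t (bracket L0 u s) \<oplus>\<^bsub>L0\<^esub> bracket L0 u (bracket L0 s t))"
      using s t u b br_flip[OF u b(1)] br_flip[OF t b(2)] br_flip[OF s b(3)] br_flip[OF s u]
      by (simp add: br_simps a_minus_def M.M.minus_add M.M.a_ac)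
    then have J: "?J = \<zero>\<^bsub>L0\<^esub>"
      using jacobi[OF s t u] by (simp add: M.M.a_inv_zero)
    have "d 2 (obstruction z) [cls s, cls t, cls u] =
      act s (defect z t u) \<ominus>\<^bsub>L1\<^esub> act t (defect z s u) \<oplus>\<^bsub>L1\<^esub> act u (defect z s t)
      \<ominus>\<^bsub>L1\<^esub> defect z (bracket L0 s t) u \<oplus>\<^bsub>L1\<^esub> defect z (bracket L0 s u) t \<ominus>\<^bsub>L1\<^esub> defect z (bracket L0 t u) s"
      using d2[OF obstruction_F[OF z] s t u] obstruction_cls[OF z] s t u b by simp
    \<comment> \<open>Expanding each defect, and using the module law for the brackets that act,
      gives exactly the left side of \<open>ce_diff_square_terms\<close>.\<close>
    also have "\<dots> = snd z (bracket L0 (bracket L0 s t) u) \<ominus>\<^bsub>L1\<^esub> snd z (bracket L0 (bracket L0 s u) t)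
       \<oplus>\<^bsub>L1\<^esub> snd z (bracket L0 (bracket L0 t u) s)"
      using s t u b cl
        A.M.ce_diff_square_terms[of "act s (act t (snd z u))" "act s (act u (snd z t))"
          "act t (act s (snd z u))" "act t (act u (snd z s))" "act u (act s (snd z t))"
          "act u (act t (snd z s))" "act s (snd z (bracket L0 t u))" "act t (snd z (bracket L0 s u))"
          "act u (snd z (bracket L0 s t))" "snd z (bracket L0 (bracket L0 s t) u)"
          "snd z (bracket L0 (bracket L0 s u) t)" "snd z (bracket L0 (bracket L0 t u) s)"]
      by (simp add: defect_def act_simps br_simps act_bracket)
    also have "\<dots> = snd z ?J"
      using s t u b lin_homD(2)[OF \<xi>] lin_hom_zero_minus(3)[OF M.module_axioms A.module_axioms \<xi>]
      by (simp add: br_simps)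
    also have "\<dots> = \<zero>\<^bsub>L1\<^esub>"
      unfolding J by (rule lin_hom_zero_minus(1)[OF M.module_axioms A.module_axioms \<xi>])
    finally show ?thesis .
  qed
  then have "d 2 (obstruction z) = \<zero>\<^bsub>F (Suc 2)\<^esub>"
    unfolding d_eq_zero_iff by (auto simp: tuples_P0(3))
  ultimately show ?thesis by (simp add: cocycles_iff)
qed

text \<open>The source of linearity for the map into \<open>H 2\<close>: each value of the defect
  depends linearly on the second component of the pair.\<close>

lemma obstruction_lin: "obstruction \<in> lin_hom k Lifts ((F 2)\<lparr>carrier := cocycles 2\<rparr>)"
proof -
  have "obstruction \<in> lin_hom k Lifts (F 2)"
  proof (rule lin_hom_fun_spaceI[OF P1_module _ _ module_carrier_closed(1,2)[OF Lifts_module]])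
    show "obstruction z \<in> carrier (F 2)" if "z \<in> carrier Lifts" for z
      using that obstruction_F by simp
    fix xs assume "xs \<in> tuples P0 2"
    then obtain s t where st: "s \<in> carrier L0" "t \<in> carrier L0" "xs = [cls s, cls t]"
      by (auto simp: tuples_P0(2))
    have b: "bracket L0 s t \<in> carrier L0" using st by (simp add: br_simps)
    have "(\<lambda>z. defect z s t) \<in> lin_hom k Lifts P1"
      unfolding lin_hom_def
    proof (intro CollectI conjI ballI)
      show "(\<lambda>z. defect z s t) \<in> carrier Lifts \<rightarrow> carrier P1" using defect_ker st by simp
      fix z assume z: "z \<in> carrier Lifts"
      then have z': "z \<in> lifts" by simp
      note cl = lin_homD(1)[OF liftsD(2)[OF z']]
      show "defect (z \<oplus>\<^bsub>Lifts\<^esub> w) s t = defect z s t \<oplus>\<^bsub>P1\<^esub> defect w s t" if w: "w \<in> carrier Lifts" for w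
      proof -
        from w have w': "w \<in> lifts" by simp
        have "snd (z \<oplus>\<^bsub>Lifts\<^esub> w) u = snd z u \<oplus>\<^bsub>L1\<^esub> snd w u" if "u \<in> carrier L0" for u
          using that by (cases z; cases w) simp
        then show ?thesis
          using st b cl lin_homD(1)[OF liftsD(2)[OF w']]
          by (simp add: defect_def act_simps a_minus_def A.M.minus_add A.M.a_ac)
      qed
      show "defect (r \<odot>\<^bsub>Lifts\<^esub> z) s t = r \<odot>\<^bsub>P1\<^esub> defect z s t" if r: "r \<in> carrier k" for r
      proof -
        have "snd (r \<odot>\<^bsub>Lifts\<^esub> z) u = r \<odot>\<^bsub>L1\<^esub> snd z u" if "u \<in> carrier L0" for u
          using that by (cases z) simp
        then show ?thesis
          using st b cl r
          by (simp add: defect_def act_simps a_minus_def A.smult_r_distr A.smult_r_minus)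
      qed
    qed
    then show "(\<lambda>z. obstruction z xs) \<in> lin_hom k Lifts P1"
      by (rule lin_hom_cong[OF _ _ module_carrier_closed(1,2)[OF Lifts_module]])
        (use st obstruction_cls in simp_all)
  qed
  then show ?thesis
    by (rule lin_hom_restrict) (use obstruction_cocycle in auto)
qed

lemma cls_eq_Im_iff: "x \<in> carrier L0 \<Longrightarrow> cls x = bd ` carrier L1 \<longleftrightarrow> x \<in> bd ` carrier L1"
  by (rule module.coset_eq_self_iff[OF M.module_axioms submodule_Im])

section \<open>Pairs over zero and 1-cochains\<close>

definition cochain_pair :: "('b set list \<Rightarrow> 'c) \<Rightarrow> 'b \<times> ('b \<Rightarrow> 'c)" where
  "cochain_pair \<phi> = (\<zero>\<^bsub>L0\<^esub>, \<lambda>t\<in>carrier L0. \<phi> [cls t])"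

text \<open>A cochain inflated to \<open>L0\<close> takes values in the kernel of
  \<open>\<partial>\<close> and vanishes on its image, as the conditions on a pair demand when the
  first component is zero.\<close>

lemma cochain_pair_lifts:
  assumes "\<phi> \<in> carrier (cochains 1)" shows "cochain_pair \<phi> \<in> lifts"
proof -
  have \<phi>: "(\<lambda>t. \<phi> [cls t]) \<in> lin_hom k L0 P1"
    using assms by (simp add: cochain_1_iff)
  have P1: "\<phi> [cls t] \<in> carrier P1" if "t \<in> carrier L0" for t
    using lin_homD(1)[OF \<phi> that] .
  have "(\<lambda>t\<in>carrier L0. \<phi> [cls t]) \<in> lin_hom k L0 P1"
    by (rule lin_hom_cong[OF \<phi> _ module_carrier_closed(1,2)[OF M.module_axioms]]) simp
  then have "(\<lambda>t\<in>carrier L0. \<phi> [cls t]) \<in> lin_hom k L0 L1"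
    by (rule lin_hom_restrict) (use P1 in \<open>auto simp: carrier_P1\<close>)
  moreover have "\<phi> [cls (bd a)] = \<zero>\<^bsub>L1\<^esub>" if a: "a \<in> carrier L1" for a
  proof -
    have "cls (bd a) = cls \<zero>\<^bsub>L0\<^esub>"
      using a cls_eq_iff[of "bd a" "\<zero>\<^bsub>L0\<^esub>"] by (simp add: bd_simps a_minus_def M.M.a_inv_zero)
    then show ?thesis
      using lin_hom_zero_minus(1)[OF M.module_axioms P1_module \<phi>] by simp
  qed
  ultimately show ?thesis
    using P1 by (auto simp: cochain_pair_def lifts_def carrier_P1 br_simps act_simps bd_simps)
qed

lemma cochain_pair_lin: "cochain_pair \<in> lin_hom k (cochains 1) Lifts"
proof -
  have "cochain_pair (\<phi> \<oplus>\<^bsub>F 1\<^esub> \<psi>) = cochain_pair \<phi> \<oplus>\<^bsub>Z\<^esub> cochain_pair \<psi>"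
    and "cochain_pair (r \<odot>\<^bsub>F 1\<^esub> \<phi>) = r \<odot>\<^bsub>Z\<^esub> cochain_pair \<phi>"
    if "r \<in> carrier k" for \<phi> \<psi> r
    using that tuples_P0_mem(1)
    by (auto simp: cochain_pair_def fun_space_apply fun_eq_iff)
  then show ?thesis
    using cochain_pair_lifts R.zero_closed by (auto simp: lin_hom_def)
qed

text \<open>On inflated cochains the formula for the defect is that of \<open>d 1\<close>. Changing
  a lift by such a pair therefore changes its obstruction by a coboundary, and every coboundary
  arises so.\<close>

lemma obstruction_cochain_pair:
  assumes "\<phi> \<in> carrier (cochains 1)"
  shows "obstruction (cochain_pair \<phi>) = d 1 \<phi>"
proof (rule fun_space_eqI)
  have \<phi>: "\<phi> \<in> carrier (F 1)" using assms cochains_subset by blast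
  show "obstruction (cochain_pair \<phi>) \<in> carrier (F 2)"
    by (rule obstruction_F[OF cochain_pair_lifts[OF assms]])
  show "d 1 \<phi> \<in> carrier (F 2)"
    by (rule lin_homD(1)[OF d1_lin \<phi>])
  fix xs assume "xs \<in> tuples P0 2"
  then obtain s t where st: "s \<in> carrier L0" "t \<in> carrier L0" "xs = [cls s, cls t]"
    by (auto simp: tuples_P0(2))
  show "obstruction (cochain_pair \<phi>) xs = d 1 \<phi> xs"
    unfolding st(3) obstruction_cls[OF cochain_pair_lifts[OF assms] st(1,2)] d1[OF \<phi> st(1,2)]
    using st by (simp add: defect_def cochain_pair_def br_simps)
qed

lemma lift_in_Z_iff:
  assumes z: "z \<in> lifts"
  shows "z \<in> carrier Z \<longleftrightarrow> obstruction z = \<zero>\<^bsub>F 2\<^esub>"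
proof -
  note cl = lin_homD(1)[OF liftsD(2)[OF z]]
  have "obstruction z = \<zero>\<^bsub>F 2\<^esub> \<longleftrightarrow> (\<forall>s\<in>carrier L0. \<forall>t\<in>carrier L0. defect z s t = \<zero>\<^bsub>L1\<^esub>)"
  proof
    assume 0: "obstruction z = \<zero>\<^bsub>F 2\<^esub>"
    have "defect z s t = \<zero>\<^bsub>L1\<^esub>" if "s \<in> carrier L0" "t \<in> carrier L0" for s t
      using obstruction_cls[OF z that] tuples_P0_mem(2)[OF that that(1)] by (simp add: 0 fun_space_apply)
    then show "\<forall>s\<in>carrier L0. \<forall>t\<in>carrier L0. defect z s t = \<zero>\<^bsub>L1\<^esub>" by blast
  next
    assume 0: "\<forall>s\<in>carrier L0. \<forall>t\<in>carrier L0. defect z s t = \<zero>\<^bsub>L1\<^esub>"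
    show "obstruction z = \<zero>\<^bsub>F 2\<^esub>"
    proof (rule fun_space_eqI[OF obstruction_F[OF z] module_carrier_closed(3)[OF F_module]])
      fix xs assume xs: "xs \<in> tuples P0 2"
      then obtain s t where "s \<in> carrier L0" "t \<in> carrier L0" "xs = [cls s, cls t]"
        by (auto simp: tuples_P0(2))
      then show "obstruction z xs = \<zero>\<^bsub>F 2\<^esub> xs"
        using xs 0 by (simp add: obstruction_cls[OF z] fun_space_apply)
    qed
  qed
  moreover have "defect z s t = \<zero>\<^bsub>L1\<^esub> \<longleftrightarrow> snd z (bracket L0 s t) = act s (snd z t) \<ominus>\<^bsub>L1\<^esub> act t (snd z s)"
    if "s \<in> carrier L0" "t \<in> carrier L0" for s t
    using that cl by (auto simp: defect_def A.M.a_minus_eq_zero_iff act_simps br_simps)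
  ultimately show ?thesis
    using z by (simp add: carrier_Z)
qed

lemma cochain_pair_Z_iff:
  "\<phi> \<in> carrier (cochains 1) \<Longrightarrow> cochain_pair \<phi> \<in> carrier Z \<longleftrightarrow> \<phi> \<in> cocycles 1"
  using lift_in_Z_iff[OF cochain_pair_lifts] by (simp add: obstruction_cochain_pair cocycle_1_iff)

text \<open>Over zero the two conditions say that \<open>\<xi>\<close> has values in the kernel of
  \<open>\<partial>\<close> and kills its image, so it factors as a linear map from
  \<open>\<pi>\<^sub>0\<close> to \<open>\<pi>\<^sub>1\<close>.\<close>

lemma lift_of_zero:
  assumes v: "v \<in> lifts" and v0: "fst v = \<zero>\<^bsub>L0\<^esub>"
  obtains \<phi> where "\<phi> \<in> carrier (cochains 1)" "v = cochain_pair \<phi>"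
proof -
  note \<xi> = liftsD(2)[OF v]
  have P1: "snd v t \<in> carrier P1" if "t \<in> carrier L0" for t
    using that lin_homD(1)[OF \<xi>] liftsD(4)[OF v that] by (simp add: carrier_P1 v0 br_simps)
  have \<xi>P: "snd v \<in> lin_hom k L0 P1"
    by (rule lin_hom_restrict[OF \<xi>]) (use P1 in auto)
  have cong: "snd v x = snd v y" if x: "x \<in> carrier L0" and y: "y \<in> carrier L0" and eq: "cls x = cls y" for x y
  proof -
    have "x \<ominus>\<^bsub>L0\<^esub> y \<in> bd ` carrier L1" using cls_eq_iff[OF x y] eq by simp
    then obtain a where a: "a \<in> carrier L1" "x \<ominus>\<^bsub>L0\<^esub> y = bd a" by blast
    have "snd v x \<ominus>\<^bsub>L1\<^esub> snd v y = snd v (x \<ominus>\<^bsub>L0\<^esub> y)"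
      using lin_hom_zero_minus(3)[OF M.module_axioms A.module_axioms \<xi> x y] by simp
    also have "\<dots> = \<zero>\<^bsub>L1\<^esub>"
      using liftsD(5)[OF v a(1)] a by (simp add: v0 act_simps)
    finally show ?thesis
      using lin_homD(1)[OF \<xi>] x y by (simp add: A.M.a_minus_eq_zero_iff)
  qed
  have "\<exists>g\<in>lin_hom k P0 P1. \<forall>t\<in>carrier L0. g (cls t) = snd v t"
    by (rule factor_lin_hom[OF cls_lin \<xi>P carrier_P0[symmetric]
          module_carrier_closed(1,2)[OF M.module_axioms] cong])
  then obtain g where g: "g \<in> lin_hom k P0 P1" "\<forall>t\<in>carrier L0. g (cls t) = snd v t" by blast
  define \<phi> where "\<phi> = (\<lambda>xs\<in>tuples P0 1. g (hd xs))"
  have eval: "\<phi> [cls t] = snd v t" if "t \<in> carrier L0" for t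
    using that g(2) tuples_P0_mem(1) by (simp add: \<phi>_def)
  have "\<phi> \<in> carrier (F 1)"
    unfolding \<phi>_def by (rule restrict_fun_space) (use P1 g(2) in \<open>auto simp: tuples_P0(1)\<close>)
  moreover have "(\<lambda>t. \<phi> [cls t]) \<in> lin_hom k L0 P1"
    by (rule lin_hom_cong[OF \<xi>P _ module_carrier_closed(1,2)[OF M.module_axioms]]) (simp add: eval)
  ultimately have "\<phi> \<in> carrier (cochains 1)"
    by (simp add: cochain_1_iff)
  moreover have "v = cochain_pair \<phi>"
  proof (rule prod_eqI)
    show "snd v = snd (cochain_pair \<phi>)"
      by (rule extensionalityI[OF liftsD(3)[OF v]]) (simp_all add: cochain_pair_def eval)
  qed (simp add: cochain_pair_def v0)
  ultimately show thesis by (rule that)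
qed

text \<open>Subtracting \<open>\<delta> c\<close>, which has the same first component and lies in
  the centre, leaves a pair over zero. Both the well-definedness of the map to \<open>H 2\<close>
  and exactness at \<open>PZ0\<close> rest on this decomposition.\<close>

lemma lift_of_boundary:
  assumes z: "z \<in> lifts" and c: "c \<in> carrier L1" and zc: "fst z = bd c"
  obtains \<phi> where "\<phi> \<in> carrier (cochains 1)" "z = cochain_pair \<phi> \<oplus>\<^bsub>Z\<^esub> \<delta> c"
proof -
  interpret L: module k Lifts by (rule Lifts_module)
  have \<delta>: "\<delta> c \<in> carrier Lifts" using \<delta>_mem[OF c] Z_subset_lifts by auto
  have zL: "z \<in> carrier Lifts" using z by simp
  let ?v = "z \<ominus>\<^bsub>Lifts\<^esub> \<delta> c"
  have "fst ?v = fst z \<ominus>\<^bsub>L0\<^esub> fst (\<delta> c)"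
    by (rule lin_hom_zero_minus(3)[OF Lifts_module M.module_axioms Lifts_fst_lin zL \<delta>])
  also have "\<dots> = \<zero>\<^bsub>L0\<^esub>"
    using c zc by (simp add: \<delta>_eq a_minus_def M.M.r_neg bd_simps)
  finally have v0: "fst ?v = \<zero>\<^bsub>L0\<^esub>" .
  have v: "?v \<in> carrier Lifts" using zL \<delta> by (rule L.M.minus_closed)
  have "z = ?v \<oplus>\<^bsub>Lifts\<^esub> \<delta> c"
    using L.M.add.m_assoc[OF zL L.M.a_inv_closed[OF \<delta>] \<delta>] zL \<delta>
    by (simp only: a_minus_def L.M.l_neg[OF \<delta>] L.M.r_zero[OF zL])
  moreover from v have "?v \<in> lifts" by simp
  then obtain \<phi> where "\<phi> \<in> carrier (cochains 1)" "?v = cochain_pair \<phi>"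
    using v0 by (rule lift_of_zero)
  ultimately show thesis using that by simp
qed

lemma cocycles_1_submodule: "submodule (cocycles 1) k (F 1)"
proof -
  have d1: "d 1 \<in> lin_hom k (cochains 1) (F 2)"
    by (rule lin_hom_restrict[OF d1_lin cochains_subset])
     (use cochains_subset[of 1] lin_homD(1)[OF d1_lin] in auto)
  have "cocycles 1 = a_kernel (cochains 1) (F 2) (d 1)"
    by (auto simp: cocycle_1_iff a_kernel_eq)
  then have "submodule (cocycles 1) k (cochains 1)"
    using submodule_kernel[OF d1 cochains_1_module F_module] by simp
  note E = module.submoduleE[OF cochains_1_module this]
  show ?thesis
  proof (rule module.submoduleI_smult[OF F_module cocycles_subset])
    have "\<zero>\<^bsub>cochains 1\<^esub> \<in> cocycles 1"
      using module_carrier_closed(3)[OF cochains_1_module] lin_hom_zero_minus(1)[OF cochains_1_module F_module d1]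
      by (simp add: cocycle_1_iff)
    then show "\<zero>\<^bsub>F 1\<^esub> \<in> cocycles 1" by simp
  qed (use E(4,5) in simp_all)
qed

text \<open>If the pair equals \<open>\<delta> c\<close>, its vanishing first component puts
  \<open>c\<close> into \<open>\<pi>\<^sub>1\<close>, so \<open>c\<close> is the value of a
  0-cochain. One direction makes the map out of \<open>H 1\<close> well defined, the other makes it
  injective.\<close>

lemma cochain_pair_\<delta>_iff:
  assumes "\<phi> \<in> cocycles 1"
  shows "cochain_pair \<phi> \<in> \<delta> ` carrier L1 \<longleftrightarrow> \<phi> \<in> coboundaries 1"
proof -
  have \<phi>: "\<phi> \<in> carrier (F 1)" using assms cocycles_subset by blast
  \<comment> \<open>The sign offsets the one in \<open>\<xi>\<^sub>c(t) = - t \<cdot> c\<close>, as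
    \<open>d 0\<close> sends \<open>\<omega>\<close> to \<open>t \<cdot> \<omega>\<close> without a
    sign.\<close>
  have eq: "cochain_pair \<phi> = \<delta> (\<ominus>\<^bsub>L1\<^esub> \<omega> []) \<longleftrightarrow> \<phi> = d 0 \<omega>" if \<omega>: "\<omega> \<in> carrier (F 0)" for \<omega>
  proof -
    have \<omega>0: "\<omega> [] \<in> carrier L1" "bd (\<omega> []) = \<zero>\<^bsub>L0\<^esub>" using F_closed(1)[OF \<omega>] by (simp_all add: carrier_P1)
    have "cochain_pair \<phi> = \<delta> (\<ominus>\<^bsub>L1\<^esub> \<omega> []) \<longleftrightarrow> (\<forall>t\<in>carrier L0. \<phi> [cls t] = act t (\<omega> []))"
      using \<omega>0 by (auto simp: cochain_pair_def \<delta>_eq fun_eq_iff bd_simps act_simps M.M.a_inv_zero)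
    also have "\<dots> \<longleftrightarrow> (\<forall>xs\<in>tuples P0 1. \<phi> xs = d 0 \<omega> xs)"
      by (simp add: tuples_P0(1) d0[OF \<omega>])
    also have "\<dots> \<longleftrightarrow> \<phi> = d 0 \<omega>"
      using fun_space_eqI[OF \<phi> lin_homD(1)[OF d0_lin \<omega>]] by blast
    finally show ?thesis .
  qed
  show ?thesis
  proof
    assume "cochain_pair \<phi> \<in> \<delta> ` carrier L1"
    then obtain c where c: "c \<in> carrier L1" "cochain_pair \<phi> = \<delta> c" by blast
    then have "bd c = \<zero>\<^bsub>L0\<^esub>" by (simp add: cochain_pair_def \<delta>_eq)
    then have "(\<lambda>xs\<in>tuples P0 0. \<ominus>\<^bsub>L1\<^esub> c) \<in> carrier (F 0)"
      using c by (intro restrict_fun_space) (simp add: carrier_P1 bd_simps M.M.a_inv_zero)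
    moreover have "\<delta> (\<ominus>\<^bsub>L1\<^esub> (\<lambda>xs\<in>tuples P0 0. \<ominus>\<^bsub>L1\<^esub> c) []) = \<delta> c"
      using c by (simp add: tuples_0)
    ultimately show "\<phi> \<in> coboundaries 1"
      using eq c(2) unfolding coboundaries_eq by fastforce
  next
    assume "\<phi> \<in> coboundaries 1"
    then obtain \<omega> where \<omega>: "\<omega> \<in> carrier (F 0)" "\<phi> = d 0 \<omega>" unfolding coboundaries_eq by blast
    then have "cochain_pair \<phi> = \<delta> (\<ominus>\<^bsub>L1\<^esub> \<omega> [])" using eq by blast
    moreover have "\<ominus>\<^bsub>L1\<^esub> \<omega> [] \<in> carrier L1" using F_closed(1)[OF \<omega>(1)] by (simp add: carrier_P1)
    ultimately show "cochain_pair \<phi> \<in> \<delta> ` carrier L1" by blast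
  qed
qed

section \<open>Central elements of the cokernel and their lifts\<close>

abbreviation C where "C \<equiv> central_annihilator P0 P1 (pi_act act)"

lemma cls_mem_C_iff:
  assumes x: "x \<in> carrier L0"
  shows "cls x \<in> carrier C \<longleftrightarrow>
    (\<forall>y\<in>carrier L0. bracket L0 x y \<in> bd ` carrier L1) \<and> (\<forall>a\<in>carrier P1. act x a = \<zero>\<^bsub>L1\<^esub>)"
proof -
  have "(\<forall>u\<in>carrier P0. bracket P0 (cls x) u = \<zero>\<^bsub>P0\<^esub>) \<longleftrightarrow>
      (\<forall>y\<in>carrier L0. bracket L0 x y \<in> bd ` carrier L1)"
    using x by (simp add: carrier_P0 bracket_P0 zero_P0 cls_eq_Im_iff br_simps)
  moreover have "(\<forall>a\<in>carrier P1. pi_act act (cls x) a = \<zero>\<^bsub>P1\<^esub>) \<longleftrightarrow> (\<forall>a\<in>carrier P1. act x a = \<zero>\<^bsub>L1\<^esub>)"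
    using x by (simp add: pi_act_cls)
  ultimately show ?thesis
    using cls_mem[OF x] by (simp add: central_annihilator_def)
qed

text \<open>The bracket \<open>[x, t] = \<partial>\<xi>(t)\<close> is a boundary, and
  \<open>x \<cdot> a = \<xi>(\<partial>a) = \<xi>(0) = 0\<close> for \<open>a\<close> in the
  kernel.\<close>

lemma lift_cls_mem_C:
  assumes z: "z \<in> lifts" shows "cls (fst z) \<in> carrier C"
  unfolding cls_mem_C_iff[OF liftsD(1)[OF z]]
proof (intro conjI ballI)
  show "bracket L0 (fst z) y \<in> bd ` carrier L1" if "y \<in> carrier L0" for y
    using liftsD(4)[OF z that, symmetric] lin_homD(1)[OF liftsD(2)[OF z] that] by simp
  show "act (fst z) a = \<zero>\<^bsub>L1\<^esub>" if "a \<in> carrier P1" for a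
    using that liftsD(5)[OF z, of a] lin_hom_zero_minus(1)[OF M.module_axioms A.module_axioms liftsD(2)[OF z]]
    by (simp add: carrier_P1)
qed

text \<open>The graphs of the \<open>\<xi>\<close> with \<open>(x, \<xi>) \<in> lifts\<close> are the complements of \<open>0 \<times> Ker \<partial>\<close> in the subspace
  \<open>{(t, b). \<partial>b = [x, t]}\<close> of \<open>L\<^sub>0 \<times> L\<^sub>1\<close> that contain all pairs \<open>(\<partial>a, x \<cdot> a)\<close>.\<close>

lemma lift_exists:
  assumes "field k" and x: "x \<in> carrier L0" and xC: "cls x \<in> carrier C"
  shows "\<exists>z\<in>lifts. fst z = x"
proof -
  have x_Im: "\<And>y. y \<in> carrier L0 \<Longrightarrow> bracket L0 x y \<in> bd ` carrier L1"
    and x_Ker: "\<And>a. a \<in> carrier P1 \<Longrightarrow> act x a = \<zero>\<^bsub>L1\<^esub>"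
    using xC by (auto simp: cls_mem_C_iff[OF x])
  define Q :: "('a, 'b \<times> 'c) module" where
    "Q = \<lparr>carrier = carrier L0 \<times> carrier L1, mult = undefined, one = undefined, zero = (\<zero>\<^bsub>L0\<^esub>, \<zero>\<^bsub>L1\<^esub>),
      add = (\<lambda>(t, b) (t', b'). (t \<oplus>\<^bsub>L0\<^esub> t', b \<oplus>\<^bsub>L1\<^esub> b')), smult = (\<lambda>r (t, b). (r \<odot>\<^bsub>L0\<^esub> t, r \<odot>\<^bsub>L1\<^esub> b))\<rparr>"
  have Q: "module k Q"
    by (rule module_prod[OF M.module_axioms A.module_axioms]) (simp_all add: Q_def)
  define K where "K = {(t, b). t \<in> carrier L0 \<and> b \<in> carrier L1 \<and> bd b = bracket L0 x t}"
  have K: "submodule K k Q"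
    by (rule module.submoduleI_smult[OF Q]) (use x in \<open>auto simp: K_def Q_def bd_simps br_simps\<close>)
  define QK where "QK = Q\<lparr>carrier := K\<rparr>"
  have QK: "module k QK" unfolding QK_def by (rule submodule.submodule_is_module[OF K Q])
  interpret QK: module k QK by (rule QK)
  have QK_simps: "carrier QK = K" "(t, b) \<oplus>\<^bsub>QK\<^esub> (t', b') = (t \<oplus>\<^bsub>L0\<^esub> t', b \<oplus>\<^bsub>L1\<^esub> b')"
      "r \<odot>\<^bsub>QK\<^esub> (t, b) = (r \<odot>\<^bsub>L0\<^esub> t, r \<odot>\<^bsub>L1\<^esub> b)" "\<zero>\<^bsub>QK\<^esub> = (\<zero>\<^bsub>L0\<^esub>, \<zero>\<^bsub>L1\<^esub>)" for t b t' b' r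
    by (simp_all add: QK_def Q_def)
  have "(\<lambda>a. (bd a, act x a)) \<in> lin_hom k L1 QK"
    using x by (auto simp: lin_hom_def QK_simps K_def bd_simps act_simps bd_act)
  from submodule_image[OF this A.module_axioms QK]
  have S: "submodule ((\<lambda>a. (bd a, act x a)) ` carrier L1) k QK" .
  have "(\<lambda>b. (\<zero>\<^bsub>L0\<^esub>, b)) \<in> lin_hom k P1 QK"
    using x by (auto simp: lin_hom_def QK_simps K_def carrier_P1 br_simps)
  from submodule_image[OF this P1_module QK]
  have N: "submodule ((\<lambda>b. (\<zero>\<^bsub>L0\<^esub>, b)) ` carrier P1) k QK" .
  \<comment> \<open>Triviality of the action on \<open>\<pi>\<^sub>1\<close> is used here: if
    \<open>\<partial>a = 0\<close> then \<open>x \<cdot> a = 0\<close>, so the values prescribed on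
    boundaries do not conflict.\<close>
  have SN: "(\<lambda>a. (bd a, act x a)) ` carrier L1 \<inter> (\<lambda>b. (\<zero>\<^bsub>L0\<^esub>, b)) ` carrier P1 = {\<zero>\<^bsub>QK\<^esub>}"
  proof
    show "(\<lambda>a. (bd a, act x a)) ` carrier L1 \<inter> (\<lambda>b. (\<zero>\<^bsub>L0\<^esub>, b)) ` carrier P1 \<subseteq> {\<zero>\<^bsub>QK\<^esub>}"
      using x_Ker by (auto simp: QK_simps carrier_P1)
    have "\<zero>\<^bsub>QK\<^esub> = (bd \<zero>\<^bsub>L1\<^esub>, act x \<zero>\<^bsub>L1\<^esub>)" using x by (simp add: QK_simps bd_simps act_simps)
    moreover have "\<zero>\<^bsub>L1\<^esub> \<in> carrier P1" by (simp add: carrier_P1 bd_simps)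
    ultimately show "{\<zero>\<^bsub>QK\<^esub>} \<subseteq> (\<lambda>a. (bd a, act x a)) ` carrier L1 \<inter> (\<lambda>b. (\<zero>\<^bsub>L0\<^esub>, b)) ` carrier P1"
      by (auto simp: QK_simps)
  qed
  obtain G where G: "submodule G k QK" and SG: "(\<lambda>a. (bd a, act x a)) ` carrier L1 \<subseteq> G"
    and GN: "G \<inter> (\<lambda>b. (\<zero>\<^bsub>L0\<^esub>, b)) ` carrier P1 = {\<zero>\<^bsub>QK\<^esub>}"
    and compl: "\<And>v. v \<in> carrier QK \<Longrightarrow> \<exists>g\<in>G. \<exists>n\<in>(\<lambda>b. (\<zero>\<^bsub>L0\<^esub>, b)) ` carrier P1. v = g \<oplus>\<^bsub>QK\<^esub> n"
    by (rule QK.complement_exists[OF assms(1) S N SN]) blast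
  note GE = QK.submoduleE[OF G]
  have GK: "t \<in> carrier L0 \<and> b \<in> carrier L1 \<and> bd b = bracket L0 x t" if "(t, b) \<in> G" for t b
    using that GE(1) by (auto simp: QK_simps K_def)
  \<comment> \<open>Two values over the same \<open>t\<close> differ by an element of the kernel of
    \<open>\<partial>\<close>, which would lie in both \<open>G\<close> and its complement.\<close>
  have uniq: "b = b'" if b: "(t, b) \<in> G" and b': "(t, b') \<in> G" for t b b'
  proof -
    note Kb = GK[OF b] GK[OF b']
    have "(\<ominus>\<^bsub>k\<^esub> \<one>\<^bsub>k\<^esub>) \<odot>\<^bsub>QK\<^esub> (t, b') \<in> G" using b' by (intro GE(4)) simp_all
    then have "(t, b) \<oplus>\<^bsub>QK\<^esub> (\<ominus>\<^bsub>k\<^esub> \<one>\<^bsub>k\<^esub>) \<odot>\<^bsub>QK\<^esub> (t, b') \<in> G" using b by (intro GE(5))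
    then have diff: "(\<zero>\<^bsub>L0\<^esub>, b \<ominus>\<^bsub>L1\<^esub> b') \<in> G"
      using Kb by (simp add: QK_simps a_minus_def M.smult_l_minus A.smult_l_minus M.M.r_neg)
    have "b \<ominus>\<^bsub>L1\<^esub> b' \<in> carrier P1"
      using Kb x by (simp add: carrier_P1 bd_simps a_minus_def M.M.r_neg br_simps)
    then have "(\<zero>\<^bsub>L0\<^esub>, b \<ominus>\<^bsub>L1\<^esub> b') \<in> {\<zero>\<^bsub>QK\<^esub>}" unfolding GN[symmetric] using diff by blast
    then show ?thesis
      using Kb by (simp add: QK_simps A.M.a_minus_eq_zero_iff)
  qed
  \<comment> \<open>Centrality of the class of \<open>x\<close> supplies some \<open>b\<close> with
    \<open>\<partial>b = [x, t]\<close>. Splitting \<open>(t, b)\<close> along the complement alters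
    only the second entry, so the part in \<open>G\<close> still lies over \<open>t\<close>.\<close>
  have ex: "\<exists>b. (t, b) \<in> G" if t: "t \<in> carrier L0" for t
  proof -
    obtain b where b: "b \<in> carrier L1" "bracket L0 x t = bd b" using x_Im[OF t] by blast
    then have "(t, b) \<in> carrier QK" using t by (simp add: QK_simps K_def)
    then obtain g n where g: "g \<in> G" "n \<in> carrier P1" "(t, b) = g \<oplus>\<^bsub>QK\<^esub> (\<zero>\<^bsub>L0\<^esub>, n)"
      using compl by blast
    obtain t' b' where g': "g = (t', b')" by (cases g)
    then have "t' = t" using g GK[of t' b'] by (simp add: QK_simps)
    then show ?thesis using g g' by blast
  qed
  define \<xi> where "\<xi> = (\<lambda>t\<in>carrier L0. THE b. (t, b) \<in> G)"
  have \<xi>G: "(t, \<xi> t) \<in> G" if t: "t \<in> carrier L0" for t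
  proof -
    have "\<exists>!b. (t, b) \<in> G" using ex[OF t] uniq by blast
    then show ?thesis using t theI'[of "\<lambda>b. (t, b) \<in> G"] by (simp add: \<xi>_def)
  qed
  have \<xi>_eq: "\<xi> t = b" if "(t, b) \<in> G" for t b
    using uniq[OF \<xi>G that] GK[OF that] by blast
  have "(x, \<xi>) \<in> lifts"
  proof -
    have "\<xi> (s \<oplus>\<^bsub>L0\<^esub> t) = \<xi> s \<oplus>\<^bsub>L1\<^esub> \<xi> t" if "s \<in> carrier L0" "t \<in> carrier L0" for s t
      using GE(5)[OF \<xi>G[OF that(1)] \<xi>G[OF that(2)]] by (intro \<xi>_eq) (simp add: QK_simps)
    moreover have "\<xi> (r \<odot>\<^bsub>L0\<^esub> t) = r \<odot>\<^bsub>L1\<^esub> \<xi> t" if "r \<in> carrier k" "t \<in> carrier L0" for r t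
      using GE(4)[OF that(1) \<xi>G[OF that(2)]] by (intro \<xi>_eq) (simp add: QK_simps)
    moreover have "\<xi> (bd a) = act x a" if "a \<in> carrier L1" for a
      using SG that by (intro \<xi>_eq) blast
    moreover have "\<xi> t \<in> carrier L1" "bd (\<xi> t) = bracket L0 x t" if "t \<in> carrier L0" for t
      using GK[OF \<xi>G[OF that]] by simp_all
    moreover have "\<xi> \<in> extensional (carrier L0)" by (simp add: \<xi>_def)
    ultimately show ?thesis using x by (simp add: lifts_def lin_hom_def)
  qed
  then show ?thesis by force
qed

section \<open>The exact sequence\<close>

abbreviation H where "H \<equiv> ce_cohomology k P0 P1 (pi_act act)"
abbreviation PZ0 where "PZ0 \<equiv> cm_pi0 L1 Z \<delta>"
abbreviation cls_Z where "cls_Z z \<equiv> \<delta> ` carrier L1 +>\<^bsub>Z\<^esub> z"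

lemma submodule_\<delta>: "submodule (\<delta> ` carrier L1) k Z"
  by (rule submodule_image[OF \<delta>_lin A.module_axioms Z_module])

lemma carrier_PZ0: "carrier PZ0 = (\<lambda>z. cls_Z z) ` carrier Z"
  using module.quot_proj(2)[OF Z_module submodule_\<delta>, of "carrier Z"]
  by (simp add: cm_pi0_def lin_hom_lie_quot)

lemma lin_hom_PZ0: "lin_hom k U PZ0 = lin_hom k U (quot_space Z (\<delta> ` carrier L1))"
  by (simp add: cm_pi0_def lin_hom_lie_quot)

lemma zero_PZ0: "\<zero>\<^bsub>PZ0\<^esub> = \<delta> ` carrier L1"
  by (simp add: cm_pi0_def lie_quot_def)

lemma zero_H: "\<zero>\<^bsub>H n\<^esub> = coboundaries n"
  by (simp add: cohomology_eq quot_space_def)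

lemma zero_C: "\<zero>\<^bsub>C\<^esub> = bd ` carrier L1"
  by (simp add: central_annihilator_def zero_P0)

lemma lin_hom_C:
  assumes "f \<in> lin_hom k U P0" "f ` carrier U \<subseteq> carrier C"
  shows "f \<in> lin_hom k U C"
  by (rule lin_hom_restrict[OF assms(1) _ assms(2)]) (simp_all add: central_annihilator_def)

lemma connecting_f:
  "\<exists>f\<in>lin_hom k (H 1) PZ0. \<forall>\<phi>\<in>cocycles 1. f (coboundaries 1 +>\<^bsub>F 1\<^esub> \<phi>) = cls_Z (cochain_pair \<phi>)"
proof -
  have "cochain_pair \<in> lin_hom k ((F 1)\<lparr>carrier := cocycles 1\<rparr>) Z"
    by (rule lin_hom_restrict[OF cochain_pair_lin])
      (use cochain_pair_Z_iff in \<open>auto simp: cocycle_1_iff\<close>)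
  moreover have "cochain_pair \<phi> \<in> \<delta> ` carrier L1" if "\<phi> \<in> coboundaries 1" "\<phi> \<in> cocycles 1" for \<phi>
    using that cochain_pair_\<delta>_iff by blast
  ultimately show ?thesis
    unfolding cohomology_eq lin_hom_PZ0
    by (rule quot_factor[OF F_module Z_module coboundaries_submodule(2) cocycles_1_submodule submodule_\<delta>])
qed

lemma connecting_g:
  "\<exists>g\<in>lin_hom k PZ0 C. \<forall>z\<in>carrier Z. g (cls_Z z) = cls (fst z)"
proof -
  have "\<exists>g\<in>lin_hom k (quot_space (Z\<lparr>carrier := carrier Z\<rparr>) (\<delta> ` carrier L1))
      (quot_space L0 (bd ` carrier L1)). \<forall>z\<in>carrier Z. g (cls_Z z) = cls (fst z)"
    by (rule quot_factor[OF Z_module M.module_axioms submodule_\<delta>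
          module.carrier_is_submodule[OF Z_module] submodule_Im])
      (use fst_lin in \<open>auto simp: \<delta>_eq\<close>)
  then obtain g where g: "g \<in> lin_hom k PZ0 P0" "\<And>z. z \<in> carrier Z \<Longrightarrow> g (cls_Z z) = cls (fst z)"
    by (auto simp: cm_pi0_def lin_hom_lie_quot)
  have "g \<in> lin_hom k PZ0 C"
    by (rule lin_hom_C[OF g(1)])
      (use g(2) lift_cls_mem_C Z_subset_lifts in \<open>auto simp: carrier_PZ0\<close>)
  with g(2) show ?thesis by blast
qed

text \<open>The summand \<open>\<delta> c\<close> of the lift is a derivation and contributes no
  obstruction; the inflated cochain contributes its differential.\<close>

lemma obstruction_coboundary_of_Im:
  assumes z: "z \<in> lifts" and Im: "fst z \<in> bd ` carrier L1"
  shows "obstruction z \<in> coboundaries 2"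
proof -
  interpret F2: module k "F 2" by (rule F_module)
  obtain c where c: "c \<in> carrier L1" "fst z = bd c" using Im by blast
  obtain \<phi> where \<phi>: "\<phi> \<in> carrier (cochains 1)" "z = cochain_pair \<phi> \<oplus>\<^bsub>Z\<^esub> \<delta> c"
    by (rule lift_of_boundary[OF z c])
  have \<delta>: "\<delta> c \<in> carrier Z" by (rule \<delta>_mem[OF c(1)])
  then have "\<delta> c \<in> lifts" using Z_subset_lifts by blast
  then have "obstruction z = obstruction (cochain_pair \<phi>) \<oplus>\<^bsub>F 2\<^esub> obstruction (\<delta> c)"
    using lin_homD(2)[OF obstruction_lin, of "cochain_pair \<phi>" "\<delta> c"] cochain_pair_lifts[OF \<phi>(1)]
    by (simp add: \<phi>(2))
  also have "obstruction (\<delta> c) = \<zero>\<^bsub>F 2\<^esub>"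
    using \<delta> \<open>\<delta> c \<in> lifts\<close> lift_in_Z_iff by blast
  also have "obstruction (cochain_pair \<phi>) \<oplus>\<^bsub>F 2\<^esub> \<zero>\<^bsub>F 2\<^esub> = d 1 \<phi>"
    unfolding obstruction_cochain_pair[OF \<phi>(1)]
    using \<phi>(1) cochains_subset[of 1] lin_homD(1)[OF d1_lin] by (intro F2.M.r_zero) blast
  finally show ?thesis using \<phi>(1) by (simp add: coboundaries_eq)
qed

text \<open>If the obstruction is the differential of a cochain, subtracting the pair of that
  cochain removes it and leaves the first component alone. This is the substance of exactness at
  \<open>C\<close>.\<close>

lemma lift_correction:
  assumes z: "z \<in> lifts" and B: "obstruction z \<in> coboundaries 2"
  shows "\<exists>w\<in>carrier Z. fst w = fst z"
proof -
  interpret L: module k Lifts by (rule Lifts_module)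
  interpret F2: module k "F 2" by (rule F_module)
  obtain \<phi> where \<phi>: "\<phi> \<in> carrier (cochains 1)" "obstruction z = d 1 \<phi>"
    using B unfolding coboundaries_eq by blast
  have v: "cochain_pair \<phi> \<in> carrier Lifts" using cochain_pair_lifts[OF \<phi>(1)] by simp
  have zL: "z \<in> carrier Lifts" using z by simp
  let ?w = "z \<ominus>\<^bsub>Lifts\<^esub> cochain_pair \<phi>"
  have wL: "?w \<in> carrier Lifts" using zL v by (rule L.M.minus_closed)
  then have w: "?w \<in> lifts" by simp
  have "obstruction \<in> lin_hom k Lifts (F 2)"
    by (rule lin_hom_restrict[OF obstruction_lin]) (use obstruction_F in auto)
  from lin_hom_zero_minus(3)[OF Lifts_module F_module this zL v]
  have "obstruction ?w = d 1 \<phi> \<ominus>\<^bsub>F 2\<^esub> d 1 \<phi>"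
    by (simp only: obstruction_cochain_pair[OF \<phi>(1)] \<phi>(2))
  also have "\<dots> = \<zero>\<^bsub>F 2\<^esub>"
    using obstruction_F[OF z] by (simp add: \<phi>(2) a_minus_def F2.M.r_neg)
  finally have "?w \<in> carrier Z" using lift_in_Z_iff[OF w] by blast
  moreover have "fst ?w = fst z"
    using lin_hom_zero_minus(3)[OF Lifts_module M.module_axioms Lifts_fst_lin zL v] liftsD(1)[OF z]
    by (simp add: cochain_pair_def a_minus_def M.M.a_inv_zero)
  ultimately show ?thesis by blast
qed

text \<open>Factors the linear obstruction class through the projection of \<open>Lifts\<close> onto
  \<open>C\<close>, whose surjectivity is \<open>lift_exists\<close>; no lift depending linearly on
  the central element has to be chosen.\<close>

lemma connecting_h:
  assumes "field k"
  shows "\<exists>h\<in>lin_hom k C (H 2). \<forall>z\<in>lifts. h (cls (fst z)) = coboundaries 2 +>\<^bsub>F 2\<^esub> obstruction z"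
proof -
  interpret L: module k Lifts by (rule Lifts_module)
  have p: "(\<lambda>z. cls (fst z)) \<in> lin_hom k Lifts C"
    by (rule lin_hom_C[OF lin_hom_comp[OF Lifts_fst_lin cls_lin]]) (use lift_cls_mem_C in auto)
  have onto: "(\<lambda>z. cls (fst z)) ` carrier Lifts = carrier C"
  proof
    show "(\<lambda>z. cls (fst z)) ` carrier Lifts \<subseteq> carrier C" using lift_cls_mem_C by auto
    show "carrier C \<subseteq> (\<lambda>z. cls (fst z)) ` carrier Lifts"
    proof
      fix X assume X: "X \<in> carrier C"
      then obtain x where x: "x \<in> carrier L0" "X = cls x"
        by (auto simp: central_annihilator_def carrier_P0)
      then obtain z where "z \<in> lifts" "fst z = x"
        using lift_exists[OF assms] X by blast
      then show "X \<in> (\<lambda>z. cls (fst z)) ` carrier Lifts" using x by auto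
    qed
  qed
  \<comment> \<open>The difference of two lifts of one class is a lift with first component in the
    image of \<open>\<partial>\<close>, so linearity reduces the claim to
    \<open>obstruction_coboundary_of_Im\<close>.\<close>
  have cong: "coboundaries 2 +>\<^bsub>F 2\<^esub> obstruction z = coboundaries 2 +>\<^bsub>F 2\<^esub> obstruction w"
    if z: "z \<in> carrier Lifts" and w: "w \<in> carrier Lifts" and eq: "cls (fst z) = cls (fst w)" for z w
  proof -
    from z w have zw: "z \<in> lifts" "w \<in> lifts" by simp_all
    have "fst z \<ominus>\<^bsub>L0\<^esub> fst w \<in> bd ` carrier L1"
      using eq cls_eq_iff liftsD(1) zw by blast
    then have "fst (z \<ominus>\<^bsub>Lifts\<^esub> w) \<in> bd ` carrier L1"
      by (simp only: lin_hom_zero_minus(3)[OF Lifts_module M.module_axioms Lifts_fst_lin z w])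
    moreover have "z \<ominus>\<^bsub>Lifts\<^esub> w \<in> carrier Lifts" using z w by (rule L.M.minus_closed)
    then have "z \<ominus>\<^bsub>Lifts\<^esub> w \<in> lifts" by simp
    ultimately have "obstruction (z \<ominus>\<^bsub>Lifts\<^esub> w) \<in> coboundaries 2"
      by (intro obstruction_coboundary_of_Im)
    moreover have "obstruction \<in> lin_hom k Lifts (F 2)"
      by (rule lin_hom_restrict[OF obstruction_lin]) (use obstruction_F in auto)
    ultimately have "obstruction z \<ominus>\<^bsub>F 2\<^esub> obstruction w \<in> coboundaries 2"
      by (simp only: lin_hom_zero_minus(3)[OF Lifts_module F_module _ z w])
    then show ?thesis
      using module.coset_eq_iff[OF F_module coboundaries_submodule(3)] obstruction_F zw by blast
  qed
  have "\<exists>h\<in>lin_hom k C (H 2). \<forall>z\<in>carrier Lifts.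
      h (cls (fst z)) = coboundaries 2 +>\<^bsub>F 2\<^esub> obstruction z"
    by (rule factor_lin_hom[OF p lin_hom_comp[OF obstruction_lin coh_proj(1)[OF coboundaries_submodule(3)]]
          onto module_carrier_closed(1,2)[OF Lifts_module] cong])
  then show ?thesis by simp
qed

text \<open>Along the projections from cocycles, centre and lifts each claim becomes one about
  pairs: injectivity at \<open>H 1\<close> is \<open>cochain_pair_\<delta>_iff\<close>, exactness at
  \<open>PZ0\<close> comes from \<open>lift_of_boundary\<close>, and exactness at \<open>C\<close>
  from \<open>lift_correction\<close>. The last two clauses pin \<open>f\<close> and
  \<open>g\<close> down as the natural maps.\<close>

theorem centre_exact_sequence:
  assumes "field k"
  shows "\<exists>f g h. f \<in> lin_hom k (H 1) PZ0 \<and> g \<in> lin_hom k PZ0 C \<and> h \<in> lin_hom k C (H 2) \<and>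
    a_kernel (H 1) PZ0 f = {\<zero>\<^bsub>H 1\<^esub>} \<and> exact_at (H 1) f PZ0 g C \<and> exact_at PZ0 g C h (H 2) \<and>
    (\<forall>\<phi>\<in>cocycles 1. f (ce_class k P0 P1 (pi_act act) 1 \<phi>) =
       cls_Z (\<zero>\<^bsub>L0\<^esub>, \<lambda>t\<in>carrier L0. \<phi> [cls t])) \<and>
    (\<forall>z\<in>carrier Z. g (cls_Z z) = cls (fst z))"
proof -
  obtain f where f: "f \<in> lin_hom k (H 1) PZ0"
    and f_eq: "\<And>\<phi>. \<phi> \<in> cocycles 1 \<Longrightarrow> f (coboundaries 1 +>\<^bsub>F 1\<^esub> \<phi>) = cls_Z (cochain_pair \<phi>)"
    using connecting_f by blast
  obtain g where g: "g \<in> lin_hom k PZ0 C"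
    and g_eq: "\<And>z. z \<in> carrier Z \<Longrightarrow> g (cls_Z z) = cls (fst z)"
    using connecting_g by blast
  obtain h where h: "h \<in> lin_hom k C (H 2)"
    and h_eq: "\<And>z. z \<in> lifts \<Longrightarrow> h (cls (fst z)) = coboundaries 2 +>\<^bsub>F 2\<^esub> obstruction z"
    using connecting_h[OF assms] by blast
  note H1 = coh_proj(2)[OF coboundaries_submodule(2)]
  have pair_Z: "cochain_pair \<phi> \<in> carrier Z" if "\<phi> \<in> cocycles 1" for \<phi>
    using that cochain_pair_Z_iff by (simp add: cocycle_1_iff)
  have h_zero: "h (cls (fst z)) = \<zero>\<^bsub>H 2\<^esub> \<longleftrightarrow> obstruction z \<in> coboundaries 2" if "z \<in> lifts" for z
    unfolding h_eq[OF that] zero_H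
    by (rule module.coset_eq_self_iff[OF F_module coboundaries_submodule(3) obstruction_F[OF that]])
  have "a_kernel (H 1) PZ0 f = {\<zero>\<^bsub>H 1\<^esub>}"
  proof -
    have eq: "f (coboundaries 1 +>\<^bsub>F 1\<^esub> \<phi>) = \<zero>\<^bsub>PZ0\<^esub> \<longleftrightarrow> coboundaries 1 +>\<^bsub>F 1\<^esub> \<phi> = \<zero>\<^bsub>H 1\<^esub>"
      if \<phi>: "\<phi> \<in> cocycles 1" for \<phi>
    proof -
      have "\<phi> \<in> carrier (F 1)" using \<phi> cocycles_subset by blast
      then show ?thesis
        unfolding f_eq[OF \<phi>] zero_PZ0 zero_H
          module.coset_eq_self_iff[OF Z_module submodule_\<delta> pair_Z[OF \<phi>]]
          module.coset_eq_self_iff[OF F_module coboundaries_submodule(2)]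
        by (simp add: cochain_pair_\<delta>_iff[OF \<phi>]
            module.coset_eq_self_iff[OF F_module coboundaries_submodule(2)])
    qed
    have "\<zero>\<^bsub>H 1\<^esub> \<in> carrier (H 1)"
    proof -
      have "\<zero>\<^bsub>F 1\<^esub> \<in> cocycles 1"
        using subgroup.one_closed[OF submodule.axioms(1)[OF cocycles_1_submodule]] by simp
      moreover have "coboundaries 1 +>\<^bsub>F 1\<^esub> \<zero>\<^bsub>F 1\<^esub> = \<zero>\<^bsub>H 1\<^esub>"
        unfolding zero_H
          module.coset_eq_self_iff[OF F_module coboundaries_submodule(2) module_carrier_closed(3)[OF F_module]]
        using subgroup.one_closed[OF submodule.axioms(1)[OF coboundaries_submodule(2)]] by simp
      ultimately show ?thesis unfolding H1 by force
    qed
    moreover have "f X = \<zero>\<^bsub>PZ0\<^esub> \<longleftrightarrow> X = \<zero>\<^bsub>H 1\<^esub>" if X: "X \<in> carrier (H 1)" for X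
    proof -
      obtain \<phi> where "\<phi> \<in> cocycles 1" "X = coboundaries 1 +>\<^bsub>F 1\<^esub> \<phi>"
        using X unfolding H1 by blast
      then show ?thesis by (simp only: eq)
    qed
    ultimately show ?thesis unfolding a_kernel_eq by blast
  qed
  moreover have "exact_at (H 1) f PZ0 g C"
    unfolding exact_at_def
  proof
    show "f ` carrier (H 1) \<subseteq> a_kernel PZ0 C g"
    proof
      fix Y assume "Y \<in> f ` carrier (H 1)"
      then obtain \<phi> where \<phi>: "\<phi> \<in> cocycles 1" "Y = cls_Z (cochain_pair \<phi>)"
        using f_eq by (auto simp: H1)
      have "cls \<zero>\<^bsub>L0\<^esub> = bd ` carrier L1"
        using subgroup.one_closed[OF submodule.axioms(1)[OF submodule_Im]] by (simp add: cls_eq_Im_iff)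
      then have "g Y = \<zero>\<^bsub>C\<^esub>"
        using g_eq[OF pair_Z[OF \<phi>(1)]] by (simp add: \<phi>(2) zero_C cochain_pair_def)
      then show "Y \<in> a_kernel PZ0 C g"
        using pair_Z[OF \<phi>(1)] by (auto simp: a_kernel_eq carrier_PZ0 \<phi>(2))
    qed
    show "a_kernel PZ0 C g \<subseteq> f ` carrier (H 1)"
    proof
      fix Y assume "Y \<in> a_kernel PZ0 C g"
      then obtain z where z: "z \<in> carrier Z" "Y = cls_Z z" and gz: "g Y = \<zero>\<^bsub>C\<^esub>"
        by (auto simp: a_kernel_eq carrier_PZ0)
      have "fst z \<in> bd ` carrier L1"
        using gz g_eq[OF z(1)] cls_eq_Im_iff[OF ZD(1)[OF z(1)]] by (simp add: z(2) zero_C)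
      then obtain c where c: "c \<in> carrier L1" "fst z = bd c" by blast
      have "z \<in> lifts" using z(1) Z_subset_lifts by blast
      then obtain \<phi> where \<phi>: "\<phi> \<in> carrier (cochains 1)" "z = cochain_pair \<phi> \<oplus>\<^bsub>Z\<^esub> \<delta> c"
        using c by (rule lift_of_boundary)
      have v: "cochain_pair \<phi> \<in> carrier Lifts" using cochain_pair_lifts[OF \<phi>(1)] by simp
      have \<delta>: "\<delta> c \<in> carrier Z" by (rule \<delta>_mem[OF c(1)])
      then have \<delta>L: "\<delta> c \<in> lifts" using Z_subset_lifts by blast
      \<comment> \<open>The obstruction is additive and vanishes on \<open>z\<close> and on
        \<open>\<delta> c\<close>, both in the centre. Hence it vanishes on the remaining pair,
        whose cochain is then a cocycle.\<close>
      have "obstruction z = obstruction (cochain_pair \<phi>) \<oplus>\<^bsub>F 2\<^esub> obstruction (\<delta> c)"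
        using lin_homD(2)[OF obstruction_lin, of "cochain_pair \<phi>" "\<delta> c"] v \<delta>L by (simp add: \<phi>(2))
      moreover have "obstruction z = \<zero>\<^bsub>F 2\<^esub>" "obstruction (\<delta> c) = \<zero>\<^bsub>F 2\<^esub>"
        using z(1) \<delta> Z_subset_lifts lift_in_Z_iff by blast+
      moreover have "obstruction (cochain_pair \<phi>) \<in> carrier (F 2)"
        using v by (intro obstruction_F) simp
      ultimately have "obstruction (cochain_pair \<phi>) = \<zero>\<^bsub>F 2\<^esub>"
        by (simp add: abelian_monoid.r_zero[OF abelian_group.axioms(1)[OF module.axioms(2)[OF F_module]]])
      then have "cochain_pair \<phi> \<in> carrier Z"
        using lift_in_Z_iff v by simp
      then have \<phi>1: "\<phi> \<in> cocycles 1" using cochain_pair_Z_iff[OF \<phi>(1)] by blast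
      interpret Z: module k Z by (rule Z_module)
      \<comment> \<open>The difference is a value of \<open>\<delta>\<close>, so \<open>z\<close>
        has the same class as the pair of a cocycle, which is a value of \<open>f\<close>.\<close>
      have "z \<ominus>\<^bsub>Z\<^esub> cochain_pair \<phi> = \<delta> c"
        using pair_Z[OF \<phi>1] \<delta> by (simp add: \<phi>(2) a_minus_def Z.M.a_comm[of "cochain_pair \<phi>"] Z.M.a_assoc Z.M.r_neg
          del: Z_record)
      then have "Y = cls_Z (cochain_pair \<phi>)"
        unfolding z(2) module.coset_eq_iff[OF Z_module submodule_\<delta> z(1) pair_Z[OF \<phi>1]]
        using c(1) by simp
      then have "Y = f (coboundaries 1 +>\<^bsub>F 1\<^esub> \<phi>)" by (simp add: f_eq[OF \<phi>1])
      then show "Y \<in> f ` carrier (H 1)" using \<phi>1 by (auto simp: H1)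
    qed
  qed
  moreover have "exact_at PZ0 g C h (H 2)"
    unfolding exact_at_def
  proof
    show "g ` carrier PZ0 \<subseteq> a_kernel C (H 2) h"
    proof
      fix X assume "X \<in> g ` carrier PZ0"
      then obtain z where z: "z \<in> carrier Z" "X = cls (fst z)"
        using g_eq by (auto simp: carrier_PZ0)
      then have zl: "z \<in> lifts" using Z_subset_lifts by blast
      then have "obstruction z = \<zero>\<^bsub>F 2\<^esub>" using z(1) lift_in_Z_iff by blast
      then have "obstruction z \<in> coboundaries 2"
        using subgroup.one_closed[OF submodule.axioms(1)[OF coboundaries_submodule(3)]] by simp
      then show "X \<in> a_kernel C (H 2) h"
        using h_zero[OF zl] lift_cls_mem_C[OF zl] by (simp add: a_kernel_eq z(2))
    qed
    show "a_kernel C (H 2) h \<subseteq> g ` carrier PZ0"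
    proof
      fix X assume X: "X \<in> a_kernel C (H 2) h"
      then have XC: "X \<in> carrier C" "h X = \<zero>\<^bsub>H 2\<^esub>" by (simp_all add: a_kernel_eq)
      then obtain x where x: "x \<in> carrier L0" "X = cls x"
        by (auto simp: central_annihilator_def carrier_P0)
      \<comment> \<open>A lift of the class need not be a derivation; the vanishing of
        \<open>h\<close> says that its obstruction is a coboundary, which is what allows the
        correction to an element of the centre.\<close>
      then obtain z where z: "z \<in> lifts" "fst z = x"
        using lift_exists[OF assms] XC(1) by blast
      then have "obstruction z \<in> coboundaries 2" using h_zero XC(2) x(2) by blast
      then obtain w where w: "w \<in> carrier Z" "fst w = fst z"
        using lift_correction z(1) by blast
      then have "X = g (cls_Z w)" using g_eq z(2) x(2) by simp
      then show "X \<in> g ` carrier PZ0" using w(1) by (auto simp: carrier_PZ0)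
    qed
  qed
  moreover have "f (ce_class k P0 P1 (pi_act act) 1 \<phi>) = cls_Z (\<zero>\<^bsub>L0\<^esub>, \<lambda>t\<in>carrier L0. \<phi> [cls t])"
    if "\<phi> \<in> cocycles 1" for \<phi>
    using f_eq[OF that] by (simp add: ce_class_def cochains_coset cochain_pair_def)
  ultimately show ?thesis using f g h g_eq by blast
qed

end

end

theorem mainTheorem1:
  fixes k :: "('k, 'r) ring_scheme"
    and L1 :: "('k, 'a, 'm) module_scheme"
    and L0 :: "('k, 'b, 'n) lie_algebra_scheme"
    and act :: "'b \<Rightarrow> 'a \<Rightarrow> 'a"
    and bd :: "'a \<Rightarrow> 'b"
  assumes "field k"
    and "\<one>\<^bsub>k\<^esub> \<oplus>\<^bsub>k\<^esub> \<one>\<^bsub>k\<^esub> \<noteq> \<zero>\<^bsub>k\<^esub>"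
    and "crossed_module k L1 L0 act bd"
  defines "Z0 \<equiv> centre0 k L1 L0 act bd"
    and "\<delta> \<equiv> centre_bd L1 L0 act bd"
    and "P0 \<equiv> cm_pi0 L1 L0 bd"
    and "P1 \<equiv> cm_pi1 L1 L0 bd"
  defines "H \<equiv> ce_cohomology k P0 P1 (pi_act act)"
    and "PZ0 \<equiv> cm_pi0 L1 Z0 \<delta>"
    and "PZ1 \<equiv> cm_pi1 L1 Z0 \<delta>"
    and "C \<equiv> central_annihilator P0 P1 (pi_act act)"
  shows
    "(\<delta> \<in> lin_hom k L1 Z0 \<and> bilinear_on k Z0 Z0 L1 centre_br \<and>
      braided_crossed_module k L1 Z0 \<delta> centre_br) \<and>
     (lie_module k L0 Z0 (centre_act L0 act) \<and>
      crossed_module k Z0 L0 (centre_act L0 act) fst) \<and>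
     lin_iso k PZ1 (H 0) \<and>
     (\<exists>f g h. f \<in> lin_hom k (H 1) PZ0 \<and> g \<in> lin_hom k PZ0 C \<and> h \<in> lin_hom k C (H 2) \<and>
       a_kernel (H 1) PZ0 f = {\<zero>\<^bsub>H 1\<^esub>} \<and>
       exact_at (H 1) f PZ0 g C \<and>
       exact_at PZ0 g C h (H 2) \<and>
       (\<forall>\<phi>\<in>ce_cocycles k P0 P1 (pi_act act) 1.
          f (ce_class k P0 P1 (pi_act act) 1 \<phi>) =
            \<delta> ` carrier L1 +>\<^bsub>Z0\<^esub> (\<zero>\<^bsub>L0\<^esub>, \<lambda>t\<in>carrier L0. \<phi> [bd ` carrier L1 +>\<^bsub>L0\<^esub> t])) \<and>
       (\<forall>z\<in>carrier Z0. g (\<delta> ` carrier L1 +>\<^bsub>Z0\<^esub> z) = bd ` carrier L1 +>\<^bsub>L0\<^esub> fst z))"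
proof -
  interpret crossed_module k L1 L0 act bd by fact
  show ?thesis
    unfolding Z0_def \<delta>_def P0_def P1_def H_def PZ0_def PZ1_def C_def
    by (intro conjI \<delta>_lin centre_br_bilinear centre_braided centre_act_lie_module centre_crossed
        H0_iso centre_exact_sequence[OF assms(1)])
qed

end
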